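(* Let $d\in\{2,3\}$, and let $r>2$ if $d=2$, $r=3$ if $d=3$. Let $\mathbf A\in\mathrm L^r_{\mathrm{loc}}(\mathbb R^d;\mathbb R^d)$ be a magnetic potential with $\mathbf B=\mathrm{curl}\,\mathbf A$, such that $\|\nabla_{\mathbf A}\psi\|_2^2\ge\Lambda\|\psi\|_2^2$ for all $\psi\in\mathrm H^1_{\mathbf A}(\mathbb R^d)$ for some $\Lambda=\Lambda[\mathbf B]>0$, with equality for some nonzero $\psi\in\mathrm H^1_{\mathbf A}(\mathbb R^d)$. Assume moreover $\lim_{\sigma\to+\infty}\sigma^{d-2}\int_{\mathbb R^d}|\mathbf A(x)|^2e^{-\sigma|x|}\,dx=0$ in case (i) and $\lim_{\sigma\to+\infty}\sigma^{d-2}\int_{|x|<1/\sigma}|\mathbf A(x)|^2\,dx=0$ in case (ii). Let $\phi\in\mathrm L^1_{\mathrm{loc}}(\mathbb R^d)$ be an arbitrary (real-valued) potential. (i) If $q>d/2$, $p=\frac{2q}{q-1}$ and $\alpha_{\mathbf B}$ is the function defined in the context for this $p$, then $$\lambda_{\mathbf A,\phi}\ge-\Big(\alpha_{\mathbf B}\big(\|\lambda-\phi\|_{q,+}\big)-\lambda\Big).$$ (ii) If $q\in(1,+\infty)$, $p=\frac{2q}{q+1}$ and $\nu_{\mathbf B}$ is the function defined in the context for this $p$, then $$\lambda_{\mathbf A,\phi}\ge\lambda+\nu_{\mathbf B}\big(\|(\phi-\lambda)^{-1}\|_q^{-1}\big).$$ These estimates hold for any $\lambda\in\mathbb R$ such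 that the norms appearing in them are well defined (finite), with the additional condition that $\phi\ge\lambda$ a.e. in case (ii).
   Context: Notation. $2^*=+\infty$ if $d=2$ and $2^*=6$ if $d=3$. $\|\cdot\|_q$ is the norm of $\mathrm L^q(\mathbb R^d)$ ($=+\infty$ outside $\mathrm L^q$), and $\|u\|_{q,+}:=\big(\int_{\{u>0\}}u^q\,dx\big)^{1/q}$ for real-valued $u$. $\nabla_{\mathbf A}:=\nabla+i\mathbf A$ and $\mathrm H^1_{\mathbf A}(\mathbb R^d):=\{\psi\in\mathrm L^2(\mathbb R^d):\nabla_{\mathbf A}\psi\in\mathrm L^2(\mathbb R^d)\}$. $\Lambda[\mathbf B]$ is the optimal constant in $\|\nabla_{\mathbf A}\psi\|_2^2\ge\Lambda[\mathbf B]\|\psi\|_2^2$, $\psi\in\mathrm H^1_{\mathbf A}(\mathbb R^d)$. For $p\in(2,2^* )$ and $\alpha>-\Lambda$, $\mu_{\mathbf B}(\alpha)$ is the largest constant such that $\|\nabla_{\mathbf A}\psi\|_2^2+\alpha\|\psi\|_2^2\ge\mu_{\mathbf B}(\alpha)\|\psi\|_p^2$ for all $\psi\in\mathrm H^1_{\mathbf A}(\mathbb R^d)$; under the assumptions of case (i), $\mu_{\mathbf B}$ is an increasing bijection from $(-\Lambda,+\infty)$ onto $(0,+\infty)$ and $\alpha_{\mathbf B}:(0,+\infty)\to(-\Lambda,+\infty)$ denotes its inverse, extended by $\alpha_{\mathbf B}(0):=-\Lambda$. For $p\in(1,2)$ and $\beta>0$, $\nu_{\mathbf B}(\beta)$ is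 the largest constant such that $\|\nabla_{\mathbf A}\psi\|_2^2+\beta\|\psi\|_p^2\ge\nu_{\mathbf B}(\beta)\|\psi\|_2^2$ for all $\psi\in\mathrm H^1_{\mathbf A}(\mathbb R^d)$. $\lambda_{\mathbf A,\phi}$ is the principal (lowest) eigenvalue of $-\Delta_{\mathbf A}+\phi$, understood as the infimum of $\int_{\mathbb R^d}(|\nabla_{\mathbf A}\psi|^2+\phi|\psi|^2)\,dx$ over $\psi\in\mathrm H^1_{\mathbf A}(\mathbb R^d)$ with $\|\psi\|_2=1$ and $\int_{\mathbb R^d}\phi_+|\psi|^2dx<+\infty$, where $\phi_+=\max(\phi,0)$. *)

theory Defs
  imports "HOL-Analysis.Analysis"
begin

text \<open>
  Powers on \<open>[0, \<infinity>]\<close>, used for positive exponents only. Function spaces below consist of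
  functions, not of classes modulo null sets, and a norm is infinite outside its space.
\<close>

definition epowr :: "ennreal \<Rightarrow> real \<Rightarrow> ennreal" (infixr "epowr" 80) where
  "x epowr s = (if x = top then top else ennreal (enn2real x powr s))"

text \<open>
  The \<open>L\<^sup>q\<close> norm of a nonnegative function that may take the value \<open>\<infinity>\<close>. This is needed for
  \<open>(\<phi> - \<lambda>)\<^sup>-\<^sup>1\<close>, which is \<open>\<infinity>\<close>, and not \<open>0\<close> as with real division, where \<open>\<phi> = \<lambda>\<close>.
\<close>

definition Lnorm_abs :: "real \<Rightarrow> ('a::euclidean_space \<Rightarrow> ennreal) \<Rightarrow> ennreal" where
  "Lnorm_abs q f = (\<integral>\<^sup>+ x. f x epowr q \<partial>lebesgue) epowr (1 / q)"

definition Lnorm :: "real \<Rightarrow> ('a::euclidean_space \<Rightarrow> 'b::real_normed_vector) \<Rightarrow> ereal" where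
  "Lnorm q u = enn2ereal (Lnorm_abs q (\<lambda>x. ennreal (norm (u x))))"

definition Lnorm_pos :: "real \<Rightarrow> ('a::euclidean_space \<Rightarrow> real) \<Rightarrow> ennreal" where
  "Lnorm_pos q u = (\<integral>\<^sup>+ x\<in>{x. u x > 0}. ennreal (u x powr q) \<partial>lebesgue) epowr (1 / q)"

definition Lspace :: "real \<Rightarrow> ('a::euclidean_space \<Rightarrow> 'b::euclidean_space) set" where
  "Lspace q = {u \<in> borel_measurable lebesgue. Lnorm q u < \<infinity>}"

definition Lloc :: "real \<Rightarrow> ('a::euclidean_space \<Rightarrow> 'b::euclidean_space) set" where
  "Lloc q = {u \<in> borel_measurable lebesgue.
     \<forall>K. compact K \<longrightarrow> (\<integral>\<^sup>+ x\<in>K. ennreal (norm (u x) powr q) \<partial>lebesgue) < \<infinity>}"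

primrec cont_diff :: "nat \<Rightarrow> ('a::euclidean_space \<Rightarrow> real) \<Rightarrow> bool" where
  "cont_diff 0 f \<longleftrightarrow> continuous_on UNIV f"
| "cont_diff (Suc k) f \<longleftrightarrow>
     (\<forall>x. f differentiable at x) \<and> (\<forall>v. cont_diff k (\<lambda>x. frechet_derivative f (at x) v))"

definition test_function :: "('a::euclidean_space \<Rightarrow> real) \<Rightarrow> bool" where
  "test_function \<eta> \<longleftrightarrow> (\<forall>k. cont_diff k \<eta>) \<and> compact (closure {x. \<eta> x \<noteq> 0})"

text \<open>
  \<open>g\<close> is square integrable and equals \<open>\<nabla>\<psi> + iA\<psi>\<close> in the sense of distributions, that is,
  the distributional gradient of \<open>\<psi>\<close> is \<open>g - iA\<psi>\<close>. For \<open>A\<close> locally square integrable and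
  \<open>\<psi>\<close> square integrable, all integrands below are integrable.
  Real-valued test functions suffice by linearity.
\<close>

definition is_mag_grad ::
  "(real^'n \<Rightarrow> real^'n) \<Rightarrow> (real^'n \<Rightarrow> complex) \<Rightarrow> (real^'n \<Rightarrow> complex^'n) \<Rightarrow> bool" where
  "is_mag_grad A \<psi> g \<longleftrightarrow> g \<in> Lspace 2 \<and>
     (\<forall>j \<eta>. test_function \<eta> \<longrightarrow>
        (LINT x|lebesgue. frechet_derivative \<eta> (at x) (axis j 1) *\<^sub>R \<psi> x) =
        - (LINT x|lebesgue. \<eta> x *\<^sub>R (g x $ j - \<i> * complex_of_real (A x $ j) * \<psi> x)))"

definition H1 :: "(real^'n \<Rightarrow> real^'n) \<Rightarrow> (real^'n \<Rightarrow> complex) set" where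
  "H1 A = {\<psi> \<in> Lspace 2. \<exists>g. is_mag_grad A \<psi> g}"

text \<open>The choice is unique up to a null set for \<open>\<psi>\<close> in \<open>H1 A\<close>.\<close>

definition mag_grad ::
  "(real^'n \<Rightarrow> real^'n) \<Rightarrow> (real^'n \<Rightarrow> complex) \<Rightarrow> (real^'n \<Rightarrow> complex^'n)" where
  "mag_grad A \<psi> = (SOME g. is_mag_grad A \<psi> g)"

text \<open>
  By gauge invariance these constants depend on \<open>A\<close> only through \<open>B = curl A\<close>, whence the
  notation \<open>\<Lambda>[B]\<close>, \<open>\<mu>\<^sub>B\<close>, \<open>\<alpha>\<^sub>B\<close>, \<open>\<nu>\<^sub>B\<close>; they are defined in terms of \<open>A\<close>, so that
  the distribution \<open>B\<close> itself is not needed.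
\<close>

definition Lambda_B :: "(real^'n \<Rightarrow> real^'n) \<Rightarrow> real" where
  "Lambda_B A = (GREATEST c. \<forall>\<psi>\<in>H1 A.
     (Lnorm 2 (mag_grad A \<psi>))\<^sup>2 \<ge> ereal c * (Lnorm 2 \<psi>)\<^sup>2)"

text \<open>\<open>mu_B A p \<alpha>\<close> is meant for \<open>\<alpha> > - Lambda_B A\<close>.\<close>

definition mu_B :: "(real^'n \<Rightarrow> real^'n) \<Rightarrow> real \<Rightarrow> real \<Rightarrow> real" where
  "mu_B A p \<alpha> = (GREATEST c. \<forall>\<psi>\<in>H1 A.
     (Lnorm 2 (mag_grad A \<psi>))\<^sup>2 + ereal \<alpha> * (Lnorm 2 \<psi>)\<^sup>2 \<ge> ereal c * (Lnorm p \<psi>)\<^sup>2)"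

definition alpha_B :: "(real^'n \<Rightarrow> real^'n) \<Rightarrow> real \<Rightarrow> real \<Rightarrow> real" where
  "alpha_B A p t =
     (if t = 0 then - Lambda_B A else inv_into {- Lambda_B A<..} (mu_B A p) t)"

definition nu_B :: "(real^'n \<Rightarrow> real^'n) \<Rightarrow> real \<Rightarrow> real \<Rightarrow> real" where
  "nu_B A p \<beta> = (GREATEST c. \<forall>\<psi>\<in>H1 A.
     (Lnorm 2 (mag_grad A \<psi>))\<^sup>2 + ereal \<beta> * (Lnorm p \<psi>)\<^sup>2 \<ge> ereal c * (Lnorm 2 \<psi>)\<^sup>2)"

definition admissible ::
  "(real^'n \<Rightarrow> real^'n) \<Rightarrow> (real^'n \<Rightarrow> real) \<Rightarrow> (real^'n \<Rightarrow> complex) set" where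
  "admissible A \<phi> = {\<psi> \<in> H1 A. Lnorm 2 \<psi> = 1 \<and>
     (\<integral>\<^sup>+ x. ennreal (max (\<phi> x) 0 * (norm (\<psi> x))\<^sup>2) \<partial>lebesgue) < \<infinity>}"

text \<open>
  The integral of \<open>|\<nabla>\<^sub>A\<psi>|\<^sup>2 + \<phi>|\<psi>|\<^sup>2\<close>, split so that the value is \<open>-\<infinity>\<close> when the negative
  part of \<open>\<phi>|\<psi>|\<^sup>2\<close> is not integrable. The first integral is finite on \<open>admissible A \<phi>\<close>.
\<close>

definition energy :: "(real^'n \<Rightarrow> real^'n) \<Rightarrow> (real^'n \<Rightarrow> real) \<Rightarrow> (real^'n \<Rightarrow> complex) \<Rightarrow> ereal" where
  "energy A \<phi> \<psi> =
     enn2ereal (\<integral>\<^sup>+ x. ennreal ((norm (mag_grad A \<psi> x))\<^sup>2 + max (\<phi> x) 0 * (norm (\<psi> x))\<^sup>2) \<partial>lebesgue)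
     - enn2ereal (\<integral>\<^sup>+ x. ennreal (max (- \<phi> x) 0 * (norm (\<psi> x))\<^sup>2) \<partial>lebesgue)"

definition principal_eigenvalue :: "(real^'n \<Rightarrow> real^'n) \<Rightarrow> (real^'n \<Rightarrow> real) \<Rightarrow> ereal" where
  "principal_eigenvalue A \<phi> = (INF \<psi>\<in>admissible A \<phi>. energy A \<phi> \<psi>)"

end

theory Submission
  imports Defs
begin

text \<open>
  For a normalized \<open>\<psi>\<close>, Hoelder's inequality bounds \<open>\<integral>(\<lambda> - \<phi>)\<^sub>+|\<psi>|\<^sup>2\<close> by \<open>t\<parallel>\<psi>\<parallel>\<^sub>p\<^sup>2\<close> with
  \<open>t = \<parallel>\<lambda> - \<phi>\<parallel>\<^bsub>q,+\<^esub>\<close>, and the reverse inequality bounds \<open>\<integral>(\<phi> - \<lambda>)|\<psi>|\<^sup>2\<close> from below by \<open>\<beta>\<parallel>\<psi>\<parallel>\<^sub>p\<^sup>2\<close>,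
  so that the energy is controlled by the interpolation inequalities defining \<open>\<alpha>\<^sub>B(t)\<close> and \<open>\<nu>\<^sub>B(\<beta>)\<close>.
  What remains is that these constants exist, and that \<open>\<mu>\<^sub>B\<close> attains every \<open>t > 0\<close>. The latter needs
  \<open>\<parallel>\<psi>\<parallel>\<^sub>p\<^sup>2 \<le> \<epsilon>\<parallel>\<nabla>\<^sub>A\<psi>\<parallel>\<^sub>2\<^sup>2 + C\<^sub>\<epsilon>\<parallel>\<psi>\<parallel>\<^sub>2\<^sup>2\<close> for \<open>2 < p < 2\<^sup>*\<close>. To obtain it, one shows by duality that \<open>\<psi>\<close>
  is absolutely continuous along almost every line; since the term \<open>iA\<psi>\<close> is orthogonal to \<open>\<psi>\<close>, this gives the
  diamagnetic estimate \<open>\<parallel>|\<psi>|(\<cdot> + v) - |\<psi>|\<parallel>\<^sub>2 \<le> 2|v|\<parallel>\<nabla>\<^sub>A\<psi>\<parallel>\<^sub>2\<close>, which bounds all fractional Gagliardo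
  seminorms of \<open>|\<psi>|\<close> of order less than \<open>1\<close>, and the fractional Sobolev inequality applies.
\<close>

section \<open>Fractional Sobolev inequality\<close>

text \<open>The constants are defined by \<open>GREATEST\<close> and \<open>inv_into\<close>, which
  say nothing unless a maximum or a preimage exists. For \<open>alpha_B\<close> existence rests on
  the minimizer of the spectral gap and on the interpolation inequality. For \<open>nu_B\<close> the
  obstacle is that elements of \<open>H1 A\<close> may have infinite norm of order p < 2, so an
  element of finite energy is made by a cut-off. The detour through translations has this reason:
  the distributional gradient of \<psi> is g - iA\<psi>, with A\<psi> only locally integrable, so
  square integrability of the gradient of |\<psi>| cannot be read off. The translation estimate is
  the difference-quotient form of that property and can be proved line by line, without mollifying
  and without differentiating |\<psi>|. Passing from order 1 to orders \<sigma> < 1 loses only the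
  endpoint: with p = 2q/(q-1), the Sobolev relation 1/p = 1/2 - \<sigma>/d reads \<sigma> = d/(2q),
  so \<sigma> < 1 is exactly q > d/2. The small \<epsilon> comes from the dilation x -> cx, which
  multiplies the gradient term by a power of c higher by 2 than the power multiplying the mass
  term.\<close>

lemma nn_integral_lborel_translate:
  fixes f :: "'a::euclidean_space \<Rightarrow> ennreal"
  assumes [measurable]: "f \<in> borel_measurable borel"
  shows "(\<integral>\<^sup>+x. f (x + v) \<partial>lborel) = (\<integral>\<^sup>+x. f x \<partial>lborel)"
proof -
  have "(\<integral>\<^sup>+x. f x \<partial>lborel) = (\<integral>\<^sup>+x. f x \<partial>distr lborel borel ((+) v))"
    by (simp only: lborel_distr_plus)
  also have "\<dots> = (\<integral>\<^sup>+x. f (v + x) \<partial>lborel)"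
    by (subst nn_integral_distr) auto
  finally show ?thesis by (simp only: add.commute)
qed

section \<open>Integrability of powers of the norm near zero and near infinity\<close>

lemma dyadic_scale:
  fixes t :: real assumes "t \<ge> 1"
  obtains k :: nat where "2 powr k \<le> t" "t < 2 powr (real k + 1)"
proof -
  define k where "k = nat \<lfloor>log 2 t\<rfloor>"
  have "log 2 t \<ge> 0" using assms by simp
  then have "real k \<le> log 2 t" "log 2 t < real k + 1"
    unfolding k_def by linarith+
  then have "2 powr k \<le> t" "t < 2 powr (real k + 1)"
    using assms le_log_iff[of 2 t "real k"] log_less_iff[of 2 t "real k + 1"] by auto
  with that show ?thesis by blast
qed

text \<open>Stands in for polar coordinates: on \<open>S\<close> the function lies below the sum of
  the \<open>a k\<close> times indicators of balls. Overlaps only enlarge the sum, so concentric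
  balls can be used instead of annuli.\<close>

lemma nn_integral_le_suminf_balls:
  fixes f :: "'a::euclidean_space \<Rightarrow> real" and a R :: "nat \<Rightarrow> real"
  assumes pos: "\<And>k. a k \<ge> 0" "\<And>k. R k \<ge> 0"
    and sm: "summable (\<lambda>k. a k * R k ^ DIM('a))"
    and cov: "\<And>v. v \<in> S \<Longrightarrow> \<exists>k. v \<in> ball 0 (R k) \<and> f v \<le> a k"
  shows "(\<integral>\<^sup>+v\<in>S. ennreal (f v) \<partial>lborel) < \<infinity>"
proof -
  have [measurable]: "ball (0::'a) r \<in> sets borel" for r by simp
  have "(\<integral>\<^sup>+v\<in>S. ennreal (f v) \<partial>lborel) \<le> (\<integral>\<^sup>+v. (\<Sum>k. ennreal (a k) * indicator (ball (0::'a) (R k)) v) \<partial>lborel)"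
  proof (rule nn_integral_mono)
    fix v :: 'a
    show "ennreal (f v) * indicator S v \<le> (\<Sum>k. ennreal (a k) * indicator (ball 0 (R k)) v)"
    proof (cases "v \<in> S")
      case True
      then obtain k where k: "v \<in> ball 0 (R k)" "f v \<le> a k" using cov by blast
      have "ennreal (f v) * indicator S v \<le> ennreal (a k) * indicator (ball 0 (R k)) v"
        using True k by (simp add: ennreal_leI)
      also have "\<dots> = sum (\<lambda>j. ennreal (a j) * indicator (ball 0 (R j)) v) {k}"
        by (simp only: sum.insert[OF finite.emptyI empty_iff[THEN iffD1, THEN notI]] sum.empty add_0_right)
      also have "\<dots> \<le> (\<Sum>k. ennreal (a k) * indicator (ball 0 (R k)) v)"
        by (rule sum_le_suminf) auto
      finally show ?thesis .
    qed simp
  qed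
  also have "\<dots> = (\<Sum>k. ennreal (a k) * emeasure lborel (ball (0::'a) (R k)))"
    by (subst nn_integral_suminf, measurable) (auto simp: nn_integral_cmult_indicator)
  also have "\<dots> = (\<Sum>k. ennreal (unit_ball_vol DIM('a) * (a k * R k ^ DIM('a))))"
    using pos by (intro suminf_cong) (auto simp: emeasure_ball ennreal_mult[symmetric] mult_ac)
  also have "\<dots> < \<infinity>"
    using pos sm by (subst suminf_ennreal2) (auto intro!: summable_mult)
  finally show ?thesis .
qed

text \<open>Where 1/|v| lies between 2^k and 2^(k+1), the integrand is at most 2^((k+1)b), on a ball
  of volume of order 2^(-kd). The resulting series is geometric with ratio 2^(b-d).\<close>

lemma nn_integral_norm_powr_near_zero:
  fixes b :: real
  assumes "0 \<le> b" "b < DIM('a::euclidean_space)"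
  shows "(\<integral>\<^sup>+v\<in>ball (0::'a) 1. ennreal (norm v powr (- b)) \<partial>lborel) < \<infinity>"
proof (rule nn_integral_le_suminf_balls[where a = "\<lambda>k. 2 powr ((real k + 1) * b)" and R = "\<lambda>k. 2 powr (1 - real k)"])
  have "(\<lambda>k::nat. 2 powr ((real k + 1) * b) * (2 powr (1 - real k)) ^ DIM('a)) =
      (\<lambda>k. 2 powr (b + DIM('a)) * (2 powr (b - DIM('a))) ^ k)"
    by (auto simp: powr_realpow[symmetric] powr_powr powr_add[symmetric] algebra_simps)
  moreover have "summable (\<lambda>k::nat. 2 powr (b + DIM('a)) * (2 powr (b - DIM('a))) ^ k :: real)"
    using assms by (intro summable_mult summable_geometric) (simp add: powr_less_one)
  ultimately show "summable (\<lambda>k::nat. 2 powr ((real k + 1) * b) * (2 powr (1 - real k)) ^ DIM('a))" by simp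
next
  fix v :: 'a assume v: "v \<in> ball 0 1"
  show "\<exists>k::nat. v \<in> ball 0 (2 powr (1 - real k)) \<and> norm v powr (- b) \<le> 2 powr ((real k + 1) * b)"
  proof (cases "v = 0")
    \<comment> \<open>By the convention \<open>0 powr _ = 0\<close> the integrand vanishes at the
      origin, so any k will do.\<close>
    case True then show ?thesis by (auto intro!: exI[of _ 0])
  next
    case False
    then have "1 / norm v \<ge> 1" using v by simp
    then obtain k :: nat where k: "2 powr k \<le> 1 / norm v" "1 / norm v < 2 powr (real k + 1)"
      by (rule dyadic_scale)
    have "norm v \<le> 2 powr (- k)"
      using k(1) False by (simp add: powr_minus field_simps)
    also have "\<dots> < 2 powr (1 - real k)" by simp
    finally have 1: "v \<in> ball 0 (2 powr (1 - real k))" by simp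
    have "norm v powr (- b) = (1 / norm v) powr b"
      using False by (simp add: powr_minus powr_divide field_simps)
    also have "\<dots> \<le> (2 powr (real k + 1)) powr b"
      using k(2) assms by (intro powr_mono2) auto
    also have "\<dots> = 2 powr ((real k + 1) * b)" by (simp add: powr_powr)
    finally show ?thesis using 1 by blast
  qed
qed auto

text \<open>The same dyadic argument outwards; the ratio of the geometric series is now
  2^(d-b).\<close>

lemma nn_integral_norm_powr_near_infinity:
  fixes b :: real
  assumes "b > DIM('a::euclidean_space)"
  shows "(\<integral>\<^sup>+v\<in>- ball (0::'a) 1. ennreal (norm v powr (- b)) \<partial>lborel) < \<infinity>"
proof (rule nn_integral_le_suminf_balls[where a = "\<lambda>k. 2 powr (- (real k * b))" and R = "\<lambda>k. 2 powr (real k + 1)"])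
  have "(\<lambda>k::nat. 2 powr (- (real k * b)) * (2 powr (real k + 1)) ^ DIM('a)) =
      (\<lambda>k. 2 powr (DIM('a)) * (2 powr (DIM('a) - b)) ^ k)"
    by (auto simp: powr_realpow[symmetric] powr_powr powr_add[symmetric] algebra_simps)
  moreover have "summable (\<lambda>k::nat. 2 powr (DIM('a)) * (2 powr (DIM('a) - b)) ^ k :: real)"
    using assms by (intro summable_mult summable_geometric) (simp add: powr_less_one)
  ultimately show "summable (\<lambda>k::nat. 2 powr (- (real k * b)) * (2 powr (real k + 1)) ^ DIM('a))" by simp
next
  fix v :: 'a assume v: "v \<in> - ball 0 1"
  then have "norm v \<ge> 1" by simp
  then obtain k :: nat where k: "2 powr k \<le> norm v" "norm v < 2 powr (real k + 1)"
    by (rule dyadic_scale)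
  have "norm v powr (- b) \<le> (2 powr k) powr (- b)"
    using k(1) assms by (intro powr_mono2') auto
  also have "\<dots> = 2 powr (- (real k * b))" by (simp add: powr_powr)
  finally show "\<exists>k::nat. v \<in> ball 0 (2 powr (real k + 1)) \<and> norm v powr (- b) \<le> 2 powr (- (real k * b))"
    using k by (intro exI[of _ k]) (auto simp: add.commute)
qed auto

text \<open>
  By Chebyshev, \<open>{u > u(x)/2}\<close> fills at most half of a ball around \<open>x\<close> of volume \<open>2n(2/u(x))\<^sup>p\<close>, and
  the difference is at least \<open>u(x)/2\<close> on the rest of the ball.
\<close>

lemma gagliardo_seminorm_pointwise_lower_bound:
  fixes u :: "'a::euclidean_space \<Rightarrow> real"
  defines "d \<equiv> real DIM('a)"
  assumes [measurable]: "u \<in> borel_measurable borel"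
    and u: "\<And>x. u x \<ge> 0" and s: "\<sigma> > 0" and p: "p > 0" "p = 2 + 2 * \<sigma> * p / d"
    and n: "(\<integral>\<^sup>+x. ennreal (u x powr p) \<partial>lborel) = ennreal n" "n > 0"
  shows "ennreal (1/4 * (unit_ball_vol d / 2) powr (1 + 2 * \<sigma> / d) * 2 powr (- 2 * p * \<sigma> / d) * n powr (- 2 * \<sigma> / d) * u x powr p)
    \<le> (\<integral>\<^sup>+v. ennreal ((u (x + v) - u x)\<^sup>2 * norm v powr (- d - 2 * \<sigma>)) \<partial>lborel)"
proof (cases "u x = 0")
  case True
  then show ?thesis using p by simp
next
  case False
  define l where "l = u x"
  have l: "l > 0" using False u[of x] by (simp add: l_def)
  have d: "d > 0" by (simp add: d_def)
  define w where "w = unit_ball_vol d"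
  have w: "w > 0" by (simp add: w_def d_def)
  define m where "m = n * (2 / l) powr p"
  have m: "m > 0" using n l by (simp add: m_def)
  define r where "r = (2 * m / w) powr (1 / d)"
  have r: "r > 0" using m w by (simp add: r_def)
  have vol: "w * r ^ DIM('a) = 2 * m"
    using d m w r by (simp add: r_def powr_realpow[symmetric] powr_powr) (simp add: d_def)
  define E where "E = {y. u y > l / 2}"
  have [measurable]: "E \<in> sets borel" unfolding E_def by measurable
  have E: "emeasure lborel E \<le> ennreal m"
  proof -
    have "emeasure lborel E = (\<integral>\<^sup>+y. indicator E y \<partial>lborel)" by simp
    also have "\<dots> \<le> (\<integral>\<^sup>+y. ennreal ((2 / l) powr p) * ennreal (u y powr p) \<partial>lborel)"
    proof (intro nn_integral_mono)
      fix y :: 'a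
      have "1 \<le> (2 / l) powr p * u y powr p" if "u y > l / 2"
      proof -
        have "1 \<le> (2 / l * u y) powr p" using that l p by (intro ge_one_powr_ge_zero) (auto simp: field_simps)
        then show ?thesis using l u[of y] by (simp only: powr_mult[of "2 / l" "u y"])
      qed
      then show "indicator E y \<le> ennreal ((2 / l) powr p) * ennreal (u y powr p)"
        by (auto simp: E_def indicator_def ennreal_mult[symmetric])
    qed
    also have "\<dots> = ennreal m"
      using n by (subst nn_integral_cmult) (auto simp: m_def ennreal_mult[symmetric] mult.commute)
    finally show ?thesis .
  qed
  define F where "F = {v. x + v \<in> E}"
  have [measurable]: "F \<in> sets borel" unfolding F_def by measurable
  have F: "emeasure lborel F \<le> ennreal m"
  proof -
    have "emeasure lborel F = (\<integral>\<^sup>+v. indicator F v \<partial>lborel)" by simp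
    also have "\<dots> = (\<integral>\<^sup>+v. indicator E (v + x) \<partial>lborel)"
      by (intro nn_integral_cong) (auto simp: F_def indicator_def add.commute)
    also have "\<dots> = emeasure lborel E"
      by (subst nn_integral_lborel_translate) auto
    finally show ?thesis using E by simp
  qed
  have diff: "ennreal m \<le> emeasure lborel (ball 0 r - F)"
  proof -
    have "ennreal (2 * m) = emeasure lborel (ball (0::'a) r)"
      using r vol by (simp add: emeasure_ball w_def d_def)
    also have "\<dots> \<le> emeasure lborel (ball 0 r - F) + emeasure lborel F"
      by (rule order_trans[OF emeasure_mono emeasure_subadditive]) auto
    also have "\<dots> \<le> emeasure lborel (ball 0 r - F) + ennreal m"
      by (intro add_left_mono F)
    finally have *: "ennreal m + ennreal m \<le> emeasure lborel (ball 0 r - F) + ennreal m"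
      using m by (simp add: ennreal_plus[symmetric] del: ennreal_plus)
    show ?thesis
    proof (cases "emeasure lborel (ball 0 r - F)")
      case (real y)
      then show ?thesis
        using * m by (simp add: ennreal_plus[symmetric] ennreal_le_iff del: ennreal_plus)
    qed simp
  qed
  have "ennreal ((l/2)\<^sup>2 * r powr (- d - 2 * \<sigma>) * m) = ennreal ((l/2)\<^sup>2 * r powr (- d - 2 * \<sigma>)) * ennreal m"
    using m by (simp add: ennreal_mult)
  also have "\<dots> \<le> ennreal ((l/2)\<^sup>2 * r powr (- d - 2 * \<sigma>)) * emeasure lborel (ball 0 r - F)"
    by (intro mult_left_mono diff) auto
  also have "\<dots> = (\<integral>\<^sup>+v. ennreal ((l/2)\<^sup>2 * r powr (- d - 2 * \<sigma>)) * indicator (ball 0 r - F) v \<partial>lborel)"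
    by (subst nn_integral_cmult_indicator) auto
  also have "\<dots> \<le> (\<integral>\<^sup>+v. ennreal ((u (x + v) - u x)\<^sup>2 * norm v powr (- d - 2 * \<sigma>)) \<partial>lborel)" (is "_ \<le> (\<integral>\<^sup>+v. ?h v \<partial>lborel)")
  proof (intro nn_integral_mono)
    fix v :: 'a
    show "ennreal ((l/2)\<^sup>2 * r powr (- d - 2 * \<sigma>)) * indicator (ball 0 r - F) v
      \<le> ?h v"
    proof (cases "v \<in> ball 0 r - F")
      case True
      then have v: "norm v < r" "u (x + v) \<le> l / 2" by (auto simp: F_def E_def)
      \<comment> \<open>At the origin the kernel has the default value 0 instead of being large, so
        this point must be excluded; it is, because u(x) = l exceeds l/2.\<close>
      have "v \<noteq> 0" using v l by (auto simp: l_def)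
      have "(l/2)\<^sup>2 \<le> (u x - u (x + v))\<^sup>2"
        using v l by (intro power_mono) (auto simp: l_def)
      moreover have "r powr (- d - 2 * \<sigma>) \<le> norm v powr (- d - 2 * \<sigma>)"
        using v \<open>v \<noteq> 0\<close> d s by (intro powr_mono2') auto
      ultimately show ?thesis
        using True by (auto intro!: ennreal_leI mult_mono simp: power2_commute)
    qed simp
  qed
  also have "(l/2)\<^sup>2 * r powr (- d - 2 * \<sigma>) * m =
      1/4 * (w / 2) powr (1 + 2 * \<sigma> / d) * 2 powr (- 2 * p * \<sigma> / d) * n powr (- 2 * \<sigma> / d) * u x powr p"
  proof -
    define k where "k = 2 * \<sigma> / d"
    have "(1 / d) * (- d - 2 * \<sigma>) = - (1 + k)"
      using d by (simp add: k_def field_simps)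
    then have a: "r powr (- d - 2 * \<sigma>) = (2 * m / w) powr (- (1 + k))"
      unfolding r_def powr_powr by simp
    have b: "(2 * m / w) powr (- (1 + k)) = (w / 2) powr (1 + k) * m powr (- (1 + k))"
    proof -
      have "2 * m / w = m / (w / 2)" by simp
      then have "(2 * m / w) powr (- (1 + k)) = 1 / (m powr (1 + k) / (w / 2) powr (1 + k))"
        using m w by (simp only: powr_minus_divide powr_divide)
      then show ?thesis by (simp only: powr_minus_divide divide_divide_eq_right mult_1_left times_divide_eq_right mult_1_right)
    qed
    have c: "m powr (- (1 + k)) * m = m powr (- k)"
      using m powr_add[of m "- (1 + k)" 1] by simp
    have e: "m powr (- k) = n powr (- k) * 2 powr (- (p * k)) * l powr (p * k)"
    proof -
      have "m powr (- k) = n powr (- k) * (2 / l) powr (- (p * k))"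
        using n l by (simp add: m_def powr_mult powr_powr)
      also have "(2 / l) powr (- (p * k)) = 2 powr (- (p * k)) * l powr (p * k)"
        using l by (simp add: powr_divide powr_minus_divide)
      finally show ?thesis by simp
    qed
    \<comment> \<open>Here the Sobolev relation enters: it makes the powers of u(x) combine to
      exactly p.\<close>
    have f: "l\<^sup>2 * l powr (2 * \<sigma> * p / d) = l powr p"
    proof -
      have "l\<^sup>2 * l powr (2 * \<sigma> * p / d) = l powr 2 * l powr (2 * \<sigma> * p / d)" using l by simp
      also have "\<dots> = l powr (2 + 2 * \<sigma> * p / d)" by (simp add: powr_add)
      finally show ?thesis using p(2) by simp
    qed
    have "(l/2)\<^sup>2 * r powr (- d - 2 * \<sigma>) * m = l\<^sup>2 / 4 * (w / 2) powr (1 + k) * (m powr (- (1 + k)) * m)"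
      unfolding a b by (simp add: power_divide)
    also have "\<dots> = 1/4 * (w / 2) powr (1 + k) * 2 powr (- (p * k)) * n powr (- k) * (l\<^sup>2 * l powr (p * k))"
      unfolding c e by simp
    also have "l\<^sup>2 * l powr (p * k) = u x powr p"
      using f by (simp add: k_def l_def mult_ac)
    also have "- (p * k) = - 2 * p * \<sigma> / d" by (simp add: k_def)
    also have "- k = - 2 * \<sigma> / d" by (simp add: k_def)
    finally show ?thesis by (simp only: k_def)
  qed
  finally show ?thesis by (simp add: w_def)
qed

text \<open>The hypothesis on p is 1/p = 1/2 - \<sigma>/d cleared of denominators. Integrating the
  pointwise bound over x gives n^(-2\<sigma>/d) * n, and this exponent is 2/p. The argument divides
  by a power of n, so n must be finite beforehand.\<close>

lemma fractional_sobolev: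
  fixes u :: "'a::euclidean_space \<Rightarrow> real"
  defines "d \<equiv> real DIM('a)"
  assumes [measurable]: "u \<in> borel_measurable borel"
    and u: "\<And>x. u x \<ge> 0" and s: "\<sigma> > 0" and p: "p > 0" "p = 2 + 2 * \<sigma> * p / d"
    and n: "(\<integral>\<^sup>+x. ennreal (u x powr p) \<partial>lborel) = ennreal n" "n \<ge> 0"
  shows "ennreal (1/4 * (unit_ball_vol d / 2) powr (1 + 2 * \<sigma> / d) * 2 powr (- 2 * p * \<sigma> / d) * n powr (2 / p))
    \<le> (\<integral>\<^sup>+x. \<integral>\<^sup>+v. ennreal ((u (x + v) - u x)\<^sup>2 * norm v powr (- d - 2 * \<sigma>)) \<partial>lborel \<partial>lborel)"
proof (cases "n = 0")
  case True then show ?thesis by simp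
next
  case False
  with n have n': "n > 0" by simp
  define c where "c = 1/4 * (unit_ball_vol d / 2) powr (1 + 2 * \<sigma> / d) * 2 powr (- 2 * p * \<sigma> / d)"
  have c: "c \<ge> 0" by (simp add: c_def)
  have "d > 0" by (simp add: d_def)
  have e: "2 / p = 1 + (- 2 * \<sigma> / d)"
    using p \<open>d > 0\<close> by (simp add: field_simps)
  have "n powr (2 / p) = n powr (- 2 * \<sigma> / d) * n"
    unfolding e using n' by (subst powr_add) simp
  then have "ennreal (c * n powr (2 / p)) = ennreal (c * n powr (- 2 * \<sigma> / d)) * ennreal n"
    using n' c by (simp add: ennreal_mult[symmetric] mult_ac)
  also have "\<dots> = (\<integral>\<^sup>+x. ennreal (c * n powr (- 2 * \<sigma> / d)) * ennreal (u x powr p) \<partial>lborel)"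
    using n by (subst nn_integral_cmult) auto
  also have "\<dots> \<le> (\<integral>\<^sup>+x. \<integral>\<^sup>+v. ennreal ((u (x + v) - u x)\<^sup>2 * norm v powr (- d - 2 * \<sigma>)) \<partial>lborel \<partial>lborel)"
    using gagliardo_seminorm_pointwise_lower_bound[OF assms(2) u s p[unfolded d_def] n(1) n'] c
    by (intro nn_integral_mono) (auto simp: c_def d_def ennreal_mult[symmetric] mult_ac)
  finally show ?thesis by (simp add: c_def)
qed

text \<open>After exchanging the integrals, the inner one is at most K|v|^2 and also, by translation
  invariance, at most 4M. The first bound is used inside the unit ball, where it lowers the
  singularity of the kernel by two powers; the second is used outside.\<close>

lemma gagliardo_seminorm_upper_bound:
  fixes u :: "'a::euclidean_space \<Rightarrow> real"
  defines "d \<equiv> real DIM('a)"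
  assumes [measurable]: "u \<in> borel_measurable borel" 
    and M: "(\<integral>\<^sup>+x. ennreal ((u x)\<^sup>2) \<partial>lborel) \<le> ennreal M" "M \<ge> 0"
    and K: "\<And>v. (\<integral>\<^sup>+x. ennreal ((u (x + v) - u x)\<^sup>2) \<partial>lborel) \<le> ennreal (K * (norm v)\<^sup>2)" "K \<ge> 0"
  shows "(\<integral>\<^sup>+x. \<integral>\<^sup>+v. ennreal ((u (x + v) - u x)\<^sup>2 * norm v powr (- d - 2 * \<sigma>)) \<partial>lborel \<partial>lborel)
    \<le> ennreal (K + 4 * M) * ((\<integral>\<^sup>+v\<in>ball (0::'a) 1. ennreal (norm v powr (- (d + 2 * \<sigma> - 2))) \<partial>lborel)
      + (\<integral>\<^sup>+v\<in>- ball (0::'a) 1. ennreal (norm v powr (- (d + 2 * \<sigma>))) \<partial>lborel))"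
proof -
  have [measurable]: "ball (0::'a) 1 \<in> sets borel" by simp
  define X where "X = (\<lambda>v::'a. ennreal (K + 4 * M) * (ennreal (norm v powr (- (d + 2 * \<sigma> - 2))) * indicator (ball 0 1) v)
      + ennreal (K + 4 * M) * (ennreal (norm v powr (- (d + 2 * \<sigma>))) * indicator (- ball 0 1) v))"
  have 4: "(\<integral>\<^sup>+x. ennreal ((u (x + v) - u x)\<^sup>2) \<partial>lborel) \<le> ennreal (4 * M)" for v
  proof -
    have "(\<integral>\<^sup>+x. ennreal ((u (x + v) - u x)\<^sup>2) \<partial>lborel)
       \<le> (\<integral>\<^sup>+x. 2 * ennreal ((u (x + v))\<^sup>2) + 2 * ennreal ((u x)\<^sup>2) \<partial>lborel)" (is "_ \<le> (\<integral>\<^sup>+x. ?h x \<partial>lborel)")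
    proof (intro nn_integral_mono)
      fix x
      have "(u (x + v) - u x)\<^sup>2 \<le> 2 * (u (x + v))\<^sup>2 + 2 * (u x)\<^sup>2"
        using zero_le_power2[of "u (x + v) + u x"] by (simp add: power2_eq_square algebra_simps)
      then have "ennreal ((u (x + v) - u x)\<^sup>2) \<le> ennreal (2 * (u (x + v))\<^sup>2 + 2 * (u x)\<^sup>2)"
        by (rule ennreal_leI)
      also have "\<dots> = ?h x"
        by (simp add: ennreal_mult)
      finally show "ennreal ((u (x + v) - u x)\<^sup>2) \<le> ?h x" .
    qed
    also have "\<dots> = 2 * (\<integral>\<^sup>+x. ennreal ((u (x + v))\<^sup>2) \<partial>lborel) + 2 * (\<integral>\<^sup>+x. ennreal ((u x)\<^sup>2) \<partial>lborel)"
      by (subst nn_integral_add) (auto simp: nn_integral_cmult)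
    also have "(\<integral>\<^sup>+x. ennreal ((u (x + v))\<^sup>2) \<partial>lborel) = (\<integral>\<^sup>+x. ennreal ((u x)\<^sup>2) \<partial>lborel)"
      by (rule nn_integral_lborel_translate) auto
    also have "2 * (\<integral>\<^sup>+x. ennreal ((u x)\<^sup>2) \<partial>lborel) + 2 * (\<integral>\<^sup>+x. ennreal ((u x)\<^sup>2) \<partial>lborel) \<le> 2 * ennreal M + 2 * ennreal M"
      using M by (intro add_mono mult_left_mono) auto
    also have "\<dots> = ennreal (4 * M)"
      using M(2) by (simp add: ennreal_mult flip: distrib_right)
    finally show ?thesis .
  qed
  have "(\<integral>\<^sup>+x. \<integral>\<^sup>+v. ennreal ((u (x + v) - u x)\<^sup>2 * norm v powr (- d - 2 * \<sigma>)) \<partial>lborel \<partial>lborel)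
     = (\<integral>\<^sup>+v. \<integral>\<^sup>+x. ennreal ((u (x + v) - u x)\<^sup>2 * norm v powr (- d - 2 * \<sigma>)) \<partial>lborel \<partial>lborel)"
    by (rule lborel_pair.Fubini') measurable
  also have "\<dots> \<le> (\<integral>\<^sup>+v. X v \<partial>lborel)"
  proof (intro nn_integral_mono)
    fix v :: 'a
    have "(\<integral>\<^sup>+x. ennreal ((u (x + v) - u x)\<^sup>2 * norm v powr (- d - 2 * \<sigma>)) \<partial>lborel)
       = (\<integral>\<^sup>+x. ennreal ((u (x + v) - u x)\<^sup>2) \<partial>lborel) * ennreal (norm v powr (- d - 2 * \<sigma>))"
      by (subst nn_integral_multc[symmetric]) (auto simp: ennreal_mult)
    also have "\<dots> \<le> X v"
    proof (cases "v \<in> ball 0 1")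
      case True
      have "(norm v)\<^sup>2 * norm v powr (- d - 2 * \<sigma>) \<le> norm v powr (- (d + 2 * \<sigma> - 2))"
      proof (cases "v = 0")
        case False
        then have "(norm v)\<^sup>2 * norm v powr (- d - 2 * \<sigma>) = norm v powr 2 * norm v powr (- d - 2 * \<sigma>)"
          by simp
        also have "\<dots> = norm v powr (- (d + 2 * \<sigma> - 2))"
          by (subst powr_add[symmetric]) (simp add: algebra_simps)
        finally show ?thesis by simp
      qed simp
      then have "(K * (norm v)\<^sup>2) * norm v powr (- d - 2 * \<sigma>) \<le> (K + 4 * M) * norm v powr (- (d + 2 * \<sigma> - 2))"
        using K(2) M(2) by (subst mult.assoc) (intro mult_mono, auto)
      then have "ennreal (K * (norm v)\<^sup>2) * ennreal (norm v powr (- d - 2 * \<sigma>)) \<le> ennreal (K + 4 * M) * ennreal (norm v powr (- (d + 2 * \<sigma> - 2)))"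
        using K(2) M(2) by (simp add: ennreal_mult[symmetric] ennreal_leI del: ennreal_plus)
      then show ?thesis
        using True by (simp add: X_def order_trans[OF mult_right_mono[OF K(1)]] del: ennreal_plus)
    next
      case False
      have "ennreal (4 * M) * ennreal (norm v powr (- d - 2 * \<sigma>)) \<le> ennreal (K + 4 * M) * ennreal (norm v powr (- (d + 2 * \<sigma>)))"
        using K(2) M(2) by (intro mult_mono ennreal_leI) auto
      then show ?thesis
        using False by (simp add: X_def order_trans[OF mult_right_mono[OF 4]] del: ennreal_plus)
    qed
    finally show "(\<integral>\<^sup>+x. ennreal ((u (x + v) - u x)\<^sup>2 * norm v powr (- d - 2 * \<sigma>)) \<partial>lborel) \<le> X v" .
  qed
  also have "\<dots> = ennreal (K + 4 * M) * ((\<integral>\<^sup>+v\<in>ball (0::'a) 1. ennreal (norm v powr (- (d + 2 * \<sigma> - 2))) \<partial>lborel)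
      + (\<integral>\<^sup>+v\<in>- ball (0::'a) 1. ennreal (norm v powr (- (d + 2 * \<sigma>))) \<partial>lborel))"
    unfolding X_def
    by (subst nn_integral_add, measurable, subst nn_integral_cmult, measurable,
        subst nn_integral_cmult, measurable, simp only: distrib_left)
  finally show ?thesis .
qed

text \<open>Difference-quotient form of a bound in the Sobolev space of order 1: M stands for the
  squared norm of u and K for the squared norm of its gradient, without mention of a derivative of
  u.\<close>

definition translation_bounds :: "('a::euclidean_space \<Rightarrow> real) \<Rightarrow> real \<Rightarrow> real \<Rightarrow> bool" where
  "translation_bounds u M K \<longleftrightarrow> u \<in> borel_measurable borel \<and> (\<forall>x. u x \<ge> 0) \<and> M \<ge> 0 \<and> K \<ge> 0 \<and>
     (\<integral>\<^sup>+x. ennreal ((u x)\<^sup>2) \<partial>lborel) \<le> ennreal M \<and>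
     (\<forall>v. (\<integral>\<^sup>+x. ennreal ((u (x + v) - u x)\<^sup>2) \<partial>lborel) \<le> ennreal (K * (norm v)\<^sup>2))"

text \<open>The lower and upper bounds for the Gagliardo seminorm combine only if the norm of order
  p is already known to be finite. Hence the truncations min(u, m) are treated first: they lie in
  that space since p > 2, and truncation is a contraction and so preserves both M and K. Monotone
  convergence removes m.\<close>

lemma sobolev_of_translation_estimate:
  assumes s: "0 < \<sigma>" "\<sigma> < 1" and p: "p > 2" "p = 2 + 2 * \<sigma> * p / DIM('a::euclidean_space)"
    and dim: "DIM('a) \<ge> 2"
  obtains C :: real where "C > 0"
    "\<And>(u :: 'a \<Rightarrow> real) M K. translation_bounds u M K \<Longrightarrow>
      (\<integral>\<^sup>+x. ennreal (u x powr p) \<partial>lborel) \<le> ennreal ((C * (K + M)) powr (p / 2))"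
proof -
  define d where "d = real DIM('a)"
  have d: "d \<ge> 2" using dim by (simp add: d_def)
  define I where "I = (\<integral>\<^sup>+v\<in>ball (0::'a) 1. ennreal (norm v powr (- (d + 2 * \<sigma> - 2))) \<partial>lborel)
      + (\<integral>\<^sup>+v\<in>- ball (0::'a) 1. ennreal (norm v powr (- (d + 2 * \<sigma>))) \<partial>lborel)"
  \<comment> \<open>\<sigma> < 1 gives d + 2\<sigma> - 2 < d at the origin, \<sigma> > 0 gives d +
    2\<sigma> > d at infinity, and d \<ge> 2 keeps the first exponent nonnegative.\<close>
  have I: "I < \<infinity>"
    unfolding I_def using s d nn_integral_norm_powr_near_zero[of "d + 2 * \<sigma> - 2", where 'a='a]
      nn_integral_norm_powr_near_infinity[where b = "d + 2 * \<sigma>" and 'a='a]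
    by (auto simp: d_def)
  define i where "i = enn2real I"
  have i: "I = ennreal i" "i \<ge> 0" using I by (auto simp: i_def)
  define c where "c = 1/4 * (unit_ball_vol d / 2) powr (1 + 2 * \<sigma> / d) * 2 powr (- 2 * p * \<sigma> / d)"
  have "unit_ball_vol d > 0" using d by simp
  then have c: "c > 0" unfolding c_def by (intro mult_pos_pos) auto
  \<comment> \<open>The factor 4 comes from K + 4M \<le> 4(K + M); i + 1 in place of i keeps the
    constant positive.\<close>
  define C where "C = 4 * (i + 1) / c"
  have C: "C > 0" using i c by (simp add: C_def)
  show ?thesis
  proof (rule that[OF C])
    fix u :: "'a \<Rightarrow> real" and M K
    assume "translation_bounds u M K"
    then have [measurable]: "u \<in> borel_measurable borel" and u: "\<And>x. u x \<ge> 0" and MK: "M \<ge> 0" "K \<ge> 0"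
      and M: "(\<integral>\<^sup>+x. ennreal ((u x)\<^sup>2) \<partial>lborel) \<le> ennreal M"
      and K: "\<And>v. (\<integral>\<^sup>+x. ennreal ((u (x + v) - u x)\<^sup>2) \<partial>lborel) \<le> ennreal (K * (norm v)\<^sup>2)"
      by (simp_all add: translation_bounds_def)
    have trunc: "(\<integral>\<^sup>+x. ennreal (min (u x) (real m) powr p) \<partial>lborel) \<le> ennreal ((C * (K + M)) powr (p / 2))" for m :: nat
    proof -
      define w where "w = (\<lambda>x. min (u x) (real m))"
      have [measurable]: "w \<in> borel_measurable borel" unfolding w_def by measurable
      have w: "w x \<ge> 0" "w x \<le> u x" "w x \<le> m" for x using u by (auto simp: w_def)
      have "(\<integral>\<^sup>+x. ennreal (w x powr p) \<partial>lborel) \<le> (\<integral>\<^sup>+x. ennreal (real m powr (p - 2)) * ennreal ((u x)\<^sup>2) \<partial>lborel)"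
      proof (intro nn_integral_mono)
        fix x
        have "w x powr p = w x powr (p - 2) * w x powr 2" by (subst powr_add[symmetric]) simp
        also have "\<dots> \<le> real m powr (p - 2) * u x powr 2"
          using w[of x] p u by (intro mult_mono powr_mono2) auto
        also have "u x powr 2 = (u x)\<^sup>2" using u by simp
        finally show "ennreal (w x powr p) \<le> ennreal (real m powr (p - 2)) * ennreal ((u x)\<^sup>2)"
          by (simp add: ennreal_mult[symmetric] ennreal_leI)
      qed
      also have "\<dots> = ennreal (real m powr (p - 2)) * (\<integral>\<^sup>+x. ennreal ((u x)\<^sup>2) \<partial>lborel)"
        by (rule nn_integral_cmult) auto
      also have "\<dots> \<le> ennreal (real m powr (p - 2)) * ennreal M" by (intro mult_left_mono M) auto
      also have "\<dots> < \<infinity>" by (simp add: ennreal_mult_less_top)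
      finally have fin: "(\<integral>\<^sup>+x. ennreal (w x powr p) \<partial>lborel) < \<infinity>" .
      define n where "n = enn2real (\<integral>\<^sup>+x. ennreal (w x powr p) \<partial>lborel)"
      have n: "(\<integral>\<^sup>+x. ennreal (w x powr p) \<partial>lborel) = ennreal n" "n \<ge> 0"
        using fin by (auto simp: n_def)
      have M': "(\<integral>\<^sup>+x. ennreal ((w x)\<^sup>2) \<partial>lborel) \<le> ennreal M"
        using w by (intro order_trans[OF nn_integral_mono M] ennreal_leI power_mono) auto
      have K': "(\<integral>\<^sup>+x. ennreal ((w (x + v) - w x)\<^sup>2) \<partial>lborel) \<le> ennreal (K * (norm v)\<^sup>2)" for v
      proof -
        have "\<bar>w (x + v) - w x\<bar> \<le> \<bar>u (x + v) - u x\<bar>" for x by (auto simp: w_def)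
        then show ?thesis
          by (intro order_trans[OF nn_integral_mono K] ennreal_leI) (auto simp: abs_le_square_iff)
      qed
      have "ennreal (c * n powr (2 / p)) \<le> ennreal (K + 4 * M) * I"
        using order_trans[OF fractional_sobolev[where u=w, OF _ w(1) s(1) _ p(2) n]
          gagliardo_seminorm_upper_bound[OF _ M' MK(1) K' MK(2), of \<sigma>]] p(1)
        by (simp add: c_def I_def d_def del: ennreal_plus)
      also have "\<dots> = ennreal ((K + 4 * M) * i)"
        using MK i by (simp add: ennreal_mult del: ennreal_plus)
      finally have "c * n powr (2 / p) \<le> (K + 4 * M) * i"
        using MK i by (simp add: ennreal_le_iff del: ennreal_plus)
      also have "\<dots> \<le> (4 * (K + M)) * (i + 1)" using MK i by (intro mult_mono) auto
      finally have "n powr (2 / p) \<le> C * (K + M)"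
        using c by (simp add: C_def field_simps)
      then have "(n powr (2 / p)) powr (p / 2) \<le> (C * (K + M)) powr (p / 2)"
        using p by (intro powr_mono2) auto
      moreover have "(n powr (2 / p)) powr (p / 2) = n" using n p by (simp add: powr_powr)
      ultimately show ?thesis using n(1) by (simp add: w_def ennreal_leI)
    qed
    have lim: "(SUP m::nat. ennreal (min (u x) (real m) powr p)) = ennreal (u x powr p)" for x
    proof (rule antisym)
      obtain m :: nat where "u x \<le> m" using real_arch_simple by blast
      then show "ennreal (u x powr p) \<le> (SUP m::nat. ennreal (min (u x) (real m) powr p))"
        by (intro SUP_upper2[of m]) auto
      show "(SUP m::nat. ennreal (min (u x) (real m) powr p)) \<le> ennreal (u x powr p)"
        using u p by (intro SUP_least ennreal_leI powr_mono2) auto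
    qed
    have "(\<integral>\<^sup>+x. ennreal (u x powr p) \<partial>lborel) = (SUP m::nat. \<integral>\<^sup>+x. ennreal (min (u x) (real m) powr p) \<partial>lborel)"
      unfolding lim[symmetric]
    proof (rule nn_integral_monotone_convergence_SUP)
      show "incseq (\<lambda>m x. ennreal (min (u x) (real m) powr p))"
        using u p by (intro incseq_SucI le_funI ennreal_leI powr_mono2) auto
    qed auto
    also have "\<dots> \<le> ennreal ((C * (K + M)) powr (p / 2))" by (intro SUP_least trunc)
    finally show "(\<integral>\<^sup>+x. ennreal (u x powr p) \<partial>lborel) \<le> ennreal ((C * (K + M)) powr (p / 2))" .
  qed
qed

section \<open>The diamagnetic inequality along a line\<close>

lemma borel_measurable_cnj [measurable (raw)]:
  "f \<in> borel_measurable M \<Longrightarrow> (\<lambda>x. cnj (f x)) \<in> borel_measurable M"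
  using borel_measurable_continuous_onI[OF continuous_on_cnj[OF continuous_on_id]]
  by (rule measurable_compose[rotated])

text \<open>This is (|Z|^2)' = 2 Re(cnj Z * Z') in integrated form, obtained without
  differentiating: |int f|^2 is the double integral of f(s) * cnj f(t), and its halves on the two
  sides of the diagonal are complex conjugates of each other.\<close>

lemma norm_square_integral_eq:
  fixes f :: "real \<Rightarrow> complex"
  assumes f: "integrable lborel f"
  defines "Z \<equiv> (\<lambda>t. LINT s|lborel. indicator {..t} s *\<^sub>R f s)"
  shows "integrable lborel (\<lambda>s. cnj (Z s) * f s)"
    and "(norm (LINT s|lborel. f s))\<^sup>2 = 2 * (LINT s|lborel. Re (cnj (Z s) * f s))"
proof -
  have [measurable]: "f \<in> borel_measurable borel" using f by auto
  let ?P = "lborel \<Otimes>\<^sub>M (lborel :: real measure)"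
  have prod: "integrable ?P (\<lambda>(s, t). f s * cnj (f t))"
  proof (rule lborel_pair.Fubini_integrable)
    have "(LINT t|lborel. norm (case (s, t) of (s, t) \<Rightarrow> f s * cnj (f t))) = norm (f s) * (LINT t|lborel. norm (f t))" for s
      by (simp add: norm_mult)
    then show "integrable lborel (\<lambda>s. LINT t|lborel. norm (case (s, t) of (s, t) \<Rightarrow> f s * cnj (f t)))"
      using f by simp
    show "(\<lambda>(s, t). f s * cnj (f t)) \<in> borel_measurable (lborel \<Otimes>\<^sub>M lborel)"
      by measurable
  qed (use f in auto)
  \<comment> \<open>The two halves of the plane; the diagonal is assigned to
    \<open>h\<close>.\<close>
  define h where "h = (\<lambda>(s, t). if t \<le> s then f s * cnj (f t) else 0)"
  define k where "k = (\<lambda>(s, t). if s < t then f s * cnj (f t) else 0)"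
  have hm: "h \<in> borel_measurable ?P"
    unfolding h_def by measurable
  have km: "k \<in> borel_measurable ?P"
    unfolding k_def by measurable
  have h: "integrable ?P h"
    by (rule Bochner_Integration.integrable_bound[OF prod hm]) (auto simp: h_def indicator_def)
  have k: "integrable ?P k"
    by (rule Bochner_Integration.integrable_bound[OF prod km]) (auto simp: k_def indicator_def)
  have Zc: "cnj (Z s) = (LINT t|lborel. indicator {..s} t *\<^sub>R cnj (f t))" for s
  proof -
    have "cnj (Z s) = (LINT t|lborel. cnj (indicator {..s} t *\<^sub>R f t))"
      unfolding Z_def by (rule Bochner_Integration.integral_cnj[symmetric])
    also have "\<dots> = (LINT t|lborel. indicator {..s} t *\<^sub>R cnj (f t))"
      by (intro Bochner_Integration.integral_cong) (auto simp: scaleR_conv_of_real)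
    finally show ?thesis .
  qed
  have hi: "(LINT t|lborel. h (s, t)) = cnj (Z s) * f s" for s
  proof -
    have "h (s, t) = f s * (indicator {..s} t *\<^sub>R cnj (f t))" for t
      by (auto simp: h_def indicator_def)
    then have "(LINT t|lborel. h (s, t)) = (LINT t|lborel. f s * (indicator {..s} t *\<^sub>R cnj (f t)))"
      by (simp only:)
    also have "\<dots> = f s * cnj (Z s)"
      unfolding Zc by (rule integral_mult_right_zero)
    finally show ?thesis by (simp only: mult.commute)
  qed
  have int: "integrable lborel (\<lambda>s. LINT t|lborel. h (s, t))"
    using lborel_pair.integrable_fst'[OF h] by simp
  then show 1: "integrable lborel (\<lambda>s. cnj (Z s) * f s)" by (simp add: hi)
  have ki: "(LINT s|lborel. k (s, t)) = cnj (cnj (Z t) * f t)" for t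
  proof -
    \<comment> \<open>\<open>k\<close> requires s < t while \<open>Z t\<close> integrates over s
      \<le> t; the single point s = t is null.\<close>
    have "(LINT s|lborel. k (s, t)) = (LINT s|lborel. (indicator {..t} s *\<^sub>R f s) * cnj (f t))"
    proof (rule integral_cong_AE)
      show "AE s in lborel. k (s, t) = (indicator {..t} s *\<^sub>R f s) * cnj (f t)"
        using AE_lborel_singleton[of t] by eventually_elim (auto simp: k_def indicator_def)
    qed (auto simp: k_def indicator_def)
    also have "\<dots> = Z t * cnj (f t)"
      unfolding Z_def by (rule integral_mult_left_zero)
    finally show ?thesis by simp
  qed
  define I where "I = (LINT s|lborel. cnj (Z s) * f s)"
  have "(LINT s|lborel. f s) * cnj (LINT s|lborel. f s) = (LINT s|lborel. (LINT t|lborel. f s * cnj (f t)))"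
    by (simp add: Bochner_Integration.integral_cnj)
  also have "\<dots> = (LINT p|?P. (\<lambda>(s, t). f s * cnj (f t)) p)"
    using lborel_pair.integral_fst'[OF prod] by simp
  also have "\<dots> = (LINT p|?P. h p + k p)"
    by (rule Bochner_Integration.integral_cong) (auto simp: h_def k_def indicator_def)
  also have "\<dots> = (LINT p|?P. h p) + (LINT p|?P. k p)"
    by (rule Bochner_Integration.integral_add[OF h k])
  also have "(LINT p|?P. h p) = I"
    unfolding lborel_pair.integral_fst'[OF h, symmetric] hi I_def ..
  also have "(LINT p|?P. k p) = (LINT t|lborel. LINT s|lborel. k (s, t))"
    using lborel_pair.integral_snd[of "\<lambda>s t. k (s, t)"] k by simp
  also have "\<dots> = cnj I" unfolding ki I_def by (rule Bochner_Integration.integral_cnj)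
  finally have "(LINT s|lborel. f s) * cnj (LINT s|lborel. f s) = I + cnj I" .
  then have "complex_of_real ((norm (LINT s|lborel. f s))\<^sup>2) = complex_of_real (2 * Re I)"
    by (simp only: complex_norm_square complex_add_cnj)
  then have "(norm (LINT s|lborel. f s))\<^sup>2 = 2 * Re I"
    by (simp only: of_real_eq_iff)
  also have "Re I = (LINT s|lborel. Re (cnj (Z s) * f s))"
    unfolding I_def by (rule integral_Re[OF 1, symmetric])
  finally show "(norm (LINT s|lborel. f s))\<^sup>2 = 2 * (LINT s|lborel. Re (cnj (Z s) * f s))" .
qed

text \<open>
  Along a line, \<open>y' = G - iay\<close>, and the term \<open>-iay\<close> does not contribute to \<open>(|y|\<^sup>2)' = 2 Re(y\<^sup>* y')\<close>.
  Comparing with the maximum of \<open>|y|\<close> gives the bound; the factor \<open>2\<close> is not optimal.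
\<close>

lemma diamagnetic_line:
  fixes F G :: "real \<Rightarrow> complex" and a :: "real \<Rightarrow> real" and y0 :: complex
  assumes F: "set_integrable lborel {0..1} F"
    and G: "set_integrable lborel {0..1} G"
  defines "y \<equiv> (\<lambda>t. y0 + (LINT s:{0..t}|lborel. F s))"
  assumes ode: "AE s in lborel. s \<in> {0..1} \<longrightarrow> F s = G s - \<i> * complex_of_real (a s) * y s"
  shows "\<bar>norm (y 1) - norm y0\<bar> \<le> 2 * (LINT s:{0..1}|lborel. norm (G s))"
proof -
  define \<gamma> where "\<gamma> = (LINT s:{0..1}|lborel. norm (G s))"
  have \<gamma>: "\<gamma> \<ge> 0" unfolding \<gamma>_def set_lebesgue_integral_def by simp
  have cont: "continuous_on {0..1} y"
  proof -
    have "F integrable_on {0..1}" using F set_borel_integral_eq_integral(1) by blast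
    then have "continuous_on {0..1} (\<lambda>t. y0 + integral {0..t} F)"
      by (intro continuous_intros indefinite_integral_continuous_1)
    moreover have "integral {0..t} F = (LINT s:{0..t}|lborel. F s)" if "t \<in> {0..1}" for t
      using that by (intro set_borel_integral_eq_integral(2)[symmetric] set_integrable_subset[OF F]) auto
    ultimately show ?thesis
      unfolding y_def by (subst continuous_on_cong[OF refl]) auto
  qed
  obtain t where t: "t \<in> {0..1}" and max: "\<And>s. s \<in> {0..1} \<Longrightarrow> norm (y s) \<le> norm (y t)"
    using continuous_attains_sup[of "{0..1::real}" "\<lambda>s. norm (y s)"] cont
    by (force intro: continuous_on_norm)
  define m where "m = norm (y t)"
  define H where "H = (\<lambda>s. indicator {0..1} s * Re (cnj (y s) * F s))"
  have H: "integrable lborel H" "AE s in lborel. norm (H s) \<le> m * (indicator {0..1} s *\<^sub>R norm (G s))"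
    and sq: "\<And>r. r \<in> {0..1} \<Longrightarrow> (norm (y r))\<^sup>2 = (norm y0)\<^sup>2 + 2 * (LINT s:{0..r}|lborel. H s)"
  proof -
    have y_meas: "(\<lambda>s. indicator {0..1} s *\<^sub>R y s) \<in> borel_measurable borel"
      using borel_measurable_continuous_on_indicator[OF _ cont] by simp
    have FH: "H = (\<lambda>s. Re (cnj (indicator {0..1} s *\<^sub>R y s) * (indicator {0..1} s *\<^sub>R F s)))"
      by (auto simp: H_def indicator_def)
    have F_meas: "(\<lambda>s. indicator {0..1} s *\<^sub>R F s) \<in> borel_measurable borel"
      using F borel_measurable_integrable unfolding set_integrable_def by fastforce
    have Hm[measurable]: "H \<in> borel_measurable lborel"
      unfolding FH measurable_lborel1
      by (intro measurable_compose[OF _ borel_measurable_Re] borel_measurable_times borel_measurable_cnj)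
        (use y_meas F_meas in simp_all)
    show bd: "AE s in lborel. norm (H s) \<le> m * (indicator {0..1} s *\<^sub>R norm (G s))"
      using ode
    proof eventually_elim
      case (elim s)
      show ?case
      proof (cases "s \<in> {0..1}")
        case True
        define b where "b = \<i> * complex_of_real (a s) * y s"
        have "Re (cnj (y s) * b) = 0" by (simp add: b_def algebra_simps)
        then have "H s = Re (cnj (y s) * G s)"
          using True elim unfolding b_def[symmetric] by (simp add: H_def) (simp add: algebra_simps)
        then have "norm (H s) \<le> norm (cnj (y s) * G s)" by (metis abs_Re_le_cmod real_norm_def)
        also have "\<dots> \<le> m * norm (G s)"
          using max[OF True] by (simp add: norm_mult m_def mult_right_mono)
        finally show ?thesis using True by simp
      qed (simp add: H_def)
    qed
    show H: "integrable lborel H"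
    proof (rule Bochner_Integration.integrable_bound)
      show "integrable lborel (\<lambda>s. m * (indicator {0..1} s *\<^sub>R norm (G s)))"
        using set_integrable_norm[OF G] by (simp add: set_integrable_def)
      show "AE s in lborel. norm (H s) \<le> norm (m * (indicator {0..1} s *\<^sub>R norm (G s)))"
        using bd by eventually_elim auto
    qed simp
    fix r :: real assume r: "r \<in> {0..1}"
    \<comment> \<open>With F cut off to {0..r}, the primitive \<open>Z\<close> equals y - y0 on that
      interval and the total integral L equals y(r) - y0. The identity for |L|^2 then supplies the
      quadratic term in the expansion of |y0 + L|^2.\<close>
    define f where "f = (\<lambda>s. indicator {0..r} s *\<^sub>R F s)"
    have f: "integrable lborel f"
      using set_integrable_subset[OF F, of "{0..r}"] r by (simp add: f_def set_integrable_def)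
    define Z where "Z = (\<lambda>t. LINT s|lborel. indicator {..t} s *\<^sub>R f s)"
    have Z: "integrable lborel (\<lambda>s. cnj (Z s) * f s)"
      "(norm (LINT s|lborel. f s))\<^sup>2 = 2 * (LINT s|lborel. Re (cnj (Z s) * f s))"
      unfolding Z_def by (rule norm_square_integral_eq[OF f])+
    have Zy: "y s = y0 + Z s" if "s \<in> {0..r}" for s
    proof -
      have "(\<lambda>\<tau>. indicator {0..s} \<tau> *\<^sub>R F \<tau>) = (\<lambda>\<tau>. indicator {..s} \<tau> *\<^sub>R f \<tau>)"
        using that r by (auto simp: f_def indicator_def)
      then show ?thesis by (simp add: y_def Z_def set_lebesgue_integral_def)
    qed
    define L where "L = (LINT s|lborel. f s)"
    have yr: "y r = y0 + L"
      by (simp add: y_def L_def f_def set_lebesgue_integral_def)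
    have c: "integrable lborel (\<lambda>s. cnj y0 * f s)" using f by simp
    have "(LINT s:{0..r}|lborel. H s) = (LINT s|lborel. Re (cnj y0 * f s) + Re (cnj (Z s) * f s))"
      unfolding set_lebesgue_integral_def
    proof (rule Bochner_Integration.integral_cong)
      fix s show "indicator {0..r} s *\<^sub>R H s = Re (cnj y0 * f s) + Re (cnj (Z s) * f s)"
        using r Zy[of s] by (cases "s \<in> {0..r}") (auto simp: H_def f_def algebra_simps)
    qed simp
    also have "\<dots> = (LINT s|lborel. Re (cnj y0 * f s)) + (LINT s|lborel. Re (cnj (Z s) * f s))"
      by (intro Bochner_Integration.integral_add integrable_Re c Z(1))
    also have "(LINT s|lborel. Re (cnj y0 * f s)) = Re (cnj y0 * L)"
      unfolding integral_Re[OF c] L_def by simp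
    finally have "2 * (LINT s:{0..r}|lborel. H s) = 2 * Re (cnj y0 * L) + (norm L)\<^sup>2"
      using Z(2) by (simp add: L_def)
    moreover have "(norm (y0 + L))\<^sup>2 = (norm y0)\<^sup>2 + 2 * Re (cnj y0 * L) + (norm L)\<^sup>2"
      unfolding cmod_power2 by (simp add: power2_eq_square algebra_simps)
    ultimately show "(norm (y r))\<^sup>2 = (norm y0)\<^sup>2 + 2 * (LINT s:{0..r}|lborel. H s)"
      by (simp add: yr)
  qed
  \<comment> \<open>No order between r and e is assumed: the difference of the two indicators takes
    values in {-1, 0, 1}, and |H| \<le> m|G| covers both signs.\<close>
  have key: "(norm (y r))\<^sup>2 - (norm (y e))\<^sup>2 \<le> 2 * (m * \<gamma>)" if "r \<in> {0..1}" "e \<in> {0..1}" for r e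
  proof -
    have Hs: "integrable lborel (\<lambda>s. indicator {0..x} s *\<^sub>R H s)" for x :: real
      using H(1) by (intro integrable_mult_indicator) auto
    have "(norm (y r))\<^sup>2 - (norm (y e))\<^sup>2 = 2 * ((LINT s:{0..r}|lborel. H s) - (LINT s:{0..e}|lborel. H s))"
      using sq that by simp
    also have "(LINT s:{0..r}|lborel. H s) - (LINT s:{0..e}|lborel. H s)
        = (LINT s|lborel. indicator {0..r} s *\<^sub>R H s - indicator {0..e} s *\<^sub>R H s)"
      unfolding set_lebesgue_integral_def by (rule Bochner_Integration.integral_diff[symmetric, OF Hs Hs])
    also have "\<dots> \<le> (LINT s|lborel. m * (indicator {0..1} s *\<^sub>R norm (G s)))"
    proof (rule integral_mono_AE)
      show "integrable lborel (\<lambda>s. m * (indicator {0..1} s *\<^sub>R norm (G s)))"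
        using set_integrable_norm[OF G] by (simp add: set_integrable_def)
      show "AE s in lborel. indicator {0..r} s *\<^sub>R H s - indicator {0..e} s *\<^sub>R H s
          \<le> m * (indicator {0..1} s *\<^sub>R norm (G s))"
        using H(2) by eventually_elim (auto simp: indicator_def m_def split: if_splits)
    qed (use Hs in auto)
    also have "\<dots> = m * \<gamma>" by (simp add: \<gamma>_def set_lebesgue_integral_def)
    finally show ?thesis by simp
  qed
  \<comment> \<open>From m^2 \<le> |y(e)|^2 + 2m\<gamma> and |y(e)| \<le> m, division by m gives the
    claim. So both endpoint values lie in [m - 2\<gamma>, m] and differ by at most
    2\<gamma>.\<close>
  have bound: "m \<le> norm (y e) + 2 * \<gamma>" if e: "e \<in> {0..1}" for e
  proof (cases "m = 0")
    case False
    then have "m > 0" by (simp add: m_def)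
    have "m * m \<le> norm (y e) * norm (y e) + 2 * (m * \<gamma>)"
      using key[OF t e] by (simp add: m_def power2_eq_square)
    also have "\<dots> \<le> m * norm (y e) + 2 * (m * \<gamma>)"
      using max[OF e] by (simp add: m_def mult_right_mono)
    finally have "m * m \<le> m * (norm (y e) + 2 * \<gamma>)" by (simp add: algebra_simps)
    then show ?thesis using \<open>m > 0\<close> by simp
  qed (use \<gamma> in simp)
  have "y 0 = y0"
  proof -
    have "(LINT s:{0..0::real}|lborel. F s) = 0"
      unfolding set_lebesgue_integral_def
      by (rule integral_eq_zero_AE) (use AE_lborel_singleton[of "0::real"] in eventually_elim, simp)
    then show ?thesis by (simp add: y_def)
  qed
  then show ?thesis
    using bound[of 0] bound[of 1] max[of 0] max[of 1] by (simp add: \<gamma>_def[symmetric] m_def abs_le_iff)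
qed

section \<open>Test functions\<close>

lemma cont_diff_SucD: "cont_diff (Suc k) f \<Longrightarrow> cont_diff k f"
proof (induction k arbitrary: f)
  case 0
  then show ?case
    by (auto intro!: differentiable_imp_continuous_on simp: differentiable_on_def intro: differentiable_at_withinI)
next
  case (Suc k)
  then show ?case by (subst cont_diff.simps) (auto simp del: cont_diff.simps intro: Suc.IH simp: cont_diff.simps(2)[of "Suc k"])
qed

lemma cont_diff_const: "cont_diff k (\<lambda>x. c)"
  by (induction k arbitrary: c) (simp_all add: continuous_on_const)

lemma cont_diff_add: "cont_diff k f \<Longrightarrow> cont_diff k g \<Longrightarrow> cont_diff k (\<lambda>x. f x + g x)"
proof (induction k arbitrary: f g)
  case 0 then show ?case by (auto intro: continuous_intros)
next
  case (Suc k)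
  have "((\<lambda>x. f x + g x) has_derivative (\<lambda>v. frechet_derivative f (at x) v + frechet_derivative g (at x) v)) (at x)" for x
    using Suc.prems by (auto intro!: has_derivative_add simp: frechet_derivative_works)
  note D = this
  have "frechet_derivative (\<lambda>x. f x + g x) (at x) = (\<lambda>v. frechet_derivative f (at x) v + frechet_derivative g (at x) v)" for x
    using frechet_derivative_at[OF D] by simp
  moreover have "(\<lambda>x. f x + g x) differentiable at x" for x
    using D by (auto simp: differentiable_def)
  ultimately show ?case using Suc by simp
qed

lemma cont_diff_mult: "cont_diff k f \<Longrightarrow> cont_diff k g \<Longrightarrow> cont_diff k (\<lambda>x. f x * g x)"
proof (induction k arbitrary: f g)
  case 0 then show ?case by (auto intro: continuous_intros)
next
  case (Suc k)
  have D: "((\<lambda>x. f x * g x) has_derivative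
      (\<lambda>v. f x * frechet_derivative g (at x) v + frechet_derivative f (at x) v * g x)) (at x)" for x
    using Suc.prems by (auto intro!: has_derivative_mult simp: frechet_derivative_works)
  have "frechet_derivative (\<lambda>x. f x * g x) (at x) =
      (\<lambda>v. f x * frechet_derivative g (at x) v + frechet_derivative f (at x) v * g x)" for x
    using frechet_derivative_at[OF D] by simp
  moreover have "(\<lambda>x. f x * g x) differentiable at x" for x
    using D by (auto simp: differentiable_def)
  moreover have "cont_diff k f" "cont_diff k g" using Suc.prems by (auto intro!: cont_diff_SucD simp del: cont_diff.simps)
  ultimately show ?case using Suc by (auto intro!: cont_diff_add)
qed

lemma cont_diff_prod:
  "finite I \<Longrightarrow> (\<And>i. i \<in> I \<Longrightarrow> cont_diff k (f i)) \<Longrightarrow> cont_diff k (\<lambda>x. \<Prod>i\<in>I. f i x)"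
  by (induction I rule: finite_induct) (auto intro: cont_diff_const cont_diff_mult)

lemma test_functionD:
  assumes "test_function \<eta>"
  shows "\<And>x. (\<eta> has_derivative frechet_derivative \<eta> (at x)) (at x)"
    and "continuous_on UNIV \<eta>"
    and "\<And>v. continuous_on UNIV (\<lambda>x. frechet_derivative \<eta> (at x) v)"
    and "compact (closure {x. \<eta> x \<noteq> 0})"
  using assms[unfolded test_function_def, THEN conjunct1, THEN spec, of 0]
    assms[unfolded test_function_def, THEN conjunct1, THEN spec, of 1]
    assms by (auto simp: frechet_derivative_works test_function_def)

lemma test_function_mult:
  assumes "test_function f" "test_function g"
  shows "test_function (\<lambda>x. f x * g x)"
proof -
  have "compact (closure {x. f x * g x \<noteq> 0})"
    using closed_Int_compact[OF closed_closure[of "{x. f x * g x \<noteq> 0}"] test_functionD(4)[OF assms(1)]]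
      closure_mono[of "{x. f x * g x \<noteq> 0}" "{x. f x \<noteq> 0}"]
    by (simp add: Int_absorb2 subset_eq)
  then show ?thesis using assms by (auto simp: test_function_def cont_diff_mult)
qed

text \<open>The powers of 1/t are included so that the family is closed under differentiation up to
  linear combinations: the derivative of a member involves the members m + 1 and m + 2. Smoothness
  then follows by induction with m arbitrary.\<close>

definition flat_exp :: "nat \<Rightarrow> real \<Rightarrow> real" where
  "flat_exp m t = (if t > 0 then (1 / t) ^ m * exp (- (1 / t)) else 0)"

lemma flat_exp_tendsto_0: "(flat_exp m \<longlongrightarrow> 0) (at 0)"
proof (rule filterlim_split_at_real)
  show "(flat_exp m \<longlongrightarrow> 0) (at_left 0)"
    by (rule tendsto_eventually) (auto simp: flat_exp_def eventually_at_filter)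
  have "((\<lambda>t. (inverse t) ^ m / exp (inverse t)) \<longlongrightarrow> (0::real)) (at_right 0)"
    by (rule filterlim_compose[OF tendsto_power_div_exp_0 filterlim_inverse_at_top_right])
  then show "(flat_exp m \<longlongrightarrow> 0) (at_right 0)"
    by (rule Lim_transform_eventually)
      (auto simp: flat_exp_def eventually_at_filter exp_minus field_simps)
qed

lemma flat_exp_has_derivative:
  "(flat_exp m has_real_derivative (flat_exp (m + 2) t - real m * flat_exp (m + 1) t)) (at t)"
proof -
  consider "t > 0" | "t < 0" | "t = 0" by linarith
  then show ?thesis
  proof cases
    case 1
    have "((\<lambda>t. (1 / t) ^ m * exp (- (1 / t))) has_real_derivative (flat_exp (m + 2) t - real m * flat_exp (m + 1) t)) (at t)"
      using 1 by (auto intro!: derivative_eq_intros simp: flat_exp_def field_simps power2_eq_square)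
        (cases m; simp add: field_simps)
    then show ?thesis
      by (rule DERIV_cong_ev[THEN iffD1, rotated 3, OF _ refl _ refl])
        (use 1 eventually_nhds_in_open[of "{0<..}" t] in \<open>auto simp: flat_exp_def elim!: eventually_mono\<close>)
  next
    case 2
    have "((\<lambda>t. 0) has_real_derivative (flat_exp (m + 2) t - real m * flat_exp (m + 1) t)) (at t)"
      using 2 by (simp add: flat_exp_def)
    then show ?thesis
      by (rule DERIV_cong_ev[THEN iffD1, rotated 3, OF _ refl _ refl])
        (use 2 eventually_nhds_in_open[of "{..<0}" t] in \<open>auto simp: flat_exp_def elim!: eventually_mono\<close>)
  next
    case 3
    \<comment> \<open>The difference quotient at 0 is itself a member of the family,
      \<open>flat_exp (m + 1)\<close>, which tends to 0.\<close>
    have "(flat_exp m has_real_derivative 0) (at 0)"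
      unfolding has_field_derivative_iff
      by (rule Lim_transform_eventually[OF flat_exp_tendsto_0[of "m + 1"]])
        (auto simp: flat_exp_def eventually_at_filter)
    then show ?thesis using 3 by (simp add: flat_exp_def)
  qed
qed

lemma cont_diff_flat_exp_affine: "cont_diff k (\<lambda>x::'a::euclidean_space. flat_exp m (c + x \<bullet> e))"
proof (induction k arbitrary: m)
  case 0
  have "continuous_on UNIV (flat_exp m)"
    using flat_exp_has_derivative by (intro continuous_at_imp_continuous_on) (blast intro: DERIV_isCont)
  then have "continuous_on UNIV (\<lambda>x::'a. flat_exp m (c + x \<bullet> e))"
    by (rule continuous_on_compose2) (auto intro!: continuous_intros)
  then show ?case by simp
next
  case (Suc k)
  have D: "((\<lambda>x::'a. flat_exp m (c + x \<bullet> e)) has_derivative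
    (\<lambda>v. (v \<bullet> e) * flat_exp (m + 2) (c + x \<bullet> e) + (- real m * (v \<bullet> e)) * flat_exp (m + 1) (c + x \<bullet> e))) (at x)" for x
  proof -
    have "((\<lambda>x::'a. c + x \<bullet> e) has_derivative (\<lambda>v. v \<bullet> e)) (at x)"
      by (auto intro!: derivative_eq_intros)
    from DERIV_compose_FDERIV[OF flat_exp_has_derivative this, of m]
    show ?thesis by (simp add: algebra_simps)
  qed
  have "(\<lambda>x::'a. flat_exp m (c + x \<bullet> e)) differentiable at x" for x
    using D by (auto simp: differentiable_def)
  moreover have "frechet_derivative (\<lambda>x::'a. flat_exp m (c + x \<bullet> e)) (at x) =
    (\<lambda>v. (v \<bullet> e) * flat_exp (m + 2) (c + x \<bullet> e) + (- real m * (v \<bullet> e)) * flat_exp (m + 1) (c + x \<bullet> e))" for x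
    using frechet_derivative_at[OF D] by simp
  moreover have "cont_diff k (\<lambda>x::'a. (v \<bullet> e) * flat_exp (m + 2) (c + x \<bullet> e) + (- real m * (v \<bullet> e)) * flat_exp (m + 1) (c + x \<bullet> e))" for v
    by (intro cont_diff_add cont_diff_mult cont_diff_const Suc)
  ultimately show ?case by (simp only: cont_diff.simps) blast
qed

text \<open>Each factor is exp(-1/t), with t a multiple of the signed distance to a face. The bump
  is nonzero exactly on the open box, is bounded by 1, and tends pointwise to the indicator as k
  grows; \<open>Suc k\<close> keeps the multiple positive at k = 0.\<close>

definition box_bump :: "'a::euclidean_space \<Rightarrow> 'a \<Rightarrow> nat \<Rightarrow> 'a \<Rightarrow> real" where
  "box_bump a b k x = (\<Prod>i\<in>Basis. flat_exp 0 (real (Suc k) * (x \<bullet> i - a \<bullet> i)) * flat_exp 0 (real (Suc k) * (b \<bullet> i - x \<bullet> i)))"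

lemma box_bump_nonzero: "box_bump a b k x \<noteq> 0 \<longleftrightarrow> x \<in> box a b"
  by (auto simp: box_bump_def flat_exp_def mem_box zero_less_mult_iff)

lemma box_bump_bounds: "0 \<le> box_bump a b k x" "box_bump a b k x \<le> 1"
  unfolding box_bump_def
  by (auto intro!: prod_nonneg prod_le_1 mult_le_one simp: flat_exp_def)

lemma box_bump_tendsto: "(\<lambda>k. box_bump a b k x) \<longlonglongrightarrow> indicator (box a b) x"
proof (cases "x \<in> box a b")
  case False
  then have "box_bump a b k x = 0" for k using box_bump_nonzero by blast
  then show ?thesis using False by simp
next
  case True
  have *: "(\<lambda>k. flat_exp 0 (real (Suc k) * t)) \<longlonglongrightarrow> 1" if "t > 0" for t
  proof -
    have "(\<lambda>k. exp (- (inverse t * inverse (real (Suc k))))) \<longlonglongrightarrow> exp (- (inverse t * 0))"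
      by (intro tendsto_intros LIMSEQ_inverse_real_of_nat)
    moreover have "flat_exp 0 (real (Suc k) * t) = exp (- (inverse t * inverse (real (Suc k))))" for k
      using that by (simp add: flat_exp_def divide_inverse zero_less_mult_iff)
    ultimately show ?thesis by simp
  qed
  have "(\<lambda>k. box_bump a b k x) \<longlonglongrightarrow> (\<Prod>i\<in>(Basis::'a set). 1 * 1)"
    unfolding box_bump_def using True by (intro tendsto_prod tendsto_mult *) (auto simp: mem_box)
  then show ?thesis using True by simp
qed

lemma test_function_box_bump: "test_function (box_bump a b k)"
  unfolding test_function_def
proof (intro conjI allI)
  fix l
  have 1: "real (Suc k) * (x \<bullet> i - a \<bullet> i) = - (real (Suc k) * (a \<bullet> i)) + x \<bullet> (real (Suc k) *\<^sub>R i)" for x i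
    by (simp add: algebra_simps)
  have 2: "real (Suc k) * (b \<bullet> i - x \<bullet> i) = real (Suc k) * (b \<bullet> i) + x \<bullet> (- real (Suc k) *\<^sub>R i)" for x i
    by (simp add: algebra_simps)
  show "cont_diff l (box_bump a b k)"
    unfolding box_bump_def[abs_def] 1 2
    by (intro cont_diff_prod cont_diff_mult cont_diff_flat_exp_affine finite_Basis)
next
  have "{x. box_bump a b k x \<noteq> 0} = box a b" by (simp add: box_bump_nonzero)
  then show "compact (closure {x. box_bump a b k x \<noteq> 0})" by simp
qed

text \<open>The positive and the negative part of w are densities of two measures that agree on
  boxes. Boxes are stable under intersection and generate the Borel sets, so the measures coincide,
  and hence so do their densities almost everywhere.\<close>

lemma AE_zero_if_integral_boxes_zero_real:
  fixes w :: "'a::euclidean_space \<Rightarrow> real"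
  assumes w: "\<And>a b. set_integrable lborel (box a b) w" "w \<in> borel_measurable borel"
    and 0: "\<And>a b. (LINT x:box a b|lborel. w x) = 0"
  shows "AE x in lborel. w x = 0"
proof -
  note [measurable] = w(2)
  let ?p = "density lborel (\<lambda>x. ennreal (w x))" and ?n = "density lborel (\<lambda>x. ennreal (- w x))"
  let ?E = "range (\<lambda>(a, b). box a b :: 'a set)"
  have pn: "emeasure ?p (box a b) = emeasure ?n (box a b)" "emeasure ?p (box a b) \<noteq> \<infinity>" for a b
  proof -
    define g where "g = (\<lambda>x. indicator (box a b) x *\<^sub>R w x)"
    have g: "integrable lborel g" using w(1) by (simp add: g_def set_integrable_def)
    have p: "emeasure ?p (box a b) = (\<integral>\<^sup>+x. ennreal (g x) \<partial>lborel)"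
      by (subst emeasure_density) (auto intro!: nn_integral_cong simp: g_def indicator_def)
    have n: "emeasure ?n (box a b) = (\<integral>\<^sup>+x. ennreal (- g x) \<partial>lborel)"
      by (subst emeasure_density) (auto intro!: nn_integral_cong simp: g_def indicator_def)
    have "enn2real (\<integral>\<^sup>+x. ennreal (g x) \<partial>lborel) - enn2real (\<integral>\<^sup>+x. ennreal (- g x) \<partial>lborel) = 0"
      using 0[of a b] real_lebesgue_integral_def[OF g] by (simp add: g_def set_lebesgue_integral_def)
    moreover have "(\<integral>\<^sup>+x. ennreal (g x) \<partial>lborel) \<noteq> \<infinity>" "(\<integral>\<^sup>+x. ennreal (- g x) \<partial>lborel) \<noteq> \<infinity>"
      using g by (auto elim!: real_integrable_def[THEN iffD1, elim_format])
    ultimately show "emeasure ?p (box a b) = emeasure ?n (box a b)" "emeasure ?p (box a b) \<noteq> \<infinity>"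
      unfolding p n by (metis ennreal_enn2real_if eq_iff_diff_eq_0 infinity_ennreal_def)+
  qed
  have "?p = ?n"
  proof (rule measure_eqI_generator_eq[where E = ?E and \<Omega> = UNIV and A = "\<lambda>n. box (- (real n *\<^sub>R One)) (real n *\<^sub>R One)"])
    show "Int_stable ?E"
      by (auto simp: Int_stable_def box_Int_box)
    show "(\<Union>n. box (- (real n *\<^sub>R One)) (real n *\<^sub>R One)) = (UNIV :: 'a set)"
      by (rule UN_box_eq_UNIV)
  qed (use pn in \<open>auto simp: borel_eq_box\<close>)
  then have "AE x in lborel. ennreal (w x) = ennreal (- w x)"
    by (subst (asm) sigma_finite_measure.density_unique_iff[OF sigma_finite_lborel]) auto
  \<comment> \<open>\<open>ennreal\<close> sends negative numbers to 0, so the equality says that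
    the positive and negative parts of w(x) agree, and this only happens for w(x) = 0.\<close>
  then show ?thesis
    by eventually_elim (metis ennreal_eq_zero_iff ennreal_neg linorder_le_cases neg_0_le_iff_le neg_le_0_iff_le antisym)
qed

text \<open>Fundamental lemma of the calculus of variations. Dominated convergence along
  \<open>box_bump\<close> transfers the hypothesis to boxes, and the real and imaginary parts are
  then treated separately.\<close>

lemma AE_zero_if_integral_test_functions_zero:
  fixes w :: "'a::euclidean_space \<Rightarrow> complex"
  assumes w: "\<And>a b. set_integrable lborel (box a b) w" and [measurable]: "w \<in> borel_measurable borel"
    and 0: "\<And>\<eta>. test_function \<eta> \<Longrightarrow> (LINT x|lborel. \<eta> x *\<^sub>R w x) = 0"
  shows "AE x in lborel. w x = 0"
proof -
  have box: "(LINT x:box a b|lborel. w x) = 0" for a b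
  proof -
    have "(\<lambda>k. LINT x|lborel. box_bump a b k x *\<^sub>R w x) \<longlonglongrightarrow> (LINT x|lborel. indicator (box a b) x *\<^sub>R w x)"
    proof (rule integral_dominated_convergence)
      show "integrable lborel (\<lambda>x. norm (indicator (box a b) x *\<^sub>R w x))"
        using w by (intro integrable_norm) (simp add: set_integrable_def)
      show "(\<lambda>x. box_bump a b k x *\<^sub>R w x) \<in> borel_measurable lborel" for k
      proof -
        have "box_bump a b k \<in> borel_measurable borel"
          using test_functionD(2)[OF test_function_box_bump] by (rule borel_measurable_continuous_onI)
        then show ?thesis by measurable
      qed
      show "(\<lambda>x. indicator (box a b) x *\<^sub>R w x) \<in> borel_measurable lborel"
        using w by (auto simp: set_integrable_def)
      show "AE x in lborel. norm (box_bump a b k x *\<^sub>R w x) \<le> norm (indicator (box a b) x *\<^sub>R w x)" for k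
      proof (intro AE_I2)
        fix x
        show "norm (box_bump a b k x *\<^sub>R w x) \<le> norm (indicator (box a b) x *\<^sub>R w x)"
          using box_bump_nonzero[of a b k x] box_bump_bounds[of a b k x]
          by (cases "x \<in> box a b") (auto intro: mult_left_le_one_le)
      qed
    qed (auto intro!: tendsto_intros box_bump_tendsto)
    then show ?thesis
      using 0[OF test_function_box_bump] by (simp add: LIMSEQ_const_iff set_lebesgue_integral_def)
  qed
  have i: "integrable lborel (\<lambda>x. indicator (box a b) x *\<^sub>R w x)" for a b
    using w by (simp add: set_integrable_def)
  have "AE x in lborel. Re (w x) = 0"
  proof (rule AE_zero_if_integral_boxes_zero_real)
    show "set_integrable lborel (box a b) (\<lambda>x. Re (w x))" for a b
      using integrable_Re[OF i] by (simp add: set_integrable_def)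
    show "(LINT x:box a b|lborel. Re (w x)) = 0" for a b
      using integral_Re[OF i] box by (simp add: set_lebesgue_integral_def)
  qed simp
  moreover have "AE x in lborel. Im (w x) = 0"
  proof (rule AE_zero_if_integral_boxes_zero_real)
    show "set_integrable lborel (box a b) (\<lambda>x. Im (w x))" for a b
      using integrable_Im[OF i] by (simp add: set_integrable_def)
    show "(LINT x:box a b|lborel. Im (w x)) = 0" for a b
      using integral_Im[OF i] box by (simp add: set_lebesgue_integral_def)
  qed simp
  ultimately show ?thesis by eventually_elim (simp add: complex_eq_iff)
qed

section \<open>Absolute continuity along lines\<close>

lemma integral_lborel_translate:
  fixes f :: "'a::euclidean_space \<Rightarrow> 'b::{banach, second_countable_topology}"
  assumes [measurable]: "f \<in> borel_measurable borel"
  shows "(LINT x|lborel. f (x + v)) = (LINT x|lborel. f x)"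
proof -
  have "(LINT x|lborel. f x) = (LINT x|distr lborel borel ((+) v). f x)"
    by (simp only: lborel_distr_plus)
  also have "\<dots> = (LINT x|lborel. f (v + x))"
    by (subst integral_distr) auto
  finally show ?thesis by (simp only: add.commute)
qed

lemma test_function_translate:
  fixes \<eta> :: "'a::euclidean_space \<Rightarrow> real"
  assumes "test_function \<eta>"
  shows "test_function (\<lambda>x. \<eta> (x - c))"
    and "frechet_derivative (\<lambda>x. \<eta> (x - c)) (at x) = frechet_derivative \<eta> (at (x - c))"
proof -
  have D: "frechet_derivative (\<lambda>x. f (x - c)) (at x) = frechet_derivative f (at (x - c)) \<and> (\<lambda>x. f (x - c)) differentiable at x"
    if "\<forall>x. f differentiable at x" for f :: "'a \<Rightarrow> real" and x
  proof -
    have "(f has_derivative frechet_derivative f (at (x - c))) (at (x - c))"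
      using that frechet_derivative_works by blast
    moreover have "((\<lambda>x. x - c) has_derivative (\<lambda>v. v)) (at x)"
      by (auto intro!: derivative_eq_intros)
    ultimately have "((\<lambda>x. f (x - c)) has_derivative frechet_derivative f (at (x - c))) (at x)"
      using has_derivative_compose[of "\<lambda>x. x - c" "\<lambda>v. v" x UNIV f] by simp
    then show ?thesis using frechet_derivative_at differentiable_def by metis
  qed
  have cd: "cont_diff k f \<Longrightarrow> cont_diff k (\<lambda>x. f (x - c))" for k and f :: "'a \<Rightarrow> real"
  proof (induction k arbitrary: f)
    case 0
    then have "continuous_on UNIV f" by simp
    then have "continuous_on UNIV (\<lambda>x. f (x - c))"
      by (rule continuous_on_compose2) (auto intro!: continuous_intros)
    then show ?case by simp
  next
    case (Suc k)
    have "cont_diff k (\<lambda>x. frechet_derivative f (at (x - c)) v)" for v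
      using Suc.IH[of "\<lambda>x. frechet_derivative f (at x) v"] Suc.prems by simp
    then show ?case using D[of f] Suc.prems by simp
  qed
  have "{x. \<eta> (x - c) \<noteq> 0} = (+) c ` {x. \<eta> x \<noteq> 0}"
    by (auto intro!: image_eqI[of _ _ "_ - c"])
  then have "compact (closure {x. \<eta> (x - c) \<noteq> 0})"
    using assms by (simp add: test_function_def closure_translation compact_translation)
  then show "test_function (\<lambda>x. \<eta> (x - c))"
    using assms cd by (auto simp: test_function_def)
  show "frechet_derivative (\<lambda>x. \<eta> (x - c)) (at x) = frechet_derivative \<eta> (at (x - c))"
    using D assms[unfolded test_function_def, THEN conjunct1, THEN spec, of 1] by auto
qed

lemma test_function_bounds:
  assumes "test_function \<eta>"
  obtains R C where "R > 0" "C \<ge> 0" "\<And>x. norm x \<ge> R \<Longrightarrow> \<eta> x = 0" "\<And>x. \<bar>\<eta> x\<bar> \<le> C"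
    "\<And>x. norm x \<ge> R \<Longrightarrow> frechet_derivative \<eta> (at x) v = 0" "\<And>x. \<bar>frechet_derivative \<eta> (at x) v\<bar> \<le> C"
proof -
  let ?S = "closure {x. \<eta> x \<noteq> 0}"
  let ?D = "\<lambda>x. frechet_derivative \<eta> (at x) v"
  note T = test_functionD[OF assms]
  have S: "compact ?S" using T by simp
  obtain R where R: "R > 0" "\<And>x. x \<in> ?S \<Longrightarrow> norm x < R"
    using compact_imp_bounded[OF S] bounded_pos_less by blast
  have out: "\<eta> x = 0" "?D x = 0" if "x \<notin> ?S" for x
  proof -
    have "\<eta> y = 0" if "y \<notin> ?S" for y using that closure_subset[of "{x. \<eta> x \<noteq> 0}"] by auto
    then have ev: "\<forall>y\<in>- ?S. \<eta> y = 0" by blast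
    show "\<eta> x = 0" using ev that by blast
    have "(\<eta> has_derivative (\<lambda>v. 0)) (at x)"
    proof (rule has_derivative_transform_within_open[OF has_derivative_const[of 0], of "- ?S"])
      show "x \<in> - ?S" using that by simp
      show "0 = \<eta> y" if "y \<in> - ?S" for y using ev[rule_format, OF that] ..
    qed (rule open_Compl[OF closed_closure])
    then show "?D x = 0" using frechet_derivative_at by metis
  qed
  have "bounded (\<eta> ` ?S)" "bounded (?D ` ?S)"
    by (intro compact_imp_bounded compact_continuous_image S continuous_on_subset[OF T(2) subset_UNIV]
        continuous_on_subset[OF T(3) subset_UNIV])+
  then obtain C1 C2 where C12: "\<forall>y\<in>\<eta> ` ?S. norm y \<le> C1" "\<forall>y\<in>?D ` ?S. norm y \<le> C2"
    unfolding bounded_iff by blast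
  define C where "C = \<bar>C1\<bar> + \<bar>C2\<bar>"
  show ?thesis
  proof (rule that[of R C])
    show C: "0 \<le> C" by (simp add: C_def)
    show "\<bar>\<eta> x\<bar> \<le> C" for x
    proof (cases "x \<in> ?S")
      case True
      then have "norm (\<eta> x) \<le> C1" using C12(1) by blast
      then show ?thesis by (simp add: C_def)
    next
      case False
      then have "\<eta> x = 0" by (rule out)
      then show ?thesis by (simp add: C)
    qed
    show "\<bar>?D x\<bar> \<le> C" for x
    proof (cases "x \<in> ?S")
      case True
      then have "norm (?D x) \<le> C2" using C12(2) by blast
      then show ?thesis by (simp add: C_def)
    next
      case False
      then have "?D x = 0" by (rule out)
      then show ?thesis by (simp add: C)
    qed
    show "\<eta> x = 0" "?D x = 0" if "norm x \<ge> R" for x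
      using out[of x] R(2)[of x] that by (meson not_le)+
  qed (rule R(1))
qed

text \<open>Borel rather than Lebesgue measurability is demanded: for Fubini, maps such as (x, s) ->
  f(x + sv) must be measurable for the product of the Borel measures, which is automatic only for
  Borel f.\<close>

definition loc_integrable :: "('a::euclidean_space \<Rightarrow> complex) \<Rightarrow> bool" where
  "loc_integrable f \<longleftrightarrow> f \<in> borel_measurable borel \<and> (\<forall>R. set_integrable lborel (ball 0 R) f)"

lemma loc_integrable_borel: "loc_integrable f \<Longrightarrow> f \<in> borel_measurable borel"
  by (simp add: loc_integrable_def)

lemma loc_integrable_nn:
  "loc_integrable f \<Longrightarrow> (\<integral>\<^sup>+x. ennreal (norm (indicator (ball 0 R) x *\<^sub>R f x)) \<partial>lborel) < \<infinity>"
  unfolding loc_integrable_def set_integrable_def integrable_iff_bounded by blast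

lemma integrable_compact_support_mult:
  assumes f: "loc_integrable f" and g: "g \<in> borel_measurable borel"
    and 0: "\<And>x. norm x \<ge> R \<Longrightarrow> g x = 0" and C: "\<And>x. \<bar>g x\<bar> \<le> C"
  shows "integrable lborel (\<lambda>x. g x *\<^sub>R f x)"
proof (rule Bochner_Integration.integrable_bound)
  show "integrable lborel (\<lambda>x. C *\<^sub>R (indicator (ball 0 R) x *\<^sub>R f x))"
    by (intro integrable_scaleR_right) (use f in \<open>simp add: loc_integrable_def set_integrable_def\<close>)
  show "(\<lambda>x. g x *\<^sub>R f x) \<in> borel_measurable lborel"
    using f g by (auto simp: loc_integrable_def)
  show "AE x in lborel. norm (g x *\<^sub>R f x) \<le> norm (C *\<^sub>R (indicator (ball 0 R) x *\<^sub>R f x))"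
  proof (intro AE_I2)
    fix x
    show "norm (g x *\<^sub>R f x) \<le> norm (C *\<^sub>R (indicator (ball 0 R) x *\<^sub>R f x))"
      using 0[of x] order_trans[OF C[of x] abs_ge_self[of C]]
      by (cases "norm x \<ge> R") (auto intro!: mult_right_mono)
  qed
qed

lemma nn_integral_ball_translate_le:
  fixes f :: "'a::euclidean_space \<Rightarrow> complex"
  assumes [measurable]: "f \<in> borel_measurable borel" and S: "R + norm y \<le> S"
  shows "(\<integral>\<^sup>+x. ennreal (norm (indicator (ball 0 R) x *\<^sub>R f (x + y))) \<partial>lborel)
    \<le> (\<integral>\<^sup>+x. ennreal (norm (indicator (ball 0 S) x *\<^sub>R f x)) \<partial>lborel)"
proof -
  define h where "h = (\<lambda>x. ennreal (norm (indicator (ball 0 S) x *\<^sub>R f x)))"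
  have [measurable]: "ball (0::'a) S \<in> sets borel" by simp
  have "(\<integral>\<^sup>+x. ennreal (norm (indicator (ball 0 R) x *\<^sub>R f (x + y))) \<partial>lborel) \<le> (\<integral>\<^sup>+x. h (x + y) \<partial>lborel)"
  proof (intro nn_integral_mono)
    fix x
    have "x + y \<in> ball 0 S" if "x \<in> ball 0 R"
      using that S norm_triangle_ineq[of x y] by simp
    then show "ennreal (norm (indicator (ball 0 R) x *\<^sub>R f (x + y))) \<le> h (x + y)"
      by (cases "x \<in> ball 0 R") (auto simp: h_def)
  qed
  also have "\<dots> = (\<integral>\<^sup>+x. h x \<partial>lborel)"
    unfolding h_def by (rule nn_integral_lborel_translate) measurable
  finally show ?thesis by (simp add: h_def)
qed

text \<open>The integrand on which Fubini operates: f along the segments from x in direction v,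
  localized in x because f is only locally integrable.\<close>

definition segment_fun :: "real \<Rightarrow> real \<Rightarrow> 'a::euclidean_space \<Rightarrow> ('a \<Rightarrow> complex) \<Rightarrow> 'a \<times> real \<Rightarrow> complex" where
  "segment_fun R t v f = (\<lambda>(x, s). (indicator (ball 0 R) x * indicator {0..t} s) *\<^sub>R f (x + s *\<^sub>R v))"

text \<open>For fixed s the integral over x is, after translation by sv, bounded by the integral of
  |F| over the ball of radius R + |t||v|. This bound is uniform in s, and s runs over a bounded
  interval.\<close>

lemma integrable_along_segment:
  fixes v :: "'a::euclidean_space" and t :: real
  assumes F: "loc_integrable F"
  shows "integrable (lborel \<Otimes>\<^sub>M lborel) (segment_fun R t v F)"
proof (rule integrableI_bounded)
  note [measurable] = loc_integrable_borel[OF F]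
  have [measurable]: "ball (0::'a) r \<in> sets borel" for r by simp
  show meas: "segment_fun R t v F \<in> borel_measurable (lborel \<Otimes>\<^sub>M lborel)"
    unfolding segment_fun_def by measurable
  define L where "L = R + \<bar>t\<bar> * norm v"
  define I where "I = (\<integral>\<^sup>+x. ennreal (norm (indicator (ball 0 L) x *\<^sub>R F x)) \<partial>lborel)"
  have "(\<integral>\<^sup>+p. ennreal (norm (segment_fun R t v F p)) \<partial>(lborel \<Otimes>\<^sub>M lborel))
    = (\<integral>\<^sup>+s. \<integral>\<^sup>+x. ennreal (norm ((indicator (ball 0 R) x * indicator {0..t} s) *\<^sub>R F (x + s *\<^sub>R v))) \<partial>lborel \<partial>lborel)"
    using meas by (subst lborel_pair.nn_integral_snd[symmetric]) (auto simp: segment_fun_def split_beta)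
  also have "\<dots> \<le> (\<integral>\<^sup>+s. I * indicator {0..t} s \<partial>lborel)"
  proof (intro nn_integral_mono)
    fix s :: real
    show "(\<integral>\<^sup>+x. ennreal (norm ((indicator (ball 0 R) x * indicator {0..t} s) *\<^sub>R F (x + s *\<^sub>R v))) \<partial>lborel) \<le> I * indicator {0..t} s"
    proof (cases "s \<in> {0..t}")
      case True
      have "norm (s *\<^sub>R v) \<le> \<bar>t\<bar> * norm v" using True by (auto intro: mult_right_mono)
      then show ?thesis
        using True nn_integral_ball_translate_le[OF loc_integrable_borel[OF F], of R "s *\<^sub>R v" L]
        by (simp add: I_def L_def)
    qed simp
  qed
  also have "\<dots> = I * emeasure lborel {0..t}"
    by (rule nn_integral_cmult_indicator) auto
  also have "\<dots> < \<infinity>"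
    using loc_integrable_nn[OF F, of L] by (auto simp: I_def ennreal_mult_less_top emeasure_lborel_Icc_eq)
  finally show "(\<integral>\<^sup>+p. ennreal (norm (segment_fun R t v F p)) \<partial>(lborel \<Otimes>\<^sub>M lborel)) < \<infinity>" .
qed

lemma set_integrable_segment_AE:
  fixes v :: "'a::euclidean_space"
  assumes F: "loc_integrable F"
  shows "AE x in lborel. set_integrable lborel {0..t} (\<lambda>s. F (x + s *\<^sub>R v))"
proof -
  have "AE x in lborel. \<forall>n::nat. integrable lborel (\<lambda>s. (indicator (ball 0 (real n)) x * indicator {0..t} s) *\<^sub>R F (x + s *\<^sub>R v))"
    unfolding AE_all_countable
  proof
    fix n :: nat
    show "AE x in lborel. integrable lborel (\<lambda>s. (indicator (ball 0 (real n)) x * indicator {0..t} s) *\<^sub>R F (x + s *\<^sub>R v))"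
      using lborel_pair.AE_integrable_fst'[OF integrable_along_segment[OF F, of n t v]] by (simp add: segment_fun_def)
  qed
  then show ?thesis
  proof eventually_elim
    case (elim x)
    obtain n :: nat where "norm x < n" using reals_Archimedean2 by blast
    then show ?case using elim[rule_format, of n] by (simp add: set_integrable_def)
  qed
qed

text \<open>F is the distributional derivative of \<psi> in direction v. Tested against \<eta>, the
  increment of \<psi> moves to the smooth function \<eta>, where the fundamental theorem of calculus
  applies. The weak formulation for each translate of \<eta>, together with Fubini and a translation
  back, produces the integral of F along the segment.\<close>

lemma translation_identity:
  fixes \<psi> F :: "'a::euclidean_space \<Rightarrow> complex" and v :: 'a
  assumes \<psi>: "loc_integrable \<psi>" and F: "loc_integrable F" and t: "t \<ge> 0"
    and weak: "\<And>\<eta>. test_function \<eta> \<Longrightarrow>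
      (LINT x|lborel. frechet_derivative \<eta> (at x) v *\<^sub>R \<psi> x) = - (LINT x|lborel. \<eta> x *\<^sub>R F x)"
  shows "AE x in lborel. \<psi> (x + t *\<^sub>R v) - \<psi> x = (LINT s:{0..t}|lborel. F (x + s *\<^sub>R v))"
proof -
  note [measurable] = loc_integrable_borel[OF F] loc_integrable_borel[OF \<psi>]
  have [measurable]: "ball (0::'a) r \<in> sets borel" for r by simp
  define J where "J = (\<lambda>x. LINT s:{0..t}|lborel. F (x + s *\<^sub>R v))"
  have J_meas[measurable]: "J \<in> borel_measurable borel"
    unfolding J_def set_lebesgue_integral_def by measurable
  have J: "loc_integrable J"
    unfolding loc_integrable_def set_integrable_def
  proof (intro conjI allI J_meas)
    fix R
    have "(LINT s|lborel. (indicator (ball 0 R) x * indicator {0..t} s) *\<^sub>R F (x + s *\<^sub>R v)) = indicator (ball 0 R) x *\<^sub>R J x" for x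
      unfolding J_def set_lebesgue_integral_def by (simp flip: scaleR_scaleR)
    then show "integrable lborel (\<lambda>x. indicator (ball 0 R) x *\<^sub>R J x)"
      using lborel_pair.integrable_fst'[OF integrable_along_segment[OF F, of R t v]] by (simp add: segment_fun_def)
  qed
  have \<psi>t: "loc_integrable (\<lambda>x. \<psi> (x + t *\<^sub>R v))"
    unfolding loc_integrable_def set_integrable_def
  proof (intro conjI allI integrableI_bounded)
    fix R
    show "(\<integral>\<^sup>+x. ennreal (norm (indicator (ball 0 R) x *\<^sub>R \<psi> (x + t *\<^sub>R v))) \<partial>lborel) < \<infinity>"
      by (rule le_less_trans[OF nn_integral_ball_translate_le[OF loc_integrable_borel[OF \<psi>] order_refl] loc_integrable_nn[OF \<psi>]])
  qed measurable
  define w where "w = (\<lambda>x. (\<psi> (x + t *\<^sub>R v) - \<psi> x) - J x)"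
  have w_meas[measurable]: "w \<in> borel_measurable borel" unfolding w_def by measurable
  have "AE x in lborel. w x = 0"
  proof (rule AE_zero_if_integral_test_functions_zero[OF _ w_meas])
    fix a b :: 'a
    obtain R where R: "box a b \<subseteq> ball 0 R"
      using bounded_subset_ballD[OF bounded_box] by blast
    have "set_integrable lborel (ball 0 R) w"
      using J \<psi> \<psi>t unfolding w_def loc_integrable_def by (auto intro!: set_integral_diff)
    then show "set_integrable lborel (box a b) w"
      by (rule set_integrable_subset) (use R in auto)
  next
    fix \<eta> :: "'a \<Rightarrow> real" assume \<eta>: "test_function \<eta>"
    define D where "D = (\<lambda>x. frechet_derivative \<eta> (at x) v)"
    note T = test_functionD[OF \<eta>]
    have [measurable]: "\<eta> \<in> borel_measurable borel" "D \<in> borel_measurable borel"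
      using T(2) T(3)[of v] by (auto intro: borel_measurable_continuous_onI simp: D_def)
    obtain R C where RC: "R > 0" "C \<ge> 0" "\<And>x. norm x \<ge> R \<Longrightarrow> \<eta> x = 0" "\<And>x. \<bar>\<eta> x\<bar> \<le> C"
      "\<And>x. norm x \<ge> R \<Longrightarrow> D x = 0" "\<And>x. \<bar>D x\<bar> \<le> C"
      using test_function_bounds[OF \<eta>, of v] unfolding D_def by blast
    have int: "integrable lborel (\<lambda>x. \<eta> (x - c) *\<^sub>R f x)" if f: "loc_integrable f" for f c
    proof (rule integrable_compact_support_mult[OF f])
      show "\<eta> (x - c) = 0" if "norm x \<ge> R + norm c" for x
        using that norm_triangle_ineq2[of x c] by (intro RC) linarith
    qed (use RC in auto)
    have int0: "integrable lborel (\<lambda>x. \<eta> x *\<^sub>R f x)" if f: "loc_integrable f" for f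
      using int[OF f, of 0] by simp
    let ?P = "lborel \<Otimes>\<^sub>M (lborel :: real measure)"
    \<comment> \<open>For s in {0..t} the function \<open>D (x - s *\<^sub>R v)\<close> vanishes
      outside the ball of this radius. So \<open>K\<close> is dominated by C times
      \<open>segment_fun\<close> with direction 0, that is, by a multiple of \<psi>(x) cut off to a
      ball times an interval.\<close>
    define L where "L = R + t * norm v"
    define K where "K = (\<lambda>(x, s). (indicator {0..t} s * D (x - s *\<^sub>R v)) *\<^sub>R \<psi> x)"
    have K: "integrable ?P K"
    proof (rule Bochner_Integration.integrable_bound)
      show "integrable ?P (\<lambda>p. C *\<^sub>R segment_fun L t 0 \<psi> p)"
        by (intro integrable_scaleR_right integrable_along_segment[OF \<psi>])
      show "K \<in> borel_measurable ?P" unfolding K_def by measurable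
      show "AE p in ?P. norm (K p) \<le> norm (C *\<^sub>R segment_fun L t 0 \<psi> p)"
      proof (intro AE_I2)
        fix p :: "'a \<times> real"
        obtain x s where p: "p = (x, s)" by force
        show "norm (K p) \<le> norm (C *\<^sub>R segment_fun L t 0 \<psi> p)"
        proof (cases "s \<in> {0..t} \<and> D (x - s *\<^sub>R v) \<noteq> 0")
          case True
          have "norm (x - s *\<^sub>R v) < R" using True RC(5) by (meson not_le)
          moreover have "norm x \<le> norm (x - s *\<^sub>R v) + \<bar>s\<bar> * norm v"
            using norm_triangle_ineq[of "x - s *\<^sub>R v" "s *\<^sub>R v"] by simp
          moreover have "\<bar>s\<bar> * norm v \<le> t * norm v" using True by (intro mult_right_mono) auto
          ultimately have "x \<in> ball 0 L" by (simp add: L_def)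
          then show ?thesis using True RC(2) RC(6)[of "x - s *\<^sub>R v"] by (simp add: p K_def segment_fun_def mult_right_mono)
        qed (auto simp: p K_def segment_fun_def)
      qed
    qed
    have D_cont: "continuous_on {0..t} (\<lambda>s. D (x - s *\<^sub>R v))" for x
      unfolding D_def by (rule continuous_on_compose2[OF T(3)]) (auto intro!: continuous_intros)
    have D_int: "integrable lborel (\<lambda>s. indicator {0..t} s * D (x - s *\<^sub>R v))" for x
      using borel_integrable_atLeastAtMost'[OF D_cont] by (simp add: set_integrable_def)
    \<comment> \<open>A primitive of s -> \<open>D (x - s *\<^sub>R v)\<close> is s ->
      \<open>- \<eta> (x - s *\<^sub>R v)\<close>.\<close>
    have ftc: "(LINT s|lborel. indicator {0..t} s * D (x - s *\<^sub>R v)) = \<eta> x - \<eta> (x - t *\<^sub>R v)" for x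
    proof -
      have "(LINT s|lborel. indicator {0..t} s *\<^sub>R D (x - s *\<^sub>R v)) = - \<eta> (x - t *\<^sub>R v) - (- \<eta> (x - 0 *\<^sub>R v))"
      proof (rule integral_FTC_atLeastAtMost[OF t])
        fix s :: real
        have "((\<lambda>s. x - s *\<^sub>R v) has_derivative (\<lambda>h. - (h *\<^sub>R v))) (at s within {0..t})"
          by (auto intro!: derivative_eq_intros)
        from has_derivative_compose[OF this T(1)[of "x - s *\<^sub>R v"]]
        have "((\<lambda>s. - \<eta> (x - s *\<^sub>R v)) has_derivative (\<lambda>h. - frechet_derivative \<eta> (at (x - s *\<^sub>R v)) (- (h *\<^sub>R v)))) (at s within {0..t})"
          by (rule has_derivative_minus)
        moreover have "linear (frechet_derivative \<eta> (at (x - s *\<^sub>R v)))"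
          using T(1) has_derivative_linear by blast
        ultimately show "((\<lambda>s. - \<eta> (x - s *\<^sub>R v)) has_vector_derivative D (x - s *\<^sub>R v)) (at s within {0..t})"
          by (simp add: has_vector_derivative_def D_def linear_neg linear_cmul)
        show "continuous_on {0..t} (\<lambda>s. D (x - s *\<^sub>R v))"
          by (rule D_cont)
      qed
      then show ?thesis by simp
    qed
    have "(LINT x|lborel. \<eta> x *\<^sub>R (\<psi> (x + t *\<^sub>R v) - \<psi> x))
      = (LINT x|lborel. \<eta> x *\<^sub>R \<psi> (x + t *\<^sub>R v)) - (LINT x|lborel. \<eta> x *\<^sub>R \<psi> x)"
      using int0[OF \<psi>t] int0[OF \<psi>] by (simp add: scaleR_diff_right)
    also have "(LINT x|lborel. \<eta> x *\<^sub>R \<psi> (x + t *\<^sub>R v)) = (LINT x|lborel. \<eta> (x - t *\<^sub>R v) *\<^sub>R \<psi> x)"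
      using integral_lborel_translate[of "\<lambda>x. \<eta> (x - t *\<^sub>R v) *\<^sub>R \<psi> x" "t *\<^sub>R v"] by simp
    also have "\<dots> - (LINT x|lborel. \<eta> x *\<^sub>R \<psi> x) = (LINT x|lborel. (\<eta> (x - t *\<^sub>R v) - \<eta> x) *\<^sub>R \<psi> x)"
      using int[OF \<psi>] int0[OF \<psi>] by (simp add: scaleR_diff_left)
    also have "\<dots> = - (LINT x|lborel. LINT s|lborel. K (x, s))"
    proof -
      have "(LINT s|lborel. K (x, s)) = (\<eta> x - \<eta> (x - t *\<^sub>R v)) *\<^sub>R \<psi> x" for x
        unfolding K_def ftc[symmetric] prod.case by (rule integral_scaleR_left) (rule D_int)
      then show ?thesis
        by (simp flip: integral_minus scaleR_minus_left)
    qed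
    also have "(LINT x|lborel. LINT s|lborel. K (x, s)) = (LINT s|lborel. LINT x|lborel. K (x, s))"
      using lborel_pair.Fubini_integral[of "\<lambda>x s. K (x, s)"] K by simp
    also have "\<dots> = - (LINT s|lborel. LINT x|lborel. indicator {0..t} s *\<^sub>R (\<eta> x *\<^sub>R F (x + s *\<^sub>R v)))"
    proof -
      have "(LINT x|lborel. K (x, s)) = - (LINT x|lborel. indicator {0..t} s *\<^sub>R (\<eta> x *\<^sub>R F (x + s *\<^sub>R v)))" for s
      proof -
        have "(LINT x|lborel. K (x, s)) = indicator {0..t} s *\<^sub>R (LINT x|lborel. D (x - s *\<^sub>R v) *\<^sub>R \<psi> x)"
          by (simp add: K_def flip: scaleR_scaleR)
        \<comment> \<open>For each fixed s the translate of \<eta> by sv is again a test function,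
          so the weak formulation applies to it.\<close>
        also have "(LINT x|lborel. D (x - s *\<^sub>R v) *\<^sub>R \<psi> x) = - (LINT x|lborel. \<eta> (x - s *\<^sub>R v) *\<^sub>R F x)"
          using weak[OF test_function_translate(1)[OF \<eta>, of "s *\<^sub>R v"]]
          by (simp add: test_function_translate(2)[OF \<eta>] D_def)
        also have "(LINT x|lborel. \<eta> (x - s *\<^sub>R v) *\<^sub>R F x) = (LINT x|lborel. \<eta> x *\<^sub>R F (x + s *\<^sub>R v))"
          using integral_lborel_translate[of "\<lambda>x. \<eta> (x - s *\<^sub>R v) *\<^sub>R F x" "s *\<^sub>R v"] by simp
        finally show ?thesis
          by (simp only: scaleR_minus_right integral_scaleR_right)
      qed
      then show ?thesis by simp
    qed
    also have "(LINT s|lborel. LINT x|lborel. indicator {0..t} s *\<^sub>R (\<eta> x *\<^sub>R F (x + s *\<^sub>R v)))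
      = (LINT x|lborel. LINT s|lborel. indicator {0..t} s *\<^sub>R (\<eta> x *\<^sub>R F (x + s *\<^sub>R v)))"
    proof (rule lborel_pair.Fubini_integral)
      show "integrable ?P (\<lambda>(x, s). indicator {0..t} s *\<^sub>R (\<eta> x *\<^sub>R F (x + s *\<^sub>R v)))"
      proof (rule Bochner_Integration.integrable_bound)
        show "integrable ?P (\<lambda>p. C *\<^sub>R segment_fun R t v F p)"
          by (intro integrable_scaleR_right integrable_along_segment[OF F])
        show "AE p in ?P. norm ((\<lambda>(x, s). indicator {0..t} s *\<^sub>R (\<eta> x *\<^sub>R F (x + s *\<^sub>R v))) p)
          \<le> norm (C *\<^sub>R segment_fun R t v F p)"
        proof (intro AE_I2)
          fix p :: "'a \<times> real"
          obtain x s where p: "p = (x, s)" by force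
          show "norm ((\<lambda>(x, s). indicator {0..t} s *\<^sub>R (\<eta> x *\<^sub>R F (x + s *\<^sub>R v))) p)
            \<le> norm (C *\<^sub>R segment_fun R t v F p)"
            using RC(3)[of x] RC(4)[of x] RC(2)
            by (cases "norm x < R"; cases "s \<in> {0..t}") (auto simp: p segment_fun_def intro!: mult_right_mono)
        qed
      qed measurable
    qed
    also have "\<dots> = (LINT x|lborel. \<eta> x *\<^sub>R J x)"
    proof -
      have "(LINT s|lborel. indicator {0..t} s *\<^sub>R (\<eta> x *\<^sub>R F (x + s *\<^sub>R v))) = \<eta> x *\<^sub>R J x" for x
      proof -
        have "(LINT s|lborel. indicator {0..t} s *\<^sub>R (\<eta> x *\<^sub>R F (x + s *\<^sub>R v)))
          = (LINT s|lborel. \<eta> x *\<^sub>R (indicator {0..t} s *\<^sub>R F (x + s *\<^sub>R v)))"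
          by (simp only: scaleR_left_commute)
        then show ?thesis
          unfolding J_def set_lebesgue_integral_def by (simp only: integral_scaleR_right)
      qed
      then show ?thesis by simp
    qed
    finally have "(LINT x|lborel. \<eta> x *\<^sub>R (\<psi> (x + t *\<^sub>R v) - \<psi> x)) = (LINT x|lborel. \<eta> x *\<^sub>R J x)"
      by simp
    moreover have "integrable lborel (\<lambda>x. \<eta> x *\<^sub>R (\<psi> (x + t *\<^sub>R v) - \<psi> x))"
      using int0[OF \<psi>t] int0[OF \<psi>] by (simp add: scaleR_diff_right)
    ultimately show "(LINT x|lborel. \<eta> x *\<^sub>R w x) = 0"
      using int0[OF J] by (simp add: w_def scaleR_diff_right)
  qed
  then show ?thesis by eventually_elim (simp add: w_def J_def)
qed

section \<open>Diamagnetic translation estimate\<close>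

text \<open>Cauchy-Schwarz against the constant 1 on an interval of length 1.\<close>

lemma nn_integral_Icc_square_le:
  fixes f :: "real \<Rightarrow> real"
  assumes f: "set_integrable lborel {0..1} f" and pos: "\<And>s. f s \<ge> 0"
    and [measurable]: "f \<in> borel_measurable borel"
  shows "ennreal ((LINT s:{0..1}|lborel. f s)\<^sup>2) \<le> (\<integral>\<^sup>+s\<in>{0..1}. ennreal ((f s)\<^sup>2) \<partial>lborel)"
proof -
  have "ennreal (LINT s:{0..1}|lborel. f s) = (\<integral>\<^sup>+s. ennreal (indicator {0..1} s *\<^sub>R f s) \<partial>lborel)"
    unfolding set_lebesgue_integral_def
    by (rule nn_integral_eq_integral[symmetric]) (use f pos in \<open>auto simp: set_integrable_def\<close>)
  also have "\<dots> = (\<integral>\<^sup>+s. (ennreal (f s) * indicator {0..1} s) * indicator {0..1} s \<partial>lborel)"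
    by (intro nn_integral_cong) (auto simp: indicator_def)
  finally have eq: "ennreal (LINT s:{0..1}|lborel. f s) = \<dots>" .
  have "(\<integral>\<^sup>+s. (ennreal (f s) * indicator {0..1} s) * indicator {0..1} s \<partial>lborel)\<^sup>2
    \<le> (\<integral>\<^sup>+s. (ennreal (f s) * indicator {0..1} s)\<^sup>2 \<partial>lborel) * (\<integral>\<^sup>+s. (indicator {0..1::real} s)\<^sup>2 \<partial>lborel)"
    by (rule Cauchy_Schwarz_nn_integral) auto
  also have "(\<integral>\<^sup>+s. (indicator {0..1::real} s)\<^sup>2 \<partial>lborel) = (\<integral>\<^sup>+s. (indicator {0..1::real} s) \<partial>lborel)"
    by (intro nn_integral_cong) (auto simp: indicator_def)
  also have "\<dots> = 1" by simp
  also have "(\<integral>\<^sup>+s. (ennreal (f s) * indicator {0..1} s)\<^sup>2 \<partial>lborel) = (\<integral>\<^sup>+s\<in>{0..1}. ennreal ((f s)\<^sup>2) \<partial>lborel)"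
    using pos by (intro nn_integral_cong) (auto simp: indicator_def ennreal_power)
  finally show ?thesis
    unfolding eq[symmetric] using pos
    by (simp add: ennreal_power set_lebesgue_integral_def)
qed

text \<open>For almost every x, the integral of F along the segment gives a continuous version of s
  -> \<psi>(x + sv). Inserting it for \<psi> in the definition of F yields the differential equation
  required by \<open>diamagnetic_line\<close>.\<close>

lemma diamagnetic_translation:
  fixes \<psi> G :: "'a::euclidean_space \<Rightarrow> complex" and a :: "'a \<Rightarrow> real" and v :: 'a
  defines "F \<equiv> \<lambda>x. G x - \<i> * complex_of_real (a x) * \<psi> x"
  assumes \<psi>: "loc_integrable \<psi>" and G: "loc_integrable G" and F: "loc_integrable F"
    and weak: "\<And>\<eta>. test_function \<eta> \<Longrightarrow>
      (LINT x|lborel. frechet_derivative \<eta> (at x) v *\<^sub>R \<psi> x) = - (LINT x|lborel. \<eta> x *\<^sub>R F x)"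
  shows "AE x in lborel. ennreal ((norm (\<psi> (x + v)) - norm (\<psi> x))\<^sup>2)
      \<le> 4 * (\<integral>\<^sup>+s\<in>{0..1}. ennreal ((norm (G (x + s *\<^sub>R v)))\<^sup>2) \<partial>lborel)"
proof -
  note [measurable] = loc_integrable_borel[OF F] loc_integrable_borel[OF \<psi>] loc_integrable_borel[OF G]
  define J where "J = (\<lambda>x t. LINT s|lborel. (if 0 \<le> s \<and> s \<le> t then F (x + s *\<^sub>R v) else 0))"
  have Jeq: "J x t = (LINT s:{0..t}|lborel. F (x + s *\<^sub>R v))" for x t
    unfolding J_def set_lebesgue_integral_def
    by (intro Bochner_Integration.integral_cong) (auto simp: indicator_def)
  have Jm: "(\<lambda>p. J (fst p) (snd p)) \<in> borel_measurable (lborel \<Otimes>\<^sub>M lborel)"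
    unfolding J_def by measurable
  have id: "AE x in lborel. \<psi> (x + t *\<^sub>R v) - \<psi> x = J x t" if "t \<ge> 0" for t
    using translation_identity[OF \<psi> F that weak] by (simp add: Jeq)
  \<comment> \<open>The translation identity has an exceptional null set of x for each t. The line
    argument needs, for almost every x, the identity at almost every t; Fubini exchanges the two,
    which is why joint measurability of \<open>J\<close> is needed.\<close>
  have "AE x in lborel. AE t in lborel. t \<in> {0..1} \<longrightarrow> \<psi> (x + t *\<^sub>R v) - \<psi> x = J x t"
  proof (rule lborel_pair.AE_commute[THEN iffD2])
    have [measurable]: "Measurable.pred (lborel \<Otimes>\<^sub>M lborel) (\<lambda>p. \<psi> (fst p + snd p *\<^sub>R v) - \<psi> (fst p) = J (fst p) (snd p))"
      using Jm by measurable
    show "{p \<in> space (lborel \<Otimes>\<^sub>M lborel). snd p \<in> {0..1} \<longrightarrow> \<psi> (fst p + snd p *\<^sub>R v) - \<psi> (fst p) = J (fst p) (snd p)}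
        \<in> sets (lborel \<Otimes>\<^sub>M lborel)"
      by measurable
    show "AE t in lborel. AE x in lborel. t \<in> {0..1} \<longrightarrow> \<psi> (x + t *\<^sub>R v) - \<psi> x = J x t"
    proof (rule AE_I2)
      fix t :: real
      show "AE x in lborel. t \<in> {0..1} \<longrightarrow> \<psi> (x + t *\<^sub>R v) - \<psi> x = J x t"
        using id[of t] by (cases "t \<in> {0..1}") auto
    qed
  qed
  \<comment> \<open>Almost every t need not include the endpoint t = 1, so the identity there is
    added separately.\<close>
  then show ?thesis
    using id[OF zero_le_one] set_integrable_segment_AE[OF F, of 1 v] set_integrable_segment_AE[OF G, of 1 v]
  proof eventually_elim
    case (elim x)
    have "AE s in lborel. s \<in> {0..1} \<longrightarrow> F (x + s *\<^sub>R v) = G (x + s *\<^sub>R v)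
        - \<i> * complex_of_real (a (x + s *\<^sub>R v)) * (\<psi> x + (LINT \<tau>:{0..s}|lborel. F (x + \<tau> *\<^sub>R v)))"
      using elim(1)
    proof eventually_elim
      case (elim s)
      show ?case
      proof
        assume "s \<in> {0..1}"
        then have "\<psi> (x + s *\<^sub>R v) = \<psi> x + (LINT \<tau>:{0..s}|lborel. F (x + \<tau> *\<^sub>R v))"
          using elim by (simp add: Jeq algebra_simps)
        then show "F (x + s *\<^sub>R v) = G (x + s *\<^sub>R v)
            - \<i> * complex_of_real (a (x + s *\<^sub>R v)) * (\<psi> x + (LINT \<tau>:{0..s}|lborel. F (x + \<tau> *\<^sub>R v)))"
          by (simp only: F_def)
      qed
    qed
    note diamagnetic_line[OF elim(3,4) this]
    also have "\<psi> x + (LINT s:{0..1}|lborel. F (x + s *\<^sub>R v)) = \<psi> (x + v)"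
      using elim(2) by (simp add: Jeq algebra_simps)
    finally have "\<bar>norm (\<psi> (x + v)) - norm (\<psi> x)\<bar>\<^sup>2 \<le> (2 * (LINT s:{0..1}|lborel. norm (G (x + s *\<^sub>R v))))\<^sup>2"
      by (intro power_mono) auto
    then have "ennreal ((norm (\<psi> (x + v)) - norm (\<psi> x))\<^sup>2) \<le> ennreal (4 * (LINT s:{0..1}|lborel. norm (G (x + s *\<^sub>R v)))\<^sup>2)"
      by (intro ennreal_leI) (simp add: power_mult_distrib)
    also have "\<dots> = 4 * ennreal ((LINT s:{0..1}|lborel. norm (G (x + s *\<^sub>R v)))\<^sup>2)"
      by (simp add: ennreal_mult)
    also have "\<dots> \<le> 4 * (\<integral>\<^sup>+s\<in>{0..1}. ennreal ((norm (G (x + s *\<^sub>R v)))\<^sup>2) \<partial>lborel)"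
    proof (intro mult_left_mono nn_integral_Icc_square_le)
      show "set_integrable lborel {0..1} (\<lambda>s. norm (G (x + s *\<^sub>R v)))"
        using set_integrable_norm[OF elim(4)] .
      show "(\<lambda>s. norm (G (x + s *\<^sub>R v))) \<in> borel_measurable borel" by measurable
    qed auto
    finally show ?case .
  qed
qed

text \<open>Integrated over x, every translate G(x + sv) has the same norm, and s runs over an
  interval of length 1. The 4 is the square of the factor in
  \<open>diamagnetic_line\<close>.\<close>

lemma diamagnetic_translation_L2:
  fixes \<psi> G :: "'a::euclidean_space \<Rightarrow> complex" and a :: "'a \<Rightarrow> real" and v :: 'a
  assumes \<psi>: "loc_integrable \<psi>" and G: "loc_integrable G"
    and F: "loc_integrable (\<lambda>x. G x - \<i> * complex_of_real (a x) * \<psi> x)"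
    and weak: "\<And>\<eta>. test_function \<eta> \<Longrightarrow>
      (LINT x|lborel. frechet_derivative \<eta> (at x) v *\<^sub>R \<psi> x)
      = - (LINT x|lborel. \<eta> x *\<^sub>R (G x - \<i> * complex_of_real (a x) * \<psi> x))"
  shows "(\<integral>\<^sup>+x. ennreal ((norm (\<psi> (x + v)) - norm (\<psi> x))\<^sup>2) \<partial>lborel) \<le> 4 * (\<integral>\<^sup>+x. ennreal ((norm (G x))\<^sup>2) \<partial>lborel)"
proof -
  note [measurable] = loc_integrable_borel[OF G]
  define g where "g = (\<lambda>x. ennreal ((norm (G x))\<^sup>2))"
  have g_meas[measurable]: "g \<in> borel_measurable borel" unfolding g_def by measurable
  have "(\<integral>\<^sup>+x. ennreal ((norm (\<psi> (x + v)) - norm (\<psi> x))\<^sup>2) \<partial>lborel)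
    \<le> (\<integral>\<^sup>+x. 4 * (\<integral>\<^sup>+s. g (x + s *\<^sub>R v) * indicator {0..1} s \<partial>lborel) \<partial>lborel)"
    unfolding g_def by (rule nn_integral_mono_AE[OF diamagnetic_translation[OF \<psi> G F weak]])
  also have "\<dots> = 4 * (\<integral>\<^sup>+x. \<integral>\<^sup>+s. g (x + s *\<^sub>R v) * indicator {0..1} s \<partial>lborel \<partial>lborel)"
    by (rule nn_integral_cmult) measurable
  also have "(\<integral>\<^sup>+x. \<integral>\<^sup>+s. g (x + s *\<^sub>R v) * indicator {0..1} s \<partial>lborel \<partial>lborel) = (\<integral>\<^sup>+s. \<integral>\<^sup>+x. g (x + s *\<^sub>R v) * indicator {0..1} s \<partial>lborel \<partial>lborel)"
    by (rule lborel_pair.Fubini'[symmetric]) measurable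
  also have "\<dots> = (\<integral>\<^sup>+s. (\<integral>\<^sup>+x. g x \<partial>lborel) * indicator {0..1::real} s \<partial>lborel)"
    by (subst nn_integral_multc, measurable) (simp only: nn_integral_lborel_translate[OF g_meas])
  also have "\<dots> = (\<integral>\<^sup>+x. g x \<partial>lborel)"
    by (subst nn_integral_cmult_indicator) auto
  finally show ?thesis by (simp add: g_def)
qed

lemma loc_integrable_dominated:
  assumes [measurable]: "f \<in> borel_measurable borel"
    and h: "\<And>x. norm (f x) \<le> h x" "\<And>R. (\<integral>\<^sup>+x\<in>ball 0 R. ennreal (h x) \<partial>lborel) < \<infinity>"
  shows "loc_integrable f"
  unfolding loc_integrable_def set_integrable_def
proof (intro conjI allI integrableI_bounded)
  fix R
  have "(\<integral>\<^sup>+x. ennreal (norm (indicator (ball 0 R) x *\<^sub>R f x)) \<partial>lborel) \<le> (\<integral>\<^sup>+x\<in>ball 0 R. ennreal (h x) \<partial>lborel)"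
    using h(1) by (intro nn_integral_mono) (auto simp: indicator_def intro: ennreal_leI)
  then show "(\<integral>\<^sup>+x. ennreal (norm (indicator (ball 0 R) x *\<^sub>R f x)) \<partial>lborel) < \<infinity>"
    using h(2) by (rule le_less_trans)
  have [measurable]: "ball (0::'a) R \<in> sets borel" by simp
  show "(\<lambda>x. indicator (ball 0 R) x *\<^sub>R f x) \<in> borel_measurable lborel" by measurable
qed measurable

section \<open>Magnetic Sobolev inequality\<close>

text \<open>Reduces to real-valued functions by coordinates. It links the spaces of Lebesgue
  measurable functions with the Borel setting in which translations and Fubini are carried
  out.\<close>

lemma borel_representative:
  fixes f :: "'a::euclidean_space \<Rightarrow> 'b::euclidean_space"
  assumes "f \<in> borel_measurable lebesgue"
  obtains f' where "f' \<in> borel_measurable borel" "AE x in lborel. f x = f' x"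
proof -
  have "\<exists>g. g \<in> borel_measurable lborel \<and> (AE x in lborel. f x \<bullet> b = g x)" for b
    using completion_ex_borel_measurable_real[of "\<lambda>x. f x \<bullet> b" lborel] assms by auto
  then obtain g where g: "\<And>b. g b \<in> borel_measurable lborel" "\<And>b. AE x in lborel. f x \<bullet> b = g b x"
    by metis
  show ?thesis
  proof (rule that[of "\<lambda>x. \<Sum>b\<in>Basis. g b x *\<^sub>R b"])
    have [measurable]: "g b \<in> borel_measurable borel" for b using g(1) by simp
    show "(\<lambda>x. \<Sum>b\<in>Basis. g b x *\<^sub>R b) \<in> borel_measurable borel" by measurable
    have "AE x in lborel. \<forall>b\<in>(Basis::'b set). f x \<bullet> b = g b x"
      by (intro AE_finite_allI g(2)) simp
    then show "AE x in lborel. f x = (\<Sum>b\<in>Basis. g b x *\<^sub>R b)"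
    proof eventually_elim
      case (elim x)
      have "f x = (\<Sum>b\<in>Basis. (f x \<bullet> b) *\<^sub>R b)" by (simp add: euclidean_representation)
      then show ?case using elim by simp
    qed
  qed
qed

section \<open>From Lebesgue measurable functions to Borel representatives\<close>

lemma nn_integral_lebesgue_eq:
  assumes "AE x in lborel. f x = f' x"
  shows "(\<integral>\<^sup>+x. h (f x) \<partial>lebesgue) = (\<integral>\<^sup>+x. h (f' x) \<partial>lborel)"
  unfolding nn_integral_completion using assms by (intro nn_integral_cong_AE) auto

lemma integral_lebesgue_eq:
  fixes f f' :: "'a::euclidean_space \<Rightarrow> 'b::{banach, second_countable_topology}"
  assumes ae: "AE x in lborel. f x = f' x"
    and f: "f \<in> borel_measurable lebesgue" and f': "f' \<in> borel_measurable borel"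
  shows "(LINT x|lebesgue. f x) = (LINT x|lborel. f' x)"
proof -
  have "(LINT x|lebesgue. f x) = (LINT x|lebesgue. f' x)"
    using f f' AE_completion[OF ae] by (intro integral_cong_AE) (auto intro: measurable_completion)
  also have "\<dots> = (LINT x|lborel. f' x)"
    using f' by (intro integral_completion) simp
  finally show ?thesis .
qed

lemma loc_integrable_sum_scaleR:
  assumes "\<And>j. loc_integrable (f j)" "finite I"
  shows "loc_integrable (\<lambda>x. \<Sum>j\<in>I. c j *\<^sub>R f j x)"
proof -
  have [measurable]: "f j \<in> borel_measurable borel" for j using assms(1) by (rule loc_integrable_borel)
  have "integrable lborel (\<lambda>x. \<Sum>j\<in>I. c j *\<^sub>R (indicator (ball 0 R) x *\<^sub>R f j x))" for R
    using assms by (intro Bochner_Integration.integrable_sum integrable_scaleR_right)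
      (simp add: loc_integrable_def set_integrable_def)
  moreover have "(\<Sum>j\<in>I. c j *\<^sub>R (indicator (ball 0 R) x *\<^sub>R f j x)) = indicator (ball 0 R) x *\<^sub>R (\<Sum>j\<in>I. c j *\<^sub>R f j x)" for R x
    by (simp add: scaleR_sum_right mult.commute)
  ultimately show ?thesis by (simp add: loc_integrable_def set_integrable_def)
qed

lemma borel_measurable_vec_nth [measurable (raw)]:
  fixes f :: "'a \<Rightarrow> ('b::euclidean_space)^'n"
  shows "f \<in> borel_measurable M \<Longrightarrow> (\<lambda>x. f x $ j) \<in> borel_measurable M"
  using borel_measurable_continuous_onI[OF linear_continuous_on[OF bounded_linear_vec_nth]]
  by (rule measurable_compose[rotated])

lemma norm_sum_scaleR_le:
  fixes v :: "real^'n" and z :: "complex^'n"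
  shows "norm (\<Sum>j\<in>UNIV. v $ j *\<^sub>R z $ j) \<le> norm v * norm z"
proof -
  have "norm (\<Sum>j\<in>UNIV. v $ j *\<^sub>R z $ j) \<le> (\<Sum>j\<in>UNIV. norm (v $ j) * norm (z $ j))"
    by (rule order_trans[OF norm_sum]) simp
  also have "\<dots> \<le> norm v * norm z"
    using L2_set_mult_ineq[of "\<lambda>j. norm (v $ j)" "\<lambda>j. norm (z $ j)" UNIV] by (simp add: norm_vec_def)
  finally show ?thesis .
qed

definition loc_square_integrable :: "(real^'n \<Rightarrow> real^'n) \<Rightarrow> bool" where
  "loc_square_integrable A \<longleftrightarrow> A \<in> borel_measurable lebesgue \<and>
     (\<forall>R. (\<integral>\<^sup>+x\<in>ball 0 R. ennreal ((norm (A x))\<^sup>2) \<partial>lebesgue) < \<infinity>)"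

lemma Lloc_loc_square_integrable:
  fixes A :: "real^'n \<Rightarrow> real^'n"
  assumes "A \<in> Lloc r" "r \<ge> 2"
  shows "loc_square_integrable A"
  unfolding loc_square_integrable_def
proof (intro conjI allI)
  show [measurable]: "A \<in> borel_measurable lebesgue" using assms by (simp add: Lloc_def)
  fix R
  have cball_lebesgue[measurable]: "cball (0::real^'n) R \<in> sets lebesgue" by auto
  have "(\<integral>\<^sup>+x\<in>ball 0 R. ennreal ((norm (A x))\<^sup>2) \<partial>lebesgue)
    \<le> (\<integral>\<^sup>+x. indicator (cball 0 R) x + ennreal (norm (A x) powr r) * indicator (cball 0 R) x \<partial>lebesgue)" (is "_ \<le> (\<integral>\<^sup>+x. ?h x \<partial>lebesgue)")
  proof (intro nn_integral_mono)
    fix x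
    have "(norm (A x))\<^sup>2 \<le> 1 + norm (A x) powr r"
    proof (cases "norm (A x) \<le> 1")
      case True
      then have "(norm (A x))\<^sup>2 \<le> 1" by (simp add: power_le_one)
      then show ?thesis by (simp add: add_increasing2)
    next
      case False
      then have "norm (A x) powr 2 \<le> norm (A x) powr r" using assms by (intro powr_mono) auto
      then show ?thesis using False by simp
    qed
    then have "ennreal ((norm (A x))\<^sup>2) \<le> 1 + ennreal (norm (A x) powr r)"
      by (simp add: ennreal_leI flip: ennreal_1 ennreal_plus)
    then show "ennreal ((norm (A x))\<^sup>2) * indicator (ball 0 R) x
      \<le> ?h x"
      by (cases "x \<in> ball 0 R") (auto simp: indicator_def)
  qed
  also have "\<dots> = emeasure lebesgue (cball (0::real^'n) R) + (\<integral>\<^sup>+x\<in>cball 0 R. ennreal (norm (A x) powr r) \<partial>lebesgue)"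
    by (subst nn_integral_add, measurable)
  also have "\<dots> < \<infinity>"
    using assms emeasure_bounded_finite[OF bounded_cball, of "0::real^'n" R] by (auto simp: Lloc_def)
  finally show "(\<integral>\<^sup>+x\<in>ball 0 R. ennreal ((norm (A x))\<^sup>2) \<partial>lebesgue) < \<infinity>" .
qed

lemma Lspace_2:
  "u \<in> Lspace 2 \<longleftrightarrow> u \<in> borel_measurable lebesgue \<and> (\<integral>\<^sup>+x. ennreal ((norm (u x))\<^sup>2) \<partial>lebesgue) < \<infinity>"
proof -
  have "ennreal (norm (u x)) epowr 2 = ennreal ((norm (u x))\<^sup>2)" for x
    by (simp add: epowr_def)
  moreover have "(y epowr (1 / 2) < top) = (y < top)" for y
    by (simp add: epowr_def less_top)
  ultimately show ?thesis
    by (auto simp: Lspace_def Lnorm_def Lnorm_abs_def less_ennreal.rep_eq[symmetric] simp flip: enn2ereal_top top_ereal_def)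
qed

text \<open>One function, integrable on balls, that dominates \<psi>, the components of g and those
  of g - iA\<psi>: linear terms use t \<le> 1 + t^2, the mixed term uses |A||\<psi>| \<le> |A|^2 +
  |\<psi>|^2.\<close>

definition majorant :: "(real^'n \<Rightarrow> real^'n) \<Rightarrow> (real^'n \<Rightarrow> complex) \<Rightarrow> (real^'n \<Rightarrow> complex^'n) \<Rightarrow> real^'n \<Rightarrow> real" where
  "majorant A \<psi> g x = 1 + (norm (g x))\<^sup>2 + (norm (A x))\<^sup>2 + (norm (\<psi> x))\<^sup>2"

lemma majorant_bounds:
  shows "norm (\<psi> x) \<le> majorant A \<psi> g x"
    and "norm (g x $ j) \<le> majorant A \<psi> g x"
    and "norm (g x $ j - \<i> * complex_of_real (A x $ j) * \<psi> x) \<le> majorant A \<psi> g x"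
proof -
  have sq: "t \<le> 1 + t\<^sup>2" for t :: real
    using zero_le_power2[of "t - 1/2"] by (simp add: power2_eq_square algebra_simps)
  have nonneg: "(norm (g x))\<^sup>2 \<ge> 0" "(norm (A x))\<^sup>2 \<ge> 0" "(norm (\<psi> x))\<^sup>2 \<ge> 0" by simp_all
  show "norm (\<psi> x) \<le> majorant A \<psi> g x"
    unfolding majorant_def using sq[of "norm (\<psi> x)"] nonneg by linarith
  show "norm (g x $ j) \<le> majorant A \<psi> g x"
    unfolding majorant_def
    using Finite_Cartesian_Product.norm_nth_le[of "g x" j] sq[of "norm (g x)"] nonneg by linarith
  have "norm (g x $ j - \<i> * complex_of_real (A x $ j) * \<psi> x) \<le> norm (g x $ j) + norm (A x $ j) * norm (\<psi> x)"
    by (rule order_trans[OF norm_triangle_ineq4]) (simp add: norm_mult)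
  also have "\<dots> \<le> norm (g x) + norm (A x) * norm (\<psi> x)"
    by (intro add_mono mult_right_mono Finite_Cartesian_Product.norm_nth_le) auto
  also have "\<dots> \<le> (1 + (norm (g x))\<^sup>2) + ((norm (A x))\<^sup>2 + (norm (\<psi> x))\<^sup>2)"
  proof (intro add_mono sq)
    have "2 * (norm (A x) * norm (\<psi> x)) \<le> (norm (A x))\<^sup>2 + (norm (\<psi> x))\<^sup>2"
      using zero_le_power2[of "norm (A x) - norm (\<psi> x)"] by (simp add: power2_eq_square algebra_simps)
    moreover have "0 \<le> norm (A x) * norm (\<psi> x)" by simp
    ultimately show "norm (A x) * norm (\<psi> x) \<le> (norm (A x))\<^sup>2 + (norm (\<psi> x))\<^sup>2" by linarith
  qed
  finally show "norm (g x $ j - \<i> * complex_of_real (A x $ j) * \<psi> x) \<le> majorant A \<psi> g x"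
    by (simp add: majorant_def)
qed

lemma nn_integral_majorant_finite:
  fixes A :: "real^'n \<Rightarrow> real^'n"
  assumes A: "loc_square_integrable A" and \<psi>: "\<psi> \<in> Lspace 2" and g: "g \<in> Lspace 2"
  shows "(\<integral>\<^sup>+x\<in>ball 0 R. ennreal (majorant A \<psi> g x) \<partial>lebesgue) < \<infinity>"
proof -
  have [measurable]: "A \<in> borel_measurable lebesgue" "\<psi> \<in> borel_measurable lebesgue" "g \<in> borel_measurable lebesgue"
    using A \<psi> g by (simp_all add: Lspace_2 loc_square_integrable_def)
  have [measurable]: "ball (0::real^'n) R \<in> sets lebesgue" by auto
  have "(\<integral>\<^sup>+x\<in>ball 0 R. ennreal (majorant A \<psi> g x) \<partial>lebesgue)
    \<le> (\<integral>\<^sup>+x. indicator (ball 0 R) x + ennreal ((norm (g x))\<^sup>2)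
      + ennreal ((norm (A x))\<^sup>2) * indicator (ball 0 R) x + ennreal ((norm (\<psi> x))\<^sup>2) \<partial>lebesgue)"
    by (intro nn_integral_mono) (auto simp: indicator_def majorant_def)
  also have "\<dots> = emeasure lebesgue (ball (0::real^'n) R) + (\<integral>\<^sup>+x. ennreal ((norm (g x))\<^sup>2) \<partial>lebesgue)
      + (\<integral>\<^sup>+x\<in>ball 0 R. ennreal ((norm (A x))\<^sup>2) \<partial>lebesgue) + (\<integral>\<^sup>+x. ennreal ((norm (\<psi> x))\<^sup>2) \<partial>lebesgue)"
    by (simp add: nn_integral_add)
  also have "\<dots> < \<infinity>"
    using A g \<psi> emeasure_bounded_finite[OF bounded_ball, of "0::real^'n" R]
    by (simp add: Lspace_2 loc_square_integrable_def)
  finally show ?thesis .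
qed

text \<open>Contracting the coordinatewise weak formulation with v gives the weak derivative in
  direction v, with G = v.g and the real coefficient a = A.v, as in the one-dimensional diamagnetic
  estimate. Then |v.g| \<le> |v||g|.\<close>

lemma mag_grad_translation_estimate:
  fixes A :: "real^'n \<Rightarrow> real^'n"
  assumes A: "loc_square_integrable A" and \<psi>: "\<psi> \<in> Lspace 2" and g: "is_mag_grad A \<psi> g"
    and \<psi>'[measurable]: "\<psi>' \<in> borel_measurable borel" and \<psi>\<psi>': "AE x in lborel. \<psi> x = \<psi>' x"
  shows "(\<integral>\<^sup>+x. ennreal ((norm (\<psi>' (x + v)) - norm (\<psi>' x))\<^sup>2) \<partial>lborel)
      \<le> 4 * ennreal ((norm v)\<^sup>2) * (\<integral>\<^sup>+x. ennreal ((norm (g x))\<^sup>2) \<partial>lebesgue)"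
proof -
  have A_meas: "A \<in> borel_measurable lebesgue" using A by (simp add: loc_square_integrable_def)
  have g_meas: "g \<in> borel_measurable lebesgue" and \<psi>_meas: "\<psi> \<in> borel_measurable lebesgue"
    using g \<psi> by (simp_all add: is_mag_grad_def Lspace_2)
  obtain A' where A'[measurable]: "A' \<in> borel_measurable borel" and AA': "AE x in lborel. A x = A' x"
    using borel_representative[OF A_meas] .
  obtain g' where g'[measurable]: "g' \<in> borel_measurable borel" and gg': "AE x in lborel. g x = g' x"
    using borel_representative[OF g_meas] .
  have g'_eq: "(\<integral>\<^sup>+x. ennreal ((norm (g x))\<^sup>2) \<partial>lebesgue) = (\<integral>\<^sup>+x. ennreal ((norm (g' x))\<^sup>2) \<partial>lborel)"
    using nn_integral_lebesgue_eq[OF gg', of "\<lambda>z. ennreal ((norm z)\<^sup>2)"] .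
  have h_fin: "(\<integral>\<^sup>+x\<in>ball 0 R. ennreal (majorant A' \<psi>' g' x) \<partial>lborel) < \<infinity>" for R
  proof -
    have "(\<integral>\<^sup>+x\<in>ball 0 R. ennreal (majorant A' \<psi>' g' x) \<partial>lborel) = (\<integral>\<^sup>+x\<in>ball 0 R. ennreal (majorant A \<psi> g x) \<partial>lebesgue)"
      unfolding nn_integral_completion
      by (intro nn_integral_cong_AE) (use AA' \<psi>\<psi>' gg' in eventually_elim, simp add: majorant_def)
    then show ?thesis using nn_integral_majorant_finite[OF A \<psi>] g by (simp add: is_mag_grad_def)
  qed
  have \<psi>'_loc: "loc_integrable \<psi>'"
    by (rule loc_integrable_dominated[OF \<psi>' majorant_bounds(1) h_fin])
  have g_comp: "loc_integrable (\<lambda>x. g' x $ j)" for j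
    by (rule loc_integrable_dominated[OF _ majorant_bounds(2) h_fin]) measurable
  define F where "F = (\<lambda>j x. g' x $ j - \<i> * complex_of_real (A' x $ j) * \<psi>' x)"
  have F_comp: "loc_integrable (F j)" for j
    unfolding F_def by (rule loc_integrable_dominated[OF _ majorant_bounds(3) h_fin]) measurable
  have weak_comp: "(LINT x|lborel. frechet_derivative \<eta> (at x) (axis j 1) *\<^sub>R \<psi>' x) = - (LINT x|lborel. \<eta> x *\<^sub>R F j x)"
    if \<eta>: "test_function \<eta>" for \<eta> j
  proof -
    have [measurable]: "\<eta> \<in> borel_measurable borel" "(\<lambda>x. frechet_derivative \<eta> (at x) (axis j 1)) \<in> borel_measurable borel"
      using test_functionD(2,3)[OF \<eta>] by (auto intro: borel_measurable_continuous_onI)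
    then have [measurable]: "\<eta> \<in> borel_measurable lebesgue" "(\<lambda>x. frechet_derivative \<eta> (at x) (axis j 1)) \<in> borel_measurable lebesgue"
      by (auto intro: measurable_completion)
    note [measurable] = A_meas g_meas \<psi>_meas
    have "(LINT x|lebesgue. frechet_derivative \<eta> (at x) (axis j 1) *\<^sub>R \<psi> x) = (LINT x|lborel. frechet_derivative \<eta> (at x) (axis j 1) *\<^sub>R \<psi>' x)"
      by (rule integral_lebesgue_eq) (use \<psi>\<psi>' in eventually_elim, simp, measurable)
    moreover have "(LINT x|lebesgue. \<eta> x *\<^sub>R (g x $ j - \<i> * complex_of_real (A x $ j) * \<psi> x)) = (LINT x|lborel. \<eta> x *\<^sub>R F j x)"
    proof (rule integral_lebesgue_eq)
      show "AE x in lborel. \<eta> x *\<^sub>R (g x $ j - \<i> * complex_of_real (A x $ j) * \<psi> x) = \<eta> x *\<^sub>R F j x"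
        using \<psi>\<psi>' AA' gg' by eventually_elim (simp add: F_def)
      show "(\<lambda>x. \<eta> x *\<^sub>R F j x) \<in> borel_measurable borel" unfolding F_def by measurable
    qed measurable
    ultimately show ?thesis using g \<eta> by (simp add: is_mag_grad_def)
  qed
  define G where "G = (\<lambda>x. \<Sum>j\<in>UNIV. v $ j *\<^sub>R g' x $ j)"
  have F_eq: "G x - \<i> * complex_of_real (A' x \<bullet> v) * \<psi>' x = (\<Sum>j\<in>UNIV. v $ j *\<^sub>R F j x)" for x
    by (simp add: G_def F_def inner_vec_def sum_subtractf[symmetric] sum_distrib_left sum_distrib_right
        scaleR_conv_of_real algebra_simps)
  have "(\<integral>\<^sup>+x. ennreal ((norm (\<psi>' (x + v)) - norm (\<psi>' x))\<^sup>2) \<partial>lborel) \<le> 4 * (\<integral>\<^sup>+x. ennreal ((norm (G x))\<^sup>2) \<partial>lborel)"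
  proof (rule diamagnetic_translation_L2[where a = "\<lambda>x. A' x \<bullet> v", OF \<psi>'_loc])
    show "loc_integrable G"
      unfolding G_def by (intro loc_integrable_sum_scaleR g_comp) simp
    show "loc_integrable (\<lambda>x. G x - \<i> * complex_of_real (A' x \<bullet> v) * \<psi>' x)"
      unfolding F_eq by (intro loc_integrable_sum_scaleR F_comp) simp
    fix \<eta> :: "real^'n \<Rightarrow> real" assume \<eta>: "test_function \<eta>"
    have lin: "linear (frechet_derivative \<eta> (at x))" for x
      using test_functionD(1)[OF \<eta>] has_derivative_linear by blast
    have D: "frechet_derivative \<eta> (at x) v = (\<Sum>j\<in>UNIV. v $ j * frechet_derivative \<eta> (at x) (axis j 1))" for x
    proof -
      have "v = (\<Sum>j\<in>UNIV. v $ j *\<^sub>R axis j 1)"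
        using basis_expansion[of v] by (simp add: scalar_mult_eq_scaleR)
      then have "frechet_derivative \<eta> (at x) v = frechet_derivative \<eta> (at x) (\<Sum>j\<in>UNIV. v $ j *\<^sub>R axis j 1)" by simp
      then show ?thesis by (simp only: linear_sum[OF lin] linear_cmul[OF lin] real_scaleR_def)
    qed
    have i1: "integrable lborel (\<lambda>x. frechet_derivative \<eta> (at x) (axis j 1) *\<^sub>R \<psi>' x)" for j
    proof -
      obtain R C where "\<And>x. norm x \<ge> R \<Longrightarrow> frechet_derivative \<eta> (at x) (axis j 1) = 0"
          "\<And>x. \<bar>frechet_derivative \<eta> (at x) (axis j 1)\<bar> \<le> C"
        using test_function_bounds[OF \<eta>, of "axis j 1"] by metis
      then show ?thesis
        using test_functionD(3)[OF \<eta>, of "axis j 1"]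
        by (intro integrable_compact_support_mult[OF \<psi>'_loc] borel_measurable_continuous_onI) auto
    qed
    have i2: "integrable lborel (\<lambda>x. \<eta> x *\<^sub>R F j x)" for j
    proof -
      obtain R C where "\<And>x. norm x \<ge> R \<Longrightarrow> \<eta> x = 0" "\<And>x. \<bar>\<eta> x\<bar> \<le> C"
        using test_function_bounds[OF \<eta>] by metis
      then show ?thesis
        using test_functionD(2)[OF \<eta>]
        by (intro integrable_compact_support_mult[OF F_comp] borel_measurable_continuous_onI) auto
    qed
    have "(LINT x|lborel. frechet_derivative \<eta> (at x) v *\<^sub>R \<psi>' x)
      = (LINT x|lborel. (\<Sum>j\<in>UNIV. v $ j *\<^sub>R (frechet_derivative \<eta> (at x) (axis j 1) *\<^sub>R \<psi>' x)))"
      by (simp add: D scaleR_sum_left)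
    also have "\<dots> = (\<Sum>j\<in>UNIV. v $ j *\<^sub>R (LINT x|lborel. frechet_derivative \<eta> (at x) (axis j 1) *\<^sub>R \<psi>' x))"
      using i1 by (subst Bochner_Integration.integral_sum) (auto simp only: integral_scaleR_right integrable_scaleR_right)
    also have "\<dots> = - (\<Sum>j\<in>UNIV. v $ j *\<^sub>R (LINT x|lborel. \<eta> x *\<^sub>R F j x))"
      by (simp add: weak_comp[OF \<eta>] sum_negf)
    also have "(\<Sum>j\<in>UNIV. v $ j *\<^sub>R (LINT x|lborel. \<eta> x *\<^sub>R F j x)) = (LINT x|lborel. (\<Sum>j\<in>UNIV. v $ j *\<^sub>R (\<eta> x *\<^sub>R F j x)))"
      using i2 by (subst Bochner_Integration.integral_sum) (auto simp only: integral_scaleR_right integrable_scaleR_right)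
    also have "\<dots> = (LINT x|lborel. \<eta> x *\<^sub>R (\<Sum>j\<in>UNIV. v $ j *\<^sub>R F j x))"
      by (simp only: scaleR_sum_right scaleR_left_commute)
    finally show "(LINT x|lborel. frechet_derivative \<eta> (at x) v *\<^sub>R \<psi>' x)
      = - (LINT x|lborel. \<eta> x *\<^sub>R (G x - \<i> * complex_of_real (A' x \<bullet> v) * \<psi>' x))"
      unfolding F_eq .
  qed
  also have "(\<integral>\<^sup>+x. ennreal ((norm (G x))\<^sup>2) \<partial>lborel) \<le> (\<integral>\<^sup>+x. ennreal ((norm v)\<^sup>2) * ennreal ((norm (g' x))\<^sup>2) \<partial>lborel)"
  proof (intro nn_integral_mono)
    fix x
    have "(norm (G x))\<^sup>2 \<le> (norm v * norm (g' x))\<^sup>2"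
      unfolding G_def by (intro power_mono norm_sum_scaleR_le) simp
    then show "ennreal ((norm (G x))\<^sup>2) \<le> ennreal ((norm v)\<^sup>2) * ennreal ((norm (g' x))\<^sup>2)"
      by (simp add: power_mult_distrib ennreal_leI flip: ennreal_mult)
  qed
  also have "\<dots> = ennreal ((norm v)\<^sup>2) * (\<integral>\<^sup>+x. ennreal ((norm (g' x))\<^sup>2) \<partial>lborel)"
    by (rule nn_integral_cmult) measurable
  finally show ?thesis
    unfolding g'_eq by (simp add: mult_left_mono mult.assoc)
qed

section \<open>Dilations and the interpolation inequality with a small gradient coefficient\<close>

lemma nn_integral_lborel_scale:
  fixes f :: "'a::euclidean_space \<Rightarrow> ennreal"
  assumes [measurable]: "f \<in> borel_measurable borel" and c: "c > 0"
  shows "(\<integral>\<^sup>+x. f x \<partial>lborel) = ennreal (c ^ DIM('a)) * (\<integral>\<^sup>+x. f (c *\<^sub>R x) \<partial>lborel)"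
  by (subst lborel_affine[of c "0::'a"])
    (use c in \<open>auto simp: nn_integral_density nn_integral_distr nn_integral_cmult\<close>)

text \<open>Applied to x -> u(cx), the unscaled estimate has M replaced by c^(-d) M and K by c^(2-d)
  K. After scaling back, the coefficients are C c^(2-2\<sigma>) for K and C c^(-2\<sigma>) for M. As
  \<sigma> < 1, the first can be prescribed through c.\<close>

lemma sobolev_of_translation_estimate_scaled:
  assumes s: "0 < \<sigma>" "\<sigma> < 1" and p: "p > 2" "p = 2 + 2 * \<sigma> * p / DIM('a::euclidean_space)"
    and dim: "DIM('a) \<ge> 2" and e: "\<epsilon> > 0"
  obtains C :: real where "C > 0"
    "\<And>(u :: 'a \<Rightarrow> real) M K. translation_bounds u M K \<Longrightarrow>
      (\<integral>\<^sup>+x. ennreal (u x powr p) \<partial>lborel) \<le> ennreal ((\<epsilon> * K + C * M) powr (p / 2))"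
proof -
  define d where "d = real DIM('a)"
  have d: "d \<ge> 2" using dim by (simp add: d_def)
  obtain C where C: "C > 0" and
    est: "\<And>(u :: 'a \<Rightarrow> real) M K. translation_bounds u M K \<Longrightarrow>
      (\<integral>\<^sup>+x. ennreal (u x powr p) \<partial>lborel) \<le> ennreal ((C * (K + M)) powr (p / 2))"
    using sobolev_of_translation_estimate[where 'a = 'a, OF s p dim] by blast
  \<comment> \<open>The solution of C c^(2-2\<sigma>) = \<epsilon>.\<close>
  define c where "c = (\<epsilon> / C) powr (1 / (2 - 2 * \<sigma>))"
  have c: "c > 0" using e C by (simp add: c_def)
  have c_pow: "C * c powr (2 - 2 * \<sigma>) = \<epsilon>"
    using s e C by (simp add: c_def powr_powr)
  define D where "D = C * c powr (- 2 * \<sigma>)"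
  \<comment> \<open>The Sobolev relation again, in the form 2d/p = d - 2\<sigma>.\<close>
  have exponent: "2 * d / p - d = - 2 * \<sigma>"
  proof -
    have "p * d = 2 * d + 2 * \<sigma> * p"
      using p(2) d unfolding d_def[symmetric] by (metis (no_types) distrib_right nonzero_eq_divide_eq
          add_divide_eq_iff not_numeral_le_zero)
    then show ?thesis using p(1) by (simp add: field_simps)
  qed
  show ?thesis
  proof (rule that[of D])
    show "D > 0" using C c by (simp add: D_def)
    fix u :: "'a \<Rightarrow> real" and M K
    assume "translation_bounds u M K"
    then have [measurable]: "u \<in> borel_measurable borel" and u: "\<And>x. u x \<ge> 0" and MK: "M \<ge> 0" "K \<ge> 0"
      and M: "(\<integral>\<^sup>+x. ennreal ((u x)\<^sup>2) \<partial>lborel) \<le> ennreal M"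
      and K: "\<And>v. (\<integral>\<^sup>+x. ennreal ((u (x + v) - u x)\<^sup>2) \<partial>lborel) \<le> ennreal (K * (norm v)\<^sup>2)"
      by (simp_all add: translation_bounds_def)
    have scale: "(\<integral>\<^sup>+x. f (c *\<^sub>R x) \<partial>lborel) = ennreal (c powr (- d)) * (\<integral>\<^sup>+x. f x \<partial>lborel)"
      if [measurable]: "f \<in> borel_measurable borel" for f :: "'a \<Rightarrow> ennreal"
    proof -
      have "ennreal (c powr (- d)) * (\<integral>\<^sup>+x. f x \<partial>lborel)
        = ennreal (c powr (- d) * c ^ DIM('a)) * (\<integral>\<^sup>+x. f (c *\<^sub>R x) \<partial>lborel)"
        using c by (subst nn_integral_lborel_scale[OF that c]) (simp add: ennreal_mult mult.assoc)
      also have "c powr (- d) * c ^ DIM('a) = 1"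
        using c by (simp add: d_def powr_minus powr_realpow)
      finally show ?thesis by simp
    qed
    define w where "w = (\<lambda>x. u (c *\<^sub>R x))"
    have [measurable]: "w \<in> borel_measurable borel" unfolding w_def by measurable
    have "(\<integral>\<^sup>+x. ennreal (w x powr p) \<partial>lborel)
      \<le> ennreal ((C * (c powr (- d) * (K * c\<^sup>2) + c powr (- d) * M)) powr (p / 2))"
    proof (rule est, unfold translation_bounds_def, intro conjI allI)
      have "(\<integral>\<^sup>+x. ennreal ((w x)\<^sup>2) \<partial>lborel) = ennreal (c powr (- d)) * (\<integral>\<^sup>+x. ennreal ((u x)\<^sup>2) \<partial>lborel)"
        unfolding w_def by (rule scale) measurable
      also have "\<dots> \<le> ennreal (c powr (- d)) * ennreal M" by (intro mult_left_mono M) simp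
      finally show "(\<integral>\<^sup>+x. ennreal ((w x)\<^sup>2) \<partial>lborel) \<le> ennreal (c powr (- d) * M)"
        using MK by (simp add: ennreal_mult)
      fix v
      have "(\<integral>\<^sup>+x. ennreal ((w (x + v) - w x)\<^sup>2) \<partial>lborel)
        = (\<integral>\<^sup>+x. (\<lambda>y. ennreal ((u (y + c *\<^sub>R v) - u y)\<^sup>2)) (c *\<^sub>R x) \<partial>lborel)"
        by (simp add: w_def scaleR_add_right)
      also have "\<dots> = ennreal (c powr (- d)) * (\<integral>\<^sup>+y. ennreal ((u (y + c *\<^sub>R v) - u y)\<^sup>2) \<partial>lborel)"
        by (rule scale) measurable
      also have "\<dots> \<le> ennreal (c powr (- d)) * ennreal (K * (norm (c *\<^sub>R v))\<^sup>2)"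
        by (intro mult_left_mono K) simp
      also have "\<dots> = ennreal (c powr (- d) * (K * c\<^sup>2) * (norm v)\<^sup>2)"
        using MK c by (simp add: ennreal_mult[symmetric] power_mult_distrib mult_ac)
      finally show "(\<integral>\<^sup>+x. ennreal ((w (x + v) - w x)\<^sup>2) \<partial>lborel) \<le> ennreal (c powr (- d) * (K * c\<^sup>2) * (norm v)\<^sup>2)" .
    qed (use MK u in \<open>auto simp: w_def\<close>)
    moreover have "(\<integral>\<^sup>+x. ennreal (w x powr p) \<partial>lborel) = ennreal (c powr (- d)) * (\<integral>\<^sup>+x. ennreal (u x powr p) \<partial>lborel)"
      unfolding w_def by (rule scale[of "\<lambda>x. ennreal (u x powr p)"]) measurable
    ultimately have "ennreal (c powr d) * (ennreal (c powr (- d)) * (\<integral>\<^sup>+x. ennreal (u x powr p) \<partial>lborel))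
      \<le> ennreal (c powr d) * ennreal ((C * (c powr (- d) * (K * c\<^sup>2) + c powr (- d) * M)) powr (p / 2))"
      by (intro mult_left_mono) auto
    moreover have "ennreal (c powr d) * (ennreal (c powr (- d)) * I) = I" for I
      using c by (simp add: mult.assoc[symmetric] ennreal_mult[symmetric] powr_add[symmetric])
    moreover have "c powr d * (C * (c powr (- d) * (K * c\<^sup>2) + c powr (- d) * M)) powr (p / 2) = (\<epsilon> * K + D * M) powr (p / 2)"
    proof -
      have "c powr d = (c powr (2 * d / p)) powr (p / 2)"
        using p by (simp add: powr_powr)
      then have "c powr d * (C * (c powr (- d) * (K * c\<^sup>2) + c powr (- d) * M)) powr (p / 2)
        = (c powr (2 * d / p) * (C * (c powr (- d) * (K * c\<^sup>2) + c powr (- d) * M))) powr (p / 2)"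
        using C MK by (simp add: powr_mult)
      also have "c powr (2 * d / p) * (C * (c powr (- d) * (K * c\<^sup>2) + c powr (- d) * M))
        = C * (c powr (2 * d / p) * c powr (- d) * c powr 2) * K + C * (c powr (2 * d / p) * c powr (- d)) * M"
        using c by (simp add: algebra_simps)
      also have "c powr (2 * d / p) * c powr (- d) = c powr (- 2 * \<sigma>)"
        using exponent by (simp add: powr_add[symmetric])
      also have "c powr (- 2 * \<sigma>) * c powr 2 = c powr (2 - 2 * \<sigma>)"
        by (simp add: powr_add[symmetric])
      finally show ?thesis by (simp only: c_pow D_def)
    qed
    ultimately show "(\<integral>\<^sup>+x. ennreal (u x powr p) \<partial>lborel) \<le> ennreal ((\<epsilon> * K + D * M) powr (p / 2))"
      by (simp add: ennreal_mult[symmetric])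
  qed
qed

lemma magnetic_sobolev:
  fixes A :: "real^'n \<Rightarrow> real^'n"
  assumes A: "loc_square_integrable A"
    and s: "0 < \<sigma>" "\<sigma> < 1" and p: "p > 2" "p = 2 + 2 * \<sigma> * p / CARD('n)" and dim: "CARD('n) \<ge> 2"
    and e: "\<epsilon> > 0"
  obtains C :: real where "C > 0"
    "\<And>\<psi> g. \<lbrakk>\<psi> \<in> Lspace 2; is_mag_grad A \<psi> g\<rbrakk> \<Longrightarrow>
      (\<integral>\<^sup>+x. ennreal (norm (\<psi> x) powr p) \<partial>lebesgue) \<le>
        ennreal ((\<epsilon> * enn2real (\<integral>\<^sup>+x. ennreal ((norm (g x))\<^sup>2) \<partial>lebesgue)
          + C * enn2real (\<integral>\<^sup>+x. ennreal ((norm (\<psi> x))\<^sup>2) \<partial>lebesgue)) powr (p / 2))"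
proof -
  \<comment> \<open>The division by 4 compensates the factor 4 in
    \<open>mag_grad_translation_estimate\<close>, through which K becomes four times the squared
    norm of g.\<close>
  have e4: "\<epsilon> / 4 > 0" using e by simp
  obtain C where C: "C > 0" and
    est: "\<And>(u :: real^'n \<Rightarrow> real) M K. translation_bounds u M K \<Longrightarrow>
      (\<integral>\<^sup>+x. ennreal (u x powr p) \<partial>lborel) \<le> ennreal ((\<epsilon> / 4 * K + C * M) powr (p / 2))"
    using sobolev_of_translation_estimate_scaled[where 'a = "real^'n", OF s p(1) _ _ e4] p(2) dim by auto
  show ?thesis
  proof (rule that[OF C])
    fix \<psi> :: "real^'n \<Rightarrow> complex" and g
    assume \<psi>: "\<psi> \<in> Lspace 2" and g: "is_mag_grad A \<psi> g"
    define M where "M = enn2real (\<integral>\<^sup>+x. ennreal ((norm (\<psi> x))\<^sup>2) \<partial>lebesgue)"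
    define K where "K = enn2real (\<integral>\<^sup>+x. ennreal ((norm (g x))\<^sup>2) \<partial>lebesgue)"
    have M: "(\<integral>\<^sup>+x. ennreal ((norm (\<psi> x))\<^sup>2) \<partial>lebesgue) = ennreal M" "M \<ge> 0"
      using \<psi> by (auto simp: M_def Lspace_2)
    have K: "(\<integral>\<^sup>+x. ennreal ((norm (g x))\<^sup>2) \<partial>lebesgue) = ennreal K" "K \<ge> 0"
      using g by (auto simp: K_def is_mag_grad_def Lspace_2)
    obtain \<psi>' where \<psi>'[measurable]: "\<psi>' \<in> borel_measurable borel" and ae: "AE x in lborel. \<psi> x = \<psi>' x"
      using borel_representative \<psi> by (auto simp: Lspace_2)
    have "(\<integral>\<^sup>+x. ennreal (norm (\<psi>' x) powr p) \<partial>lborel) \<le> ennreal ((\<epsilon> / 4 * (4 * K) + C * M) powr (p / 2))"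
    proof (rule est, unfold translation_bounds_def, intro conjI allI)
      show "(\<integral>\<^sup>+x. ennreal ((norm (\<psi>' x))\<^sup>2) \<partial>lborel) \<le> ennreal M"
        using nn_integral_lebesgue_eq[OF ae, of "\<lambda>z. ennreal ((norm z)\<^sup>2)"] M by simp
      show "(\<integral>\<^sup>+x. ennreal ((norm (\<psi>' (x + v)) - norm (\<psi>' x))\<^sup>2) \<partial>lborel) \<le> ennreal (4 * K * (norm v)\<^sup>2)" for v
        using mag_grad_translation_estimate[OF A \<psi> g \<psi>' ae, of v] K
        by (simp add: ennreal_mult mult_ac)
    qed (use M K in auto)
    then show "(\<integral>\<^sup>+x. ennreal (norm (\<psi> x) powr p) \<partial>lebesgue) \<le> ennreal ((\<epsilon> * enn2real (\<integral>\<^sup>+x. ennreal ((norm (g x))\<^sup>2) \<partial>lebesgue)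
          + C * enn2real (\<integral>\<^sup>+x. ennreal ((norm (\<psi> x))\<^sup>2) \<partial>lebesgue)) powr (p / 2))"
      using nn_integral_lebesgue_eq[OF ae, of "\<lambda>z. ennreal (norm z powr p)"] by (simp add: K_def M_def)
  qed
qed

section \<open>Optimal constants\<close>

text \<open>Makes \<open>GREATEST\<close> meaningful. The admissible constants contain 0, are
  bounded above thanks to \<open>x0\<close>, and are closed under suprema since each x with m x > 0
  imposes a condition c \<le> T x / m x. T may be infinite at other points, as happens with a norm
  of order p < 2.\<close>

lemma greatest_constant:
  fixes m :: "'x \<Rightarrow> real" and T :: "'x \<Rightarrow> ereal"
  assumes T: "\<And>x. x \<in> X \<Longrightarrow> T x \<ge> 0" and m: "\<And>x. x \<in> X \<Longrightarrow> m x \<ge> 0"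
    and x0: "x0 \<in> X" "m x0 > 0" "T x0 < \<infinity>" and x: "x \<in> X"
  shows "ereal ((GREATEST c. \<forall>x\<in>X. ereal (c * m x) \<le> T x) * m x) \<le> T x"
proof -
  define S where "S = {c. \<forall>x\<in>X. ereal (c * m x) \<le> T x}"
  have "T x0 \<noteq> - \<infinity>" using T[OF x0(1)] by auto
  then obtain t where t: "T x0 = ereal t" using x0(3) by (cases "T x0") auto
  have S0: "0 \<in> S" using T by (simp add: S_def zero_ereal_def)
  have bdd: "c \<le> t / m x0" if "c \<in> S" for c
    using that x0 t by (auto simp: S_def field_simps)
  then have bdd': "bdd_above S" by (auto simp: bdd_above_def)
  have S_iff: "c \<in> S \<longleftrightarrow> (\<forall>x\<in>X. ereal (c * m x) \<le> T x)" for c by (simp add: S_def)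
  have Sup: "Sup S \<in> S"
    unfolding S_iff
  proof
    fix x assume x: "x \<in> X"
    show "ereal (Sup S * m x) \<le> T x"
    proof (cases "m x = 0")
      case True then show ?thesis using T[OF x] by (simp add: zero_ereal_def)
    next
      case False
      then have mx: "m x > 0" using m[OF x] by simp
      show ?thesis
      proof (cases "T x")
        case (real r)
        have "c \<le> r / m x" if "c \<in> S" for c
          using that x mx real by (auto simp: S_def field_simps)
        then have "Sup S \<le> r / m x" using S0 by (intro cSup_least) auto
        then show ?thesis using mx real by (simp add: field_simps)
      qed (use T[OF x] in auto)
    qed
  qed
  have "(GREATEST c. c \<in> S) = Sup S"
    using Sup bdd' by (intro Greatest_equality) (auto intro: cSup_upper)
  then show ?thesis using Sup x by (auto simp: S_def)
qed

text \<open>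
  If the optimal constant at the smallest admissible \<open>\<alpha>\<close> exceeded \<open>t\<close>, then mixing the inequality
  with the spectral gap would allow a smaller \<open>\<alpha>\<close>.
\<close>

lemma optimal_constant_surj:
  fixes K m N :: "'x \<Rightarrow> real"
  assumes nn: "\<And>x. x \<in> X \<Longrightarrow> m x \<ge> 0"
    and gap: "\<And>x. x \<in> X \<Longrightarrow> K x \<ge> \<Lambda> * m x"
    and x0: "x0 \<in> X" "K x0 = \<Lambda> * m x0" "m x0 > 0" "N x0 > 0"
    and interp: "\<And>\<epsilon>. \<epsilon> > 0 \<Longrightarrow> \<exists>C. \<forall>x\<in>X. N x \<le> \<epsilon> * K x + C * m x"
    and t: "t > 0"
  shows "\<exists>\<alpha>>- \<Lambda>. (GREATEST c. \<forall>x\<in>X. c * N x \<le> K x + \<alpha> * m x) = t"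
proof -
  define S where "S = {\<alpha>. \<forall>x\<in>X. t * N x \<le> K x + \<alpha> * m x}"
  obtain C where C: "\<And>x. x \<in> X \<Longrightarrow> N x \<le> (1 / t) * K x + C * m x"
    using interp[of "1 / t"] t by auto
  \<comment> \<open>\<open>S\<close> collects the \<alpha> for which t is an admissible constant.
    The interpolation inequality with \<epsilon> = 1/t, multiplied by t, has gradient coefficient 1,
    which makes t * C one of them.\<close>
  have "t * C \<in> S"
    unfolding S_def
  proof safe
    fix x assume "x \<in> X"
    then have "t * N x \<le> t * ((1 / t) * K x + C * m x)" using C t by (intro mult_left_mono) auto
    then show "t * N x \<le> K x + t * C * m x" using t by (simp add: algebra_simps)
  qed
  then have ne: "S \<noteq> {}" by auto
  \<comment> \<open>Testing with the minimizer of the gap keeps the infimum a of \<open>S\<close>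
    strictly above -\<Lambda>.\<close>
  have lower: "t * N x0 / m x0 - \<Lambda> \<le> \<alpha>" if "\<alpha> \<in> S" for \<alpha>
  proof -
    have "t * N x0 \<le> (\<Lambda> + \<alpha>) * m x0" using that x0 by (auto simp: S_def algebra_simps)
    then have "t * N x0 / m x0 \<le> \<Lambda> + \<alpha>" using x0(3) by (simp add: divide_le_eq)
    then show ?thesis by simp
  qed
  then have bdd: "bdd_below S" by (auto simp: bdd_below_def)
  define a where "a = Inf S"
  have "t * N x0 / m x0 - \<Lambda> \<le> a" unfolding a_def using ne lower by (rule cInf_greatest)
  moreover have "t * N x0 / m x0 > 0" using t x0 by simp
  ultimately have a: "a > - \<Lambda>" by linarith
  have aS: "a \<in> S"
    unfolding S_def mem_Collect_eq
  proof
    fix x assume x: "x \<in> X"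
    show "t * N x \<le> K x + a * m x"
    proof (cases "m x = 0")
      \<comment> \<open>The inequality does not involve \<alpha> here, so it is inherited from any
        element of \<open>S\<close>.\<close>
      case True
      then show ?thesis using ne x by (auto simp: S_def)
    next
      case False
      then have mx: "m x > 0" using nn[OF x] by simp
      have "(t * N x - K x) / m x \<le> \<alpha>" if "\<alpha> \<in> S" for \<alpha>
        using that x mx by (auto simp: S_def field_simps)
      then have "(t * N x - K x) / m x \<le> a"
        unfolding a_def using ne by (intro cInf_greatest)
      then show ?thesis using mx by (simp add: field_simps)
    qed
  qed
  have "(GREATEST c. \<forall>x\<in>X. c * N x \<le> K x + a * m x) = t"
  proof (rule Greatest_equality)
    show "\<forall>x\<in>X. t * N x \<le> K x + a * m x" using aS by (simp add: S_def)
    fix c assume c: "\<forall>x\<in>X. c * N x \<le> K x + a * m x"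
    show "c \<le> t"
    proof (rule ccontr)
      assume "\<not> c \<le> t"
      then have ct: "c > t" by simp
      \<comment> \<open>s times the inequality with constant c plus 1 - s times the gap has constant
        s * c = t and the parameter sa - (1 - s)\<Lambda>. This parameter is smaller than a because
        a > -\<Lambda>, against the choice of a as infimum.\<close>
      define s where "s = t / c"
      have s: "0 < s" "s < 1" "s * c = t" using ct t by (auto simp: s_def field_simps)
      have "s * a - (1 - s) * \<Lambda> \<in> S"
        unfolding S_def
      proof safe
        fix x assume x: "x \<in> X"
        have "s * (c * N x) \<le> s * (K x + a * m x)" using c x s by (intro mult_left_mono) auto
        then have "t * N x \<le> s * (K x + a * m x)" by (simp only: s(3) mult.assoc[symmetric])
        moreover have "(1 - s) * (\<Lambda> * m x) \<le> (1 - s) * K x" using gap[OF x] s by (intro mult_left_mono) auto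
        ultimately show "t * N x \<le> K x + (s * a - (1 - s) * \<Lambda>) * m x" by (simp add: algebra_simps)
      qed
      then have "a \<le> s * a - (1 - s) * \<Lambda>" unfolding a_def by (rule cInf_lower[OF _ bdd])
      then have "(1 - s) * (a + \<Lambda>) \<le> 0" by (simp add: algebra_simps)
      moreover have "(1 - s) * (a + \<Lambda>) > 0" using s a by (intro mult_pos_pos) auto
      ultimately show False by simp
    qed
  qed
  with a show ?thesis by blast
qed

section \<open>Hoelder's inequality and real-valued forms of the squared norms\<close>

lemma nn_integral_Holder:
  fixes f g :: "'a \<Rightarrow> real"
  assumes ab: "a > 1" "b > 1" "1 / a + 1 / b = 1"
    and [measurable]: "f \<in> borel_measurable M" "g \<in> borel_measurable M"
    and f: "\<And>x. f x \<ge> 0" and g: "\<And>x. g x \<ge> 0"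
    and P: "(\<integral>\<^sup>+x. ennreal (f x powr a) \<partial>M) = ennreal P" "P \<ge> 0"
    and Q: "(\<integral>\<^sup>+x. ennreal (g x powr b) \<partial>M) = ennreal Q" "Q \<ge> 0"
  shows "(\<integral>\<^sup>+x. ennreal (f x * g x) \<partial>M) \<le> ennreal (P powr (1 / a) * Q powr (1 / b))"
proof (cases "P = 0 \<or> Q = 0")
  case True
  have "AE x in M. f x * g x = 0"
  proof (cases "P = 0")
    case True
    then have "AE x in M. ennreal (f x powr a) = 0"
      using P by (subst nn_integral_0_iff_AE[symmetric]) auto
    then show ?thesis by eventually_elim simp
  next
    case False
    then have "AE x in M. ennreal (g x powr b) = 0"
      using True Q by (subst nn_integral_0_iff_AE[symmetric]) auto
    then show ?thesis by eventually_elim simp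
  qed
  then have "(\<integral>\<^sup>+x. ennreal (f x * g x) \<partial>M) = (\<integral>\<^sup>+x. 0 \<partial>M)"
    by (intro nn_integral_cong_AE) auto
  then show ?thesis by simp
next
  case False
  then have PQ: "P > 0" "Q > 0" using P Q by auto
  define k where "k = P powr (1 / a) * Q powr (1 / b)"
  have k: "k > 0" using PQ by (simp add: k_def)
  \<comment> \<open>Young's inequality for the normalized functions f / P^(1/a) and g / Q^(1/b),
    multiplied by k. After integration the two terms add up to k(1/a + 1/b) = k.\<close>
  have young: "f x * g x \<le> k / (a * P) * f x powr a + k / (b * Q) * g x powr b" for x
  proof -
    have "(f x / P powr (1 / a)) * (g x / Q powr (1 / b))
      \<le> (f x / P powr (1 / a)) powr a / a + (g x / Q powr (1 / b)) powr b / b"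
      using f[of x] g[of x] ab by (intro Youngs_inequality) auto
    also have "(f x / P powr (1 / a)) powr a = f x powr a / P"
      using f[of x] ab PQ by (simp add: powr_divide powr_powr)
    also have "(g x / Q powr (1 / b)) powr b = g x powr b / Q"
      using g[of x] ab PQ by (simp add: powr_divide powr_powr)
    finally have "f x * g x / k \<le> f x powr a / P / a + g x powr b / Q / b"
      by (simp add: k_def)
    then have "f x * g x \<le> k * (f x powr a / P / a + g x powr b / Q / b)"
      using k by (simp add: pos_divide_le_eq mult.commute)
    then show ?thesis by (simp add: algebra_simps)
  qed
  have "(\<integral>\<^sup>+x. ennreal (f x * g x) \<partial>M)
    \<le> (\<integral>\<^sup>+x. ennreal (k / (a * P)) * ennreal (f x powr a) + ennreal (k / (b * Q)) * ennreal (g x powr b) \<partial>M)" (is "_ \<le> (\<integral>\<^sup>+x. ?h x \<partial>M)")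
  proof (intro nn_integral_mono)
    fix x
    have "ennreal (f x * g x) \<le> ennreal (k / (a * P) * f x powr a + k / (b * Q) * g x powr b)"
      by (rule ennreal_leI[OF young])
    also have "\<dots> = ?h x"
      using k ab PQ by (simp add: ennreal_mult[symmetric])
    finally show "ennreal (f x * g x) \<le> ?h x" .
  qed
  also have "\<dots> = ennreal (k / (a * P)) * ennreal P + ennreal (k / (b * Q)) * ennreal Q"
    by (simp add: nn_integral_add nn_integral_cmult P Q)
  also have "\<dots> = ennreal (k / (a * P) * P + k / (b * Q) * Q)"
    using k ab PQ by (simp add: ennreal_mult[symmetric])
  also have "k / (a * P) * P + k / (b * Q) * Q = k * (1 / a + 1 / b)"
    using PQ by (simp add: field_simps)
  finally show ?thesis using ab by (simp add: k_def)
qed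

text \<open>A real number, so that the energy inequalities become real arithmetic. It represents the
  squared norm only on \<open>Lspace 2\<close>: \<open>enn2real\<close> sends infinity to 0.\<close>

definition sq_norm :: "('a::euclidean_space \<Rightarrow> 'b::euclidean_space) \<Rightarrow> real" where
  "sq_norm u = enn2real (\<integral>\<^sup>+x. ennreal ((norm (u x))\<^sup>2) \<partial>lebesgue)"

lemma sq_norm_nonneg: "sq_norm u \<ge> 0" by (simp add: sq_norm_def)

lemma nn_integral_sq_norm:
  "u \<in> Lspace 2 \<Longrightarrow> (\<integral>\<^sup>+x. ennreal ((norm (u x))\<^sup>2) \<partial>lebesgue) = ennreal (sq_norm u)"
  by (simp add: sq_norm_def Lspace_2)

lemma Lnorm_square:
  fixes u :: "'a::euclidean_space \<Rightarrow> 'b::real_normed_vector"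
  assumes "p > 0"
  shows "(Lnorm p u)\<^sup>2 = enn2ereal ((\<integral>\<^sup>+x. ennreal (norm (u x) powr p) \<partial>lebesgue) epowr (2 / p))"
proof -
  have "ennreal (norm (u x)) epowr p = ennreal (norm (u x) powr p)" for x
    by (simp add: epowr_def)
  moreover have "(y epowr (1 / p))\<^sup>2 = y epowr (2 / p)" for y
  proof (cases "y = top")
    case False
    have "(enn2real y powr (1 / p))\<^sup>2 = enn2real y powr (2 / p)"
      by (simp add: power2_eq_square powr_add[symmetric])
    then show ?thesis using False by (simp add: epowr_def ennreal_power)
  qed (simp add: epowr_def power2_eq_square)
  moreover have "(enn2ereal y)\<^sup>2 = enn2ereal (y\<^sup>2)" for y
    by (simp add: power2_eq_square times_ennreal.rep_eq)
  ultimately show ?thesis by (simp add: Lnorm_def Lnorm_abs_def)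
qed

lemma Lnorm_2_square:
  assumes "u \<in> Lspace 2"
  shows "(Lnorm 2 u)\<^sup>2 = ereal (sq_norm u)"
  using nn_integral_sq_norm[OF assms] sq_norm_nonneg[of u]
  by (simp add: Lnorm_square epowr_def enn2ereal_ennreal)

lemma Lnorm_square_finite:
  fixes u :: "'a::euclidean_space \<Rightarrow> 'b::real_normed_vector"
  assumes "p > 0" "(\<integral>\<^sup>+x. ennreal (norm (u x) powr p) \<partial>lebesgue) = ennreal n" "n \<ge> 0"
  shows "(Lnorm p u)\<^sup>2 = ereal (n powr (2 / p))"
  using assms by (simp add: Lnorm_square epowr_def enn2ereal_ennreal)

lemma Lnorm_square_nonneg: "p > 0 \<Longrightarrow> (Lnorm p u)\<^sup>2 \<ge> 0"
  by (simp add: Lnorm_square)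

lemma sq_norm_pos:
  assumes "u \<in> Lspace 2" "\<not> (AE x in lebesgue. u x = 0)"
  shows "sq_norm u > 0"
proof (rule ccontr)
  assume "\<not> sq_norm u > 0"
  then have "sq_norm u = 0" using sq_norm_nonneg[of u] by simp
  then have "(\<integral>\<^sup>+x. ennreal ((norm (u x))\<^sup>2) \<partial>lebesgue) = 0" using nn_integral_sq_norm[OF assms(1)] by simp
  moreover have [measurable]: "u \<in> borel_measurable lebesgue" using assms by (simp add: Lspace_2)
  ultimately have "AE x in lebesgue. ennreal ((norm (u x))\<^sup>2) = 0"
    by (subst nn_integral_0_iff_AE[symmetric]) auto
  then have "AE x in lebesgue. u x = 0" by eventually_elim simp
  with assms show False by simp
qed

lemma H1_D:
  assumes "\<psi> \<in> H1 A"
  shows "\<psi> \<in> Lspace 2" "is_mag_grad A \<psi> (mag_grad A \<psi>)" "mag_grad A \<psi> \<in> Lspace 2"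
proof -
  show "\<psi> \<in> Lspace 2" using assms by (simp add: H1_def)
  have "\<exists>g. is_mag_grad A \<psi> g" using assms by (simp add: H1_def)
  then show "is_mag_grad A \<psi> (mag_grad A \<psi>)"
    unfolding mag_grad_def by (rule someI_ex)
  then show "mag_grad A \<psi> \<in> Lspace 2" by (simp add: is_mag_grad_def)
qed

text \<open>The negative part of the potential enters only through an upper bound; its finiteness
  rules out the value minus infinity.\<close>

lemma energy_ge:
  assumes \<psi>: "\<psi> \<in> admissible A \<phi>" and [measurable]: "\<phi> \<in> borel_measurable lebesgue"
    and r: "(\<integral>\<^sup>+x. ennreal (max (- \<phi> x) 0 * (norm (\<psi> x))\<^sup>2) \<partial>lebesgue) \<le> ennreal r" "r \<ge> 0"
    and P: "(\<integral>\<^sup>+x. ennreal (max (\<phi> x) 0 * (norm (\<psi> x))\<^sup>2) \<partial>lebesgue) = ennreal P" "P \<ge> 0"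
  shows "energy A \<phi> \<psi> \<ge> ereal (sq_norm (mag_grad A \<psi>) + P - r)"
proof -
  have H: "\<psi> \<in> H1 A" using \<psi> by (simp add: admissible_def)
  have [measurable]: "\<psi> \<in> borel_measurable lebesgue" "mag_grad A \<psi> \<in> borel_measurable lebesgue"
    using H1_D[OF H] by (simp_all add: Lspace_2)
  have "(\<integral>\<^sup>+x. ennreal ((norm (mag_grad A \<psi> x))\<^sup>2 + max (\<phi> x) 0 * (norm (\<psi> x))\<^sup>2) \<partial>lebesgue)
    = (\<integral>\<^sup>+x. ennreal ((norm (mag_grad A \<psi> x))\<^sup>2) + ennreal (max (\<phi> x) 0 * (norm (\<psi> x))\<^sup>2) \<partial>lebesgue)"
    by (intro nn_integral_cong) simp
  also have "\<dots> = ennreal (sq_norm (mag_grad A \<psi>)) + ennreal P"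
    by (subst nn_integral_add) (auto simp: P nn_integral_sq_norm[OF H1_D(3)[OF H]])
  also have "\<dots> = ennreal (sq_norm (mag_grad A \<psi>) + P)"
    using P sq_norm_nonneg by (intro ennreal_plus[symmetric]) auto
  finally have 1: "enn2ereal (\<integral>\<^sup>+x. ennreal ((norm (mag_grad A \<psi> x))\<^sup>2 + max (\<phi> x) 0 * (norm (\<psi> x))\<^sup>2) \<partial>lebesgue)
    = ereal (sq_norm (mag_grad A \<psi>) + P)"
    using P sq_norm_nonneg[of "mag_grad A \<psi>"] by (simp add: enn2ereal_ennreal del: ennreal_plus)
  have 2: "enn2ereal (\<integral>\<^sup>+x. ennreal (max (- \<phi> x) 0 * (norm (\<psi> x))\<^sup>2) \<partial>lebesgue) \<le> ereal r"
    using r by (metis enn2ereal_ennreal less_eq_ennreal.rep_eq)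
  have "ereal (sq_norm (mag_grad A \<psi>) + P - r) = ereal (sq_norm (mag_grad A \<psi>) + P) - ereal r" by simp
  also have "\<dots> \<le> energy A \<phi> \<psi>"
    unfolding energy_def 1 by (rule ereal_minus_mono[OF order_refl 2])
  finally show ?thesis .
qed

section \<open>Cut-off in the magnetic Sobolev space\<close>

lemma integrable_lebesgue_compact_support_mult:
  fixes f :: "'a::euclidean_space \<Rightarrow> complex" and c :: "'a \<Rightarrow> real"
  assumes [measurable]: "f \<in> borel_measurable lebesgue" "c \<in> borel_measurable lebesgue"
    and h: "\<And>x. norm (f x) \<le> h x" "(\<integral>\<^sup>+x\<in>ball 0 R. ennreal (h x) \<partial>lebesgue) < \<infinity>" "h \<in> borel_measurable lebesgue"
    and c: "\<And>x. norm x \<ge> R \<Longrightarrow> c x = 0" "\<And>x. \<bar>c x\<bar> \<le> C"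
  shows "integrable lebesgue (\<lambda>x. c x *\<^sub>R f x)"
proof (rule integrableI_bounded)
  note [measurable] = h(3)
  have [measurable]: "ball (0::'a) R \<in> sets lebesgue" by auto
  have C: "C \<ge> 0" using c(2)[of 0] by linarith
  have "(\<integral>\<^sup>+x. ennreal (norm (c x *\<^sub>R f x)) \<partial>lebesgue) \<le> (\<integral>\<^sup>+x. ennreal C * (ennreal (h x) * indicator (ball 0 R) x) \<partial>lebesgue)"
  proof (intro nn_integral_mono)
    fix x
    show "ennreal (norm (c x *\<^sub>R f x)) \<le> ennreal C * (ennreal (h x) * indicator (ball 0 R) x)"
    proof (cases "norm x \<ge> R")
      case False
      have "norm (c x *\<^sub>R f x) \<le> C * h x"
        using c(2)[of x] h(1)[of x] C by (simp add: mult_mono)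
      then show ?thesis
        using False C order_trans[OF norm_ge_zero h(1)[of x]] by (simp add: ennreal_leI flip: ennreal_mult)
    qed (use c in simp)
  qed
  also have "\<dots> = ennreal C * (\<integral>\<^sup>+x\<in>ball 0 R. ennreal (h x) \<partial>lebesgue)"
    by (rule nn_integral_cmult) measurable
  also have "\<dots> < \<infinity>" using h(2) by (simp add: ennreal_mult_less_top)
  finally show "(\<integral>\<^sup>+x. ennreal (norm (c x *\<^sub>R f x)) \<partial>lebesgue) < \<infinity>" .
qed measurable

lemma Lspace_2_dominated:
  assumes u: "u \<in> borel_measurable lebesgue" and v: "v \<in> Lspace 2" and w: "w \<in> Lspace 2"
    and le: "\<And>x. norm (u x) \<le> C * norm (v x) + D * norm (w x)"
  shows "u \<in> Lspace 2"
proof -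
  have [measurable]: "v \<in> borel_measurable lebesgue" "w \<in> borel_measurable lebesgue"
    using v w by (simp_all add: Lspace_2)
  have "(\<integral>\<^sup>+x. ennreal ((norm (u x))\<^sup>2) \<partial>lebesgue)
    \<le> (\<integral>\<^sup>+x. ennreal (2 * C\<^sup>2) * ennreal ((norm (v x))\<^sup>2) + ennreal (2 * D\<^sup>2) * ennreal ((norm (w x))\<^sup>2) \<partial>lebesgue)" (is "_ \<le> (\<integral>\<^sup>+x. ?h x \<partial>lebesgue)")
  proof (intro nn_integral_mono)
    fix x
    have "(norm (u x))\<^sup>2 \<le> (C * norm (v x) + D * norm (w x))\<^sup>2"
      using le by (intro power_mono) auto
    also have "\<dots> \<le> 2 * C\<^sup>2 * (norm (v x))\<^sup>2 + 2 * D\<^sup>2 * (norm (w x))\<^sup>2"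
      using zero_le_power2[of "C * norm (v x) - D * norm (w x)"] by (simp add: power2_eq_square algebra_simps)
    finally have "ennreal ((norm (u x))\<^sup>2) \<le> ennreal (2 * C\<^sup>2 * (norm (v x))\<^sup>2 + 2 * D\<^sup>2 * (norm (w x))\<^sup>2)"
      by (rule ennreal_leI)
    also have "\<dots> = ?h x"
      by (subst ennreal_plus) (simp_all only: ennreal_mult[symmetric] zero_le_mult_iff zero_le_power2 zero_le_numeral simp_thms)
    finally show "ennreal ((norm (u x))\<^sup>2) \<le> ?h x" .
  qed
  also have "\<dots> = ennreal (2 * C\<^sup>2) * ennreal (sq_norm v) + ennreal (2 * D\<^sup>2) * ennreal (sq_norm w)"
    by (simp add: nn_integral_add nn_integral_cmult nn_integral_sq_norm[OF v] nn_integral_sq_norm[OF w])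
  also have "\<dots> < \<infinity>" by (simp add: ennreal_mult_less_top)
  finally show ?thesis using u by (simp add: Lspace_2)
qed

text \<open>The Leibniz rule, with the gradient of \<eta> times \<psi> written as a sum over
  \<open>axis\<close>. It follows from the weak formulation for \<psi> with the test function
  \<zeta>\<eta>: the term containing the derivative of \<eta> moves to the other side.\<close>

lemma is_mag_grad_cutoff:
  fixes A :: "real^'n \<Rightarrow> real^'n"
  assumes A: "loc_square_integrable A" and \<psi>: "\<psi> \<in> Lspace 2" and g: "is_mag_grad A \<psi> g"
    and \<eta>: "test_function \<eta>"
  shows "(\<lambda>x. \<eta> x *\<^sub>R \<psi> x) \<in> Lspace 2"
    and "is_mag_grad A (\<lambda>x. \<eta> x *\<^sub>R \<psi> x)
      (\<lambda>x. \<eta> x *\<^sub>R g x + (\<Sum>j\<in>UNIV. frechet_derivative \<eta> (at x) (axis j 1) *\<^sub>R axis j (\<psi> x)))"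
proof -
  have g_L2: "g \<in> Lspace 2" using g by (simp add: is_mag_grad_def)
  have A_meas[measurable]: "A \<in> borel_measurable lebesgue" using A by (simp add: loc_square_integrable_def)
  have meas[measurable]: "\<psi> \<in> borel_measurable lebesgue" "g \<in> borel_measurable lebesgue"
    using \<psi> g_L2 by (simp_all add: Lspace_2)
  have test_meas: "\<zeta> \<in> borel_measurable lebesgue" "(\<lambda>x. frechet_derivative \<zeta> (at x) v) \<in> borel_measurable lebesgue"
    if "test_function \<zeta>" for \<zeta> :: "real^'n \<Rightarrow> real" and v
    using test_functionD(2,3)[OF that] by (auto intro!: borel_measurable_continuous_onI measurable_completion)
  note [measurable] = test_meas[OF \<eta>]
  have h_meas: "majorant A \<psi> g \<in> borel_measurable lebesgue" unfolding majorant_def[abs_def] by measurable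
  note h_fin = nn_integral_majorant_finite[OF A \<psi> g_L2]
  define F where "F = (\<lambda>j x. g x $ j - \<i> * complex_of_real (A x $ j) * \<psi> x)"
  have F_meas[measurable]: "F j \<in> borel_measurable lebesgue" for j unfolding F_def by measurable
  have F_le: "norm (F j x) \<le> majorant A \<psi> g x" for j x
    unfolding F_def by (rule majorant_bounds)
  define D where "D = (\<lambda>j x. frechet_derivative \<eta> (at x) (axis j 1))"
  have D_meas[measurable]: "D j \<in> borel_measurable lebesgue" for j unfolding D_def by measurable
  have D_bd: "\<exists>C. \<forall>x. \<bar>D j x\<bar> \<le> C" for j
    using test_function_bounds[OF \<eta>, of "axis j 1"] unfolding D_def by metis
  then obtain Cd where Cd: "\<And>j x. \<bar>D j x\<bar> \<le> Cd j" by metis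
  obtain R C where R: "\<And>x. norm x \<ge> R \<Longrightarrow> \<eta> x = 0" and C: "\<And>x. \<bar>\<eta> x\<bar> \<le> C"
    using test_function_bounds[OF \<eta>] by metis
  have C0: "C \<ge> 0" using C[of 0] by linarith
  show "(\<lambda>x. \<eta> x *\<^sub>R \<psi> x) \<in> Lspace 2"
    by (rule Lspace_2_dominated[OF _ \<psi> \<psi>, where C=C and D=0]) (use C in \<open>auto intro: mult_right_mono\<close>)
  define gr where "gr = (\<lambda>x. \<eta> x *\<^sub>R g x + (\<Sum>j\<in>UNIV. D j x *\<^sub>R axis j (\<psi> x)))"
  have gr_nth: "gr x $ j = \<eta> x *\<^sub>R g x $ j + D j x *\<^sub>R \<psi> x" for x j
    by (simp add: gr_def axis_def if_distrib[where f = "\<lambda>z. _ *\<^sub>R z"] cong: if_cong)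
  have gr_L2: "gr \<in> Lspace 2"
  proof (rule Lspace_2_dominated[OF _ g_L2 \<psi>])
    have "continuous_on UNIV (axis j :: complex \<Rightarrow> complex^'n)" for j
    proof -
      have "linear (axis j :: complex \<Rightarrow> complex^'n)"
        by (intro linearI) (auto simp: axis_def vec_eq_iff)
      then show ?thesis by (simp add: linear_continuous_on linear_conv_bounded_linear)
    qed
    then have [measurable]: "(\<lambda>x. axis j (\<psi> x) :: complex^'n) \<in> borel_measurable lebesgue" for j
      using measurable_compose[OF meas(1) borel_measurable_continuous_onI] by blast
    show "gr \<in> borel_measurable lebesgue" unfolding gr_def by measurable
    have norm_axis: "norm (axis j z :: complex^'n) \<le> norm z" for j z
    proof -
      have "norm (axis j z :: complex^'n) \<le> (\<Sum>i\<in>UNIV. norm ((axis j z :: complex^'n) $ i))"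
        unfolding norm_vec_def by (rule L2_set_le_sum) simp
      also have "\<dots> = (\<Sum>i\<in>UNIV. if i = j then norm z else 0)"
        by (intro sum.cong) (auto simp: axis_def)
      finally show ?thesis by simp
    qed
    fix x
    have "norm (gr x) \<le> norm (\<eta> x *\<^sub>R g x) + (\<Sum>j\<in>UNIV. norm (D j x *\<^sub>R (axis j (\<psi> x) :: complex^'n)))"
      unfolding gr_def by (rule order_trans[OF norm_triangle_ineq add_left_mono[OF norm_sum]])
    also have "\<dots> \<le> C * norm (g x) + (\<Sum>j\<in>UNIV. Cd j * norm (\<psi> x))"
    proof (intro add_mono sum_mono)
      show "norm (\<eta> x *\<^sub>R g x) \<le> C * norm (g x)" using C by (simp add: mult_right_mono)
      fix j
      have "\<bar>D j x\<bar> * norm (axis j (\<psi> x) :: complex^'n) \<le> Cd j * norm (\<psi> x)"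
        using Cd[of j x] norm_axis[of j "\<psi> x"] by (intro mult_mono) auto
      then show "norm (D j x *\<^sub>R (axis j (\<psi> x) :: complex^'n)) \<le> Cd j * norm (\<psi> x)" by simp
    qed
    finally show "norm (gr x) \<le> C * norm (g x) + (\<Sum>j\<in>UNIV. Cd j) * norm (\<psi> x)"
      by (simp add: sum_distrib_right)
  qed
  have "is_mag_grad A (\<lambda>x. \<eta> x *\<^sub>R \<psi> x) gr"
    unfolding is_mag_grad_def
  proof (intro conjI allI impI gr_L2)
    fix j and \<zeta> :: "real^'n \<Rightarrow> real" assume \<zeta>: "test_function \<zeta>"
    note [measurable] = test_meas[OF \<zeta>]
    define E where "E = (\<lambda>x. frechet_derivative \<zeta> (at x) (axis j 1))"
    have [measurable]: "E \<in> borel_measurable lebesgue" unfolding E_def by measurable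
    obtain R1 C1 where RC1: "\<And>x. norm x \<ge> R1 \<Longrightarrow> \<zeta> x = 0" "\<And>x. \<bar>\<zeta> x\<bar> \<le> C1" 
      "\<And>x. norm x \<ge> R1 \<Longrightarrow> E x = 0" "\<And>x. \<bar>E x\<bar> \<le> C1"
      unfolding E_def using test_function_bounds[OF \<zeta>, of "axis j 1"] by metis
    have C1: "C1 \<ge> 0" using RC1(2)[of 0] by linarith
    have prod: "frechet_derivative (\<lambda>x. \<zeta> x * \<eta> x) (at x) (axis j 1) = \<zeta> x * D j x + E x * \<eta> x" for x
    proof -
      have "((\<lambda>x. \<zeta> x * \<eta> x) has_derivative
          (\<lambda>v. \<zeta> x * frechet_derivative \<eta> (at x) v + frechet_derivative \<zeta> (at x) v * \<eta> x)) (at x)"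
        by (intro has_derivative_mult test_functionD(1) \<zeta> \<eta>)
      from frechet_derivative_at[OF this, symmetric] show ?thesis by (simp add: D_def E_def)
    qed
    have i1: "integrable lebesgue (\<lambda>x. (E x * \<eta> x) *\<^sub>R \<psi> x)"
    proof (rule integrable_lebesgue_compact_support_mult[OF meas(1) _ majorant_bounds(1) h_fin h_meas])
      show "\<bar>E x * \<eta> x\<bar> \<le> C1 * C" for x
        using RC1(4)[of x] C[of x] C1 by (simp add: abs_mult mult_mono)
    qed (use RC1 in auto)
    have i2: "integrable lebesgue (\<lambda>x. (\<zeta> x * D j x) *\<^sub>R \<psi> x)"
    proof (rule integrable_lebesgue_compact_support_mult[OF meas(1) _ majorant_bounds(1) h_fin h_meas])
      show "\<bar>\<zeta> x * D j x\<bar> \<le> C1 * Cd j" for x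
        using RC1(2)[of x] Cd[of j x] C1 by (simp add: abs_mult mult_mono)
    qed (use RC1 in auto)
    have i3: "integrable lebesgue (\<lambda>x. (\<zeta> x * \<eta> x) *\<^sub>R F j x)"
    proof (rule integrable_lebesgue_compact_support_mult[OF F_meas _ F_le h_fin h_meas])
      show "\<bar>\<zeta> x * \<eta> x\<bar> \<le> C1 * C" for x
        using RC1(2)[of x] C[of x] C1 by (simp add: abs_mult mult_mono)
    qed (use RC1 in auto)
    \<comment> \<open>The weak formulation for \<psi>, tested with the product
      \<zeta>\<eta>.\<close>
    have "(LINT x|lebesgue. (\<zeta> x * D j x + E x * \<eta> x) *\<^sub>R \<psi> x) = - (LINT x|lebesgue. (\<zeta> x * \<eta> x) *\<^sub>R F j x)"
      using g test_function_mult[OF \<zeta> \<eta>] by (simp add: is_mag_grad_def F_def flip: prod)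
    moreover have "(LINT x|lebesgue. (\<zeta> x * D j x + E x * \<eta> x) *\<^sub>R \<psi> x)
      = (LINT x|lebesgue. (\<zeta> x * D j x) *\<^sub>R \<psi> x) + (LINT x|lebesgue. (E x * \<eta> x) *\<^sub>R \<psi> x)"
      using i1 i2 by (simp only: scaleR_add_left Bochner_Integration.integral_add)
    ultimately have "(LINT x|lebesgue. (E x * \<eta> x) *\<^sub>R \<psi> x)
      = - ((LINT x|lebesgue. (\<zeta> x * \<eta> x) *\<^sub>R F j x) + (LINT x|lebesgue. (\<zeta> x * D j x) *\<^sub>R \<psi> x))"
      by (simp add: algebra_simps eq_neg_iff_add_eq_0)
    also have "(LINT x|lebesgue. (\<zeta> x * \<eta> x) *\<^sub>R F j x) + (LINT x|lebesgue. (\<zeta> x * D j x) *\<^sub>R \<psi> x)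
      = (LINT x|lebesgue. (\<zeta> x * \<eta> x) *\<^sub>R F j x + (\<zeta> x * D j x) *\<^sub>R \<psi> x)"
      using i2 i3 by (simp only: Bochner_Integration.integral_add)
    also have "(\<lambda>x. (\<zeta> x * \<eta> x) *\<^sub>R F j x + (\<zeta> x * D j x) *\<^sub>R \<psi> x)
      = (\<lambda>x. \<zeta> x *\<^sub>R (gr x $ j - \<i> * complex_of_real (A x $ j) * (\<eta> x *\<^sub>R \<psi> x)))"
      by (simp add: gr_nth F_def algebra_simps)
    finally show "(LINT x|lebesgue. frechet_derivative \<zeta> (at x) (axis j 1) *\<^sub>R \<eta> x *\<^sub>R \<psi> x)
      = - (LINT x|lebesgue. \<zeta> x *\<^sub>R (gr x $ j - \<i> * complex_of_real (A x $ j) * \<eta> x *\<^sub>R \<psi> x))"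
      by (simp add: E_def)
  qed
  then show "is_mag_grad A (\<lambda>x. \<eta> x *\<^sub>R \<psi> x)
      (\<lambda>x. \<eta> x *\<^sub>R g x + (\<Sum>j\<in>UNIV. frechet_derivative \<eta> (at x) (axis j 1) *\<^sub>R axis j (\<psi> x)))"
    by (simp add: gr_def D_def)
qed

text \<open>For p < 2, square integrability does not control the norm of order p at infinity.
  Multiplication by a bump confines \<psi> to a box, where t^p \<le> 1 + t^2 gives
  finiteness.\<close>

lemma H1_nonzero_finite_Lp:
  fixes A :: "real^'n \<Rightarrow> real^'n"
  assumes A: "loc_square_integrable A" and p: "0 < p" "p \<le> 2"
    and \<psi>: "\<psi> \<in> H1 A" "\<not> (AE x in lebesgue. \<psi> x = 0)"
  obtains \<psi>' where "\<psi>' \<in> H1 A" "sq_norm \<psi>' > 0" "(\<integral>\<^sup>+x. ennreal (norm (\<psi>' x) powr p) \<partial>lebesgue) < \<infinity>"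
proof -
  define B where "B = (\<lambda>n::nat. box (- (real n *\<^sub>R One)) (real n *\<^sub>R One) :: (real^'n) set)"
  \<comment> \<open>The box has to be chosen so that the cut-off function is not null. Countably
    many boxes exhaust the space, and the bump vanishes nowhere on its box.\<close>
  have "\<exists>n. \<not> (AE x in lebesgue. x \<in> B n \<longrightarrow> \<psi> x = 0)"
  proof (rule ccontr)
    assume "\<not> ?thesis"
    then have AEn: "AE x in lebesgue. \<forall>n. x \<in> B n \<longrightarrow> \<psi> x = 0" by (subst AE_all_countable) blast
    have ex: "\<exists>n. x \<in> B n" for x using UN_box_eq_UNIV unfolding B_def by blast
    have "AE x in lebesgue. \<psi> x = 0" by (rule eventually_mono[OF AEn]) (use ex in blast)
    with \<psi> show False by simp
  qed
  then obtain n where n: "\<not> (AE x in lebesgue. x \<in> B n \<longrightarrow> \<psi> x = 0)" by blast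
  define \<eta> where "\<eta> = box_bump (- (real n *\<^sub>R One)) (real n *\<^sub>R One :: real^'n) 0"
  have \<eta>: "test_function \<eta>" unfolding \<eta>_def by (rule test_function_box_bump)
  have \<eta>_nz: "\<eta> x \<noteq> 0 \<longleftrightarrow> x \<in> B n" for x unfolding \<eta>_def B_def by (rule box_bump_nonzero)
  have \<eta>_bd: "\<bar>\<eta> x\<bar> \<le> 1" for x
    using box_bump_bounds[of "- (real n *\<^sub>R One)" "real n *\<^sub>R One" 0 x] by (simp add: \<eta>_def)
  note cut = is_mag_grad_cutoff[OF A H1_D(1,2)[OF \<psi>(1)] \<eta>]
  have [measurable]: "\<psi> \<in> borel_measurable lebesgue" using H1_D(1)[OF \<psi>(1)] by (simp add: Lspace_2)
  show ?thesis
  proof (rule that[of "\<lambda>x. \<eta> x *\<^sub>R \<psi> x"])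
    show "(\<lambda>x. \<eta> x *\<^sub>R \<psi> x) \<in> H1 A" using cut by (auto simp: H1_def)
    show "sq_norm (\<lambda>x. \<eta> x *\<^sub>R \<psi> x) > 0"
    proof (rule sq_norm_pos[OF cut(1)])
      show "\<not> (AE x in lebesgue. \<eta> x *\<^sub>R \<psi> x = 0)"
      proof
        assume "AE x in lebesgue. \<eta> x *\<^sub>R \<psi> x = 0"
        then have "AE x in lebesgue. x \<in> B n \<longrightarrow> \<psi> x = 0"
          by eventually_elim (use \<eta>_nz in auto)
        with n show False by simp
      qed
    qed
    have [measurable]: "B n \<in> sets lebesgue" unfolding B_def by auto
    have "(\<integral>\<^sup>+x. ennreal (norm (\<eta> x *\<^sub>R \<psi> x) powr p) \<partial>lebesgue)
      \<le> (\<integral>\<^sup>+x. indicator (B n) x + ennreal ((norm (\<psi> x))\<^sup>2) \<partial>lebesgue)"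
    proof (intro nn_integral_mono)
      fix x
      show "ennreal (norm (\<eta> x *\<^sub>R \<psi> x) powr p) \<le> indicator (B n) x + ennreal ((norm (\<psi> x))\<^sup>2)"
      proof (cases "x \<in> B n")
        case True
        have "norm (\<eta> x *\<^sub>R \<psi> x) \<le> norm (\<psi> x)"
          using \<eta>_bd[of x] by (simp add: mult_left_le_one_le)
        then have "norm (\<eta> x *\<^sub>R \<psi> x) powr p \<le> norm (\<psi> x) powr p" using p by (intro powr_mono2) auto
        also have "\<dots> \<le> 1 + (norm (\<psi> x))\<^sup>2"
        proof (cases "norm (\<psi> x) \<le> 1")
          case True
          then have "norm (\<psi> x) powr p \<le> 1" using p by (intro powr_le1) auto
          then show ?thesis by (simp add: add_increasing2)
        next
          case False
          then have "norm (\<psi> x) powr p \<le> norm (\<psi> x) powr 2" using p by (intro powr_mono) auto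
          then show ?thesis using False by simp
        qed
        finally have "ennreal (norm (\<eta> x *\<^sub>R \<psi> x) powr p) \<le> ennreal (1 + (norm (\<psi> x))\<^sup>2)" by (rule ennreal_leI)
        then show ?thesis using True by simp
      next
        case False
        then have "\<eta> x = 0" using \<eta>_nz by blast
        then show ?thesis using p by simp
      qed
    qed
    also have "\<dots> = emeasure lebesgue (B n) + (\<integral>\<^sup>+x. ennreal ((norm (\<psi> x))\<^sup>2) \<partial>lebesgue)"
      by (simp add: nn_integral_add)
    also have "\<dots> < \<infinity>"
      using H1_D(1)[OF \<psi>(1)] emeasure_bounded_finite[OF bounded_box, of "- (real n *\<^sub>R One) :: real^'n" "real n *\<^sub>R One"]
      by (simp add: Lspace_2 B_def)
    finally show "(\<integral>\<^sup>+x. ennreal (norm (\<eta> x *\<^sub>R \<psi> x) powr p) \<partial>lebesgue) < \<infinity>" .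
  qed
qed

section \<open>Eigenvalue estimates\<close>

text \<open>\<open>optimal_constant_surj\<close> puts t into the image of \<open>mu_B A p\<close>,
  so \<open>inv_into\<close> returns a genuine preimage \<alpha> > -\<Lambda>. The greatest constant
  at this \<alpha> is t, and being attained as a maximum it satisfies the inequality itself.\<close>

lemma alpha_B_inequality:
  fixes A :: "real^'n \<Rightarrow> real^'n"
  assumes A: "loc_square_integrable A" and dim: "CARD('n) \<ge> 2"
    and Lambda: "\<Lambda> = Lambda_B A"
    and gap: "\<forall>\<psi>\<in>H1 A. (Lnorm 2 (mag_grad A \<psi>))\<^sup>2 \<ge> ereal \<Lambda> * (Lnorm 2 \<psi>)\<^sup>2"
    and attained: "\<exists>\<psi>\<in>H1 A. \<not> (AE x in lebesgue. \<psi> x = 0) \<and>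
          (Lnorm 2 (mag_grad A \<psi>))\<^sup>2 = ereal \<Lambda> * (Lnorm 2 \<psi>)\<^sup>2"
    and q: "q > real CARD('n) / 2" and p: "p = 2 * q / (q - 1)" and t: "t > 0"
    and \<psi>: "\<psi> \<in> H1 A"
  shows "(\<integral>\<^sup>+x. ennreal (norm (\<psi> x) powr p) \<partial>lebesgue) < \<infinity>"
    and "t * enn2real (\<integral>\<^sup>+x. ennreal (norm (\<psi> x) powr p) \<partial>lebesgue) powr (2 / p)
      \<le> sq_norm (mag_grad A \<psi>) + alpha_B A p t * sq_norm \<psi>"
proof -
  define d where "d = real CARD('n)"
  have d: "d \<ge> 2" using dim by (simp add: d_def)
  have q1: "q > 1" "q > d / 2" using q d by (simp_all add: d_def)
  \<comment> \<open>The order for which 1/p = 1/2 - \<sigma>/d when p = 2q/(q-1); it is below 1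
    exactly because q > d/2.\<close>
  define \<sigma> where "\<sigma> = d / (2 * q)"
  have s: "0 < \<sigma>" "\<sigma> < 1" using q1 d by (simp_all add: \<sigma>_def field_simps)
  have p2: "p > 2" using q1 by (simp add: p field_simps)
  have ps: "p = 2 + 2 * \<sigma> * p / CARD('n)"
    using q1 d by (simp add: p \<sigma>_def flip: d_def) (simp add: field_simps)
  define I where "I = (\<lambda>\<psi> :: real^'n \<Rightarrow> complex. \<integral>\<^sup>+x. ennreal (norm (\<psi> x) powr p) \<partial>lebesgue)"
  define K where "K = (\<lambda>\<psi>. sq_norm (mag_grad A \<psi>))"
  define N where "N = (\<lambda>\<psi>. enn2real (I \<psi>) powr (2 / p))"
  have sob: "\<exists>C>0. \<forall>\<psi>\<in>H1 A. I \<psi> \<le> ennreal ((\<epsilon> * K \<psi> + C * sq_norm \<psi>) powr (p / 2))" if "\<epsilon> > 0" for \<epsilon>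
    using magnetic_sobolev[OF A s p2 ps dim that] H1_D unfolding I_def K_def sq_norm_def by metis
  have I_fin: "I \<psi> < \<infinity>" if "\<psi> \<in> H1 A" for \<psi>
    using sob[of 1] that by (auto intro: le_less_trans)
  have interp: "\<exists>C. \<forall>\<psi>\<in>H1 A. N \<psi> \<le> \<epsilon> * K \<psi> + C * sq_norm \<psi>" if e: "\<epsilon> > 0" for \<epsilon>
  proof -
    obtain C where C: "C > 0" "\<And>\<psi>. \<psi> \<in> H1 A \<Longrightarrow> I \<psi> \<le> ennreal ((\<epsilon> * K \<psi> + C * sq_norm \<psi>) powr (p / 2))"
      using sob[OF e] by blast
    have "N \<psi> \<le> \<epsilon> * K \<psi> + C * sq_norm \<psi>" if \<psi>: "\<psi> \<in> H1 A" for \<psi>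
    proof -
      have nn: "0 \<le> \<epsilon> * K \<psi> + C * sq_norm \<psi>"
        using e C(1) by (simp add: K_def sq_norm_nonneg)
      have "enn2real (I \<psi>) \<le> (\<epsilon> * K \<psi> + C * sq_norm \<psi>) powr (p / 2)"
        using C(2)[OF \<psi>] by (intro enn2real_leI) auto
      then have "N \<psi> \<le> ((\<epsilon> * K \<psi> + C * sq_norm \<psi>) powr (p / 2)) powr (2 / p)"
        unfolding N_def using p2 by (intro powr_mono2) auto
      then show ?thesis using nn p2 by (simp add: powr_powr)
    qed
    then show ?thesis by blast
  qed
  have Lp: "(Lnorm p \<psi>)\<^sup>2 = ereal (N \<psi>)" if "\<psi> \<in> H1 A" for \<psi>
    using I_fin[OF that] p2 unfolding N_def by (intro Lnorm_square_finite) (auto simp: I_def)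
  have L2: "(Lnorm 2 \<psi>)\<^sup>2 = ereal (sq_norm \<psi>)" "(Lnorm 2 (mag_grad A \<psi>))\<^sup>2 = ereal (K \<psi>)" if "\<psi> \<in> H1 A" for \<psi>
    using H1_D[OF that] by (simp_all add: Lnorm_2_square K_def)
  have gap': "K \<psi> \<ge> \<Lambda> * sq_norm \<psi>" if "\<psi> \<in> H1 A" for \<psi>
  proof -
    have "ereal \<Lambda> * (Lnorm 2 \<psi>)\<^sup>2 \<le> (Lnorm 2 (mag_grad A \<psi>))\<^sup>2" using gap that by blast
    then show ?thesis unfolding L2[OF that] by simp
  qed
  obtain \<psi>0 where \<psi>0: "\<psi>0 \<in> H1 A" "\<not> (AE x in lebesgue. \<psi>0 x = 0)" "K \<psi>0 = \<Lambda> * sq_norm \<psi>0"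
    using attained L2 by force
  have m0: "sq_norm \<psi>0 > 0" using sq_norm_pos[OF H1_D(1)] \<psi>0 by blast
  have N0: "N \<psi>0 > 0"
  proof -
    have "I \<psi>0 \<noteq> 0"
    proof
      assume "I \<psi>0 = 0"
      moreover have [measurable]: "\<psi>0 \<in> borel_measurable lebesgue" using H1_D(1)[OF \<psi>0(1)] by (simp add: Lspace_2)
      ultimately have "AE x in lebesgue. ennreal (norm (\<psi>0 x) powr p) = 0"
        unfolding I_def by (subst nn_integral_0_iff_AE[symmetric]) auto
      then have "AE x in lebesgue. \<psi>0 x = 0" by eventually_elim simp
      with \<psi>0 show False by simp
    qed
    then have "enn2real (I \<psi>0) > 0" using I_fin[OF \<psi>0(1)] by (simp add: enn2real_positive_iff zero_less_iff_neq_zero)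
    then show ?thesis by (simp add: N_def)
  qed
  have mu: "mu_B A p \<alpha> = (GREATEST c. \<forall>\<psi>\<in>H1 A. c * N \<psi> \<le> K \<psi> + \<alpha> * sq_norm \<psi>)" for \<alpha>
  proof -
    have "(\<forall>\<psi>\<in>H1 A. (Lnorm 2 (mag_grad A \<psi>))\<^sup>2 + ereal \<alpha> * (Lnorm 2 \<psi>)\<^sup>2 \<ge> ereal c * (Lnorm p \<psi>)\<^sup>2)
      \<longleftrightarrow> (\<forall>\<psi>\<in>H1 A. c * N \<psi> \<le> K \<psi> + \<alpha> * sq_norm \<psi>)" for c
      by (intro ball_cong refl) (simp add: L2 Lp)
    then show ?thesis by (simp add: mu_B_def)
  qed
  obtain \<alpha>0 where "\<alpha>0 > - \<Lambda>" "mu_B A p \<alpha>0 = t"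
    using optimal_constant_surj[of "H1 A" sq_norm \<Lambda> K \<psi>0 N t] gap' \<psi>0 m0 N0 interp t
    unfolding mu by (auto simp: sq_norm_nonneg)
  then have img: "t \<in> mu_B A p ` {- Lambda_B A<..}" using Lambda by auto
  define \<alpha> where "\<alpha> = alpha_B A p t"
  have \<alpha>_eq: "\<alpha> = inv_into {- Lambda_B A<..} (mu_B A p) t"
    using t by (simp add: \<alpha>_def alpha_B_def)
  have \<alpha>: "\<alpha> > - \<Lambda>" "mu_B A p \<alpha> = t"
    using inv_into_into[OF img] f_inv_into_f[OF img] by (simp_all add: \<alpha>_eq Lambda)
  \<comment> \<open>Nonnegativity of the right-hand side, required for the maximum to exist, follows
    from the gap and \<alpha> > -\<Lambda>.\<close>
  have "ereal ((GREATEST c. \<forall>\<psi>\<in>H1 A. ereal (c * N \<psi>) \<le> ereal (K \<psi> + \<alpha> * sq_norm \<psi>)) * N \<psi>)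
    \<le> ereal (K \<psi> + \<alpha> * sq_norm \<psi>)"
  proof (rule greatest_constant[where m = N and T = "\<lambda>\<psi>. ereal (K \<psi> + \<alpha> * sq_norm \<psi>)", OF _ _ \<psi>0(1) N0 _ \<psi>])
    fix \<psi> assume "\<psi> \<in> H1 A"
    moreover have "0 \<le> (\<Lambda> + \<alpha>) * sq_norm \<psi>" using \<alpha>(1) sq_norm_nonneg[of \<psi>] by (intro mult_nonneg_nonneg) auto
    ultimately have "0 \<le> K \<psi> + \<alpha> * sq_norm \<psi>" using gap'[of \<psi>] by (simp add: distrib_right)
    then show "0 \<le> ereal (K \<psi> + \<alpha> * sq_norm \<psi>)" by simp
  qed (auto simp: N_def)
  then have "t * N \<psi> \<le> K \<psi> + \<alpha> * sq_norm \<psi>" using \<alpha>(2) unfolding mu by simp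
  then show "t * enn2real (\<integral>\<^sup>+x. ennreal (norm (\<psi> x) powr p) \<partial>lebesgue) powr (2 / p)
      \<le> sq_norm (mag_grad A \<psi>) + alpha_B A p t * sq_norm \<psi>"
    by (simp add: N_def I_def K_def \<alpha>_def)
  show "(\<integral>\<^sup>+x. ennreal (norm (\<psi> x) powr p) \<partial>lebesgue) < \<infinity>"
    using I_fin[OF \<psi>] by (simp add: I_def)
qed

text \<open>The right-hand side may be infinite for some \<psi>, so the element of finite norm from
  \<open>H1_nonzero_finite_Lp\<close> is what bounds the admissible constants and makes the greatest
  one exist.\<close>

lemma nu_B_inequality:
  fixes A :: "real^'n \<Rightarrow> real^'n"
  assumes A: "loc_square_integrable A"
    and ne: "\<exists>\<psi>\<in>H1 A. \<not> (AE x in lebesgue. \<psi> x = 0)"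
    and p: "0 < p" "p \<le> 2" and \<beta>: "\<beta> > 0" and \<psi>: "\<psi> \<in> H1 A"
  shows "ereal (nu_B A p \<beta> * sq_norm \<psi>) \<le> ereal (sq_norm (mag_grad A \<psi>)) + ereal \<beta> * (Lnorm p \<psi>)\<^sup>2"
proof -
  have L2: "(Lnorm 2 \<psi>)\<^sup>2 = ereal (sq_norm \<psi>)" "(Lnorm 2 (mag_grad A \<psi>))\<^sup>2 = ereal (sq_norm (mag_grad A \<psi>))" if "\<psi> \<in> H1 A" for \<psi>
    using H1_D[OF that] by (simp_all add: Lnorm_2_square)
  obtain \<psi>1 where \<psi>1: "\<psi>1 \<in> H1 A" "sq_norm \<psi>1 > 0" "(\<integral>\<^sup>+x. ennreal (norm (\<psi>1 x) powr p) \<partial>lebesgue) < \<infinity>"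
    using ne H1_nonzero_finite_Lp[OF A p] by metis
  define T where "T = (\<lambda>\<psi>. ereal (sq_norm (mag_grad A \<psi>)) + ereal \<beta> * (Lnorm p \<psi>)\<^sup>2)"
  have "(\<forall>\<psi>\<in>H1 A. (Lnorm 2 (mag_grad A \<psi>))\<^sup>2 + ereal \<beta> * (Lnorm p \<psi>)\<^sup>2 \<ge> ereal c * (Lnorm 2 \<psi>)\<^sup>2)
      \<longleftrightarrow> (\<forall>\<psi>\<in>H1 A. ereal (c * sq_norm \<psi>) \<le> T \<psi>)" for c
    by (intro ball_cong refl) (simp add: L2 T_def)
  then have nu: "nu_B A p \<beta> = (GREATEST c. \<forall>\<psi>\<in>H1 A. ereal (c * sq_norm \<psi>) \<le> T \<psi>)"
    by (simp add: nu_B_def)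
  have "ereal (nu_B A p \<beta> * sq_norm \<psi>) \<le> T \<psi>"
    unfolding nu
  proof (rule greatest_constant[where m = sq_norm and T = T, OF _ _ \<psi>1(1,2) _ \<psi>])
    show "T \<psi> \<ge> 0" if "\<psi> \<in> H1 A" for \<psi>
      using \<beta> p by (simp add: T_def Lnorm_square_nonneg sq_norm_nonneg)
    show "T \<psi>1 < \<infinity>"
    proof -
      obtain n where "(\<integral>\<^sup>+x. ennreal (norm (\<psi>1 x) powr p) \<partial>lebesgue) = ennreal n" "n \<ge> 0"
        using \<psi>1(3) by (metis ennreal_cases infinity_ennreal_def less_irrefl)
      from Lnorm_square_finite[OF p(1) this] show ?thesis by (simp add: T_def)
    qed
  qed (rule sq_norm_nonneg)
  then show ?thesis by (simp add: T_def)
qed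

section \<open>From the interpolation inequalities to the spectral bounds\<close>

lemma admissible_D:
  assumes "\<psi> \<in> admissible A \<phi>"
  shows "\<psi> \<in> H1 A" "sq_norm \<psi> = 1"
    and "\<exists>B. (\<integral>\<^sup>+x. ennreal (max (\<phi> x) 0 * (norm (\<psi> x))\<^sup>2) \<partial>lebesgue) = ennreal B \<and> B \<ge> 0"
    and "c \<ge> 0 \<Longrightarrow> (\<integral>\<^sup>+x. ennreal c * ennreal ((norm (\<psi> x))\<^sup>2) \<partial>lebesgue) = ennreal c"
proof -
  show H: "\<psi> \<in> H1 A" using assms by (simp add: admissible_def)
  have "(\<integral>\<^sup>+x. ennreal (max (\<phi> x) 0 * (norm (\<psi> x))\<^sup>2) \<partial>lebesgue) < \<infinity>"
    using assms by (simp add: admissible_def)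
  then show "\<exists>B. (\<integral>\<^sup>+x. ennreal (max (\<phi> x) 0 * (norm (\<psi> x))\<^sup>2) \<partial>lebesgue) = ennreal B \<and> B \<ge> 0"
    by (intro exI[of _ "enn2real (\<integral>\<^sup>+x. ennreal (max (\<phi> x) 0 * (norm (\<psi> x))\<^sup>2) \<partial>lebesgue)"]) simp
  have "Lnorm 2 \<psi> = 1" using assms by (simp add: admissible_def)
  then show 1: "sq_norm \<psi> = 1" using Lnorm_2_square[OF H1_D(1)[OF H]] by (simp add: one_ereal_def)
  have [measurable]: "\<psi> \<in> borel_measurable lebesgue" using H1_D(1)[OF H] by (simp add: Lspace_2)
  show "(\<integral>\<^sup>+x. ennreal c * ennreal ((norm (\<psi> x))\<^sup>2) \<partial>lebesgue) = ennreal c" if "c \<ge> 0"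
    using nn_integral_sq_norm[OF H1_D(1)[OF H]] 1 by (simp add: nn_integral_cmult)
qed

text \<open>Hoelder with the conjugate exponents q and p/2 bounds the part of \<phi> below the level
  l by t times the squared norm of order p. The inequality defining \<alpha>(t) absorbs this into
  the kinetic energy, and normalization of \<psi> turns the level l into the additive
  constant.\<close>

lemma principal_eigenvalue_ge_alpha:
  fixes A :: "real^'n \<Rightarrow> real^'n"
  assumes A: "loc_square_integrable A" and dim: "CARD('n) \<ge> 2"
    and Lambda: "\<Lambda> = Lambda_B A"
    and gap: "\<forall>\<psi>\<in>H1 A. (Lnorm 2 (mag_grad A \<psi>))\<^sup>2 \<ge> ereal \<Lambda> * (Lnorm 2 \<psi>)\<^sup>2"
    and attained: "\<exists>\<psi>\<in>H1 A. \<not> (AE x in lebesgue. \<psi> x = 0) \<and>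
          (Lnorm 2 (mag_grad A \<psi>))\<^sup>2 = ereal \<Lambda> * (Lnorm 2 \<psi>)\<^sup>2"
    and \<phi>[measurable]: "\<phi> \<in> borel_measurable lebesgue"
    and q: "q > real CARD('n) / 2" and p: "p = 2 * q / (q - 1)"
    and fin: "Lnorm_pos q (\<lambda>x. l - \<phi> x) < \<infinity>"
  shows "principal_eigenvalue A \<phi> \<ge> ereal (- (alpha_B A p (enn2real (Lnorm_pos q (\<lambda>x. l - \<phi> x))) - l))"
  unfolding principal_eigenvalue_def
proof (rule INF_greatest)
  fix \<psi> assume \<psi>: "\<psi> \<in> admissible A \<phi>"
  note H = admissible_D[OF \<psi>]
  have [measurable]: "\<psi> \<in> borel_measurable lebesgue" using H1_D(1)[OF H(1)] by (simp add: Lspace_2)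
  have q1: "q > 1" using q dim by simp
  have p2: "p > 2" using q1 by (simp add: p field_simps)
  define V where "V = (\<lambda>x. max (l - \<phi> x) 0)"
  have [measurable]: "V \<in> borel_measurable lebesgue" unfolding V_def by measurable
  have V: "V x \<ge> 0" for x by (simp add: V_def)
  define t where "t = enn2real (Lnorm_pos q (\<lambda>x. l - \<phi> x))"
  have t0: "t \<ge> 0" by (simp add: t_def)
  have VI: "Lnorm_pos q (\<lambda>x. l - \<phi> x) = (\<integral>\<^sup>+x. ennreal (V x powr q) \<partial>lebesgue) epowr (1 / q)"
  proof -
    have "(\<integral>\<^sup>+x\<in>{x. l - \<phi> x > 0}. ennreal ((l - \<phi> x) powr q) \<partial>lebesgue) = (\<integral>\<^sup>+x. ennreal (V x powr q) \<partial>lebesgue)"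
      by (intro nn_integral_cong) (auto simp: V_def indicator_def max_def)
    then show ?thesis by (simp add: Lnorm_pos_def)
  qed
  define P where "P = enn2real (\<integral>\<^sup>+x. ennreal (V x powr q) \<partial>lebesgue)"
  have "(\<integral>\<^sup>+x. ennreal (V x powr q) \<partial>lebesgue) < \<infinity>"
    using fin unfolding VI by (auto simp: epowr_def less_top split: if_splits)
  then have P: "(\<integral>\<^sup>+x. ennreal (V x powr q) \<partial>lebesgue) = ennreal P" "P \<ge> 0" by (auto simp: P_def)
  have tP: "t = P powr (1 / q)" unfolding t_def VI P using P by (simp add: epowr_def)
  define n where "n = enn2real (\<integral>\<^sup>+x. ennreal (norm (\<psi> x) powr p) \<partial>lebesgue)"
  have key: "(\<integral>\<^sup>+x. ennreal (norm (\<psi> x) powr p) \<partial>lebesgue) = ennreal n \<and>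
    t * n powr (2 / p) \<le> sq_norm (mag_grad A \<psi>) + alpha_B A p t"
  proof (cases "t = 0")
    case False
    then have "t > 0" using t0 by simp
    from alpha_B_inequality[OF A dim Lambda gap attained q p this H(1)] show ?thesis
      using H(2) by (auto simp: n_def)
  next
    \<comment> \<open>At t = 0 the convention \<open>alpha_B A p 0 = - Lambda_B A\<close> reduces
      the inequality to the spectral gap. The norm of order p must still be finite, which is read
      off from \<open>alpha_B_inequality\<close> at the auxiliary value 1.\<close>
    case True
    have "(\<integral>\<^sup>+x. ennreal (norm (\<psi> x) powr p) \<partial>lebesgue) < \<infinity>"
      using alpha_B_inequality(1)[OF A dim Lambda gap attained q p zero_less_one H(1)] .
    moreover have "\<Lambda> \<le> sq_norm (mag_grad A \<psi>)"
      using gap H H1_D[OF H(1)] by (auto simp: Lnorm_2_square)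
    ultimately show ?thesis using True Lambda by (auto simp: n_def alpha_B_def)
  qed
  have Holder: "(\<integral>\<^sup>+x. ennreal (V x * (norm (\<psi> x))\<^sup>2) \<partial>lebesgue) \<le> ennreal (t * n powr (2 / p))"
  proof -
    have "(\<integral>\<^sup>+x. ennreal (V x * (norm (\<psi> x))\<^sup>2) \<partial>lebesgue) \<le> ennreal (P powr (1 / q) * n powr (1 / (p / 2)))"
    proof (rule nn_integral_Holder[OF q1 _ _ _ _ V _ P])
      show "p / 2 > 1" using p2 by simp
      show "1 / q + 1 / (p / 2) = 1" using q1 by (simp add: p field_simps)
      have "((norm (\<psi> x))\<^sup>2) powr (p / 2) = norm (\<psi> x) powr p" for x
      proof (cases "\<psi> x = 0")
        case False
        then have "(norm (\<psi> x))\<^sup>2 = norm (\<psi> x) powr 2" by simp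
        then show ?thesis by (simp only: powr_powr) simp
      qed (use p2 in simp)
      then show "(\<integral>\<^sup>+x. ennreal ((norm (\<psi> x))\<^sup>2 powr (p / 2)) \<partial>lebesgue) = ennreal n" using key by simp
      show "n \<ge> 0" by (simp add: n_def)
    qed auto
    then show ?thesis by (simp add: tP)
  qed
  obtain B where B: "(\<integral>\<^sup>+x. ennreal (max (\<phi> x) 0 * (norm (\<psi> x))\<^sup>2) \<partial>lebesgue) = ennreal B" "B \<ge> 0"
    using H(3) by blast
  define R where "R = (\<integral>\<^sup>+x. ennreal (max (- \<phi> x) 0 * (norm (\<psi> x))\<^sup>2) \<partial>lebesgue)"
  define r where "r = t * n powr (2 / p) + B - l"
  have "R + ennreal (max l 0) = (\<integral>\<^sup>+x. ennreal (max (- \<phi> x) 0 * (norm (\<psi> x))\<^sup>2) + ennreal (max l 0) * ennreal ((norm (\<psi> x))\<^sup>2) \<partial>lebesgue)"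
    by (subst nn_integral_add) (auto simp: R_def H(4))
  also have "\<dots> \<le> (\<integral>\<^sup>+x. ennreal (V x * (norm (\<psi> x))\<^sup>2) + ennreal (max (\<phi> x) 0 * (norm (\<psi> x))\<^sup>2)
      + ennreal (max (- l) 0) * ennreal ((norm (\<psi> x))\<^sup>2) \<partial>lebesgue)" (is "_ \<le> (\<integral>\<^sup>+x. ?h x \<partial>lebesgue)")
  proof (intro nn_integral_mono)
    fix x
    have "(max (- \<phi> x) 0 + max l 0) * (norm (\<psi> x))\<^sup>2 \<le> (V x + max (\<phi> x) 0 + max (- l) 0) * (norm (\<psi> x))\<^sup>2"
      by (intro mult_right_mono) (auto simp: V_def max_def)
    then have "ennreal (max (- \<phi> x) 0 * (norm (\<psi> x))\<^sup>2 + max l 0 * (norm (\<psi> x))\<^sup>2)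
      \<le> ennreal (V x * (norm (\<psi> x))\<^sup>2 + max (\<phi> x) 0 * (norm (\<psi> x))\<^sup>2 + max (- l) 0 * (norm (\<psi> x))\<^sup>2)"
      by (intro ennreal_leI) (simp only: distrib_right)
    then show "ennreal (max (- \<phi> x) 0 * (norm (\<psi> x))\<^sup>2) + ennreal (max l 0) * ennreal ((norm (\<psi> x))\<^sup>2)
      \<le> ?h x"
      using V by (simp add: ennreal_mult)
  qed
  also have "\<dots> = (\<integral>\<^sup>+x. ennreal (V x * (norm (\<psi> x))\<^sup>2) \<partial>lebesgue) + ennreal B + ennreal (max (- l) 0)"
    by (simp add: nn_integral_add B(1) H(4))
  also have "\<dots> \<le> ennreal (t * n powr (2 / p)) + ennreal B + ennreal (max (- l) 0)"
    by (intro add_right_mono Holder)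
  also have "\<dots> = ennreal (t * n powr (2 / p) + B + max (- l) 0)"
    using t0 B by simp
  finally have RL: "R + ennreal (max l 0) \<le> ennreal (t * n powr (2 / p) + B + max (- l) 0)" .
  have "R \<noteq> top" using RL by (auto simp: top_unique)
  then obtain \<rho> where \<rho>: "R = ennreal \<rho>" "\<rho> \<ge> 0" by (cases R) auto
  have "\<rho> + max l 0 \<le> t * n powr (2 / p) + B + max (- l) 0"
    using RL t0 B \<rho> by (simp add: ennreal_le_iff flip: ennreal_plus)
  then have "\<rho> \<le> r" by (auto simp: r_def max_def split: if_splits)
  then have R: "R \<le> ennreal r" "r \<ge> 0" using \<rho> by (auto intro: ennreal_leI)
  have "ereal (sq_norm (mag_grad A \<psi>) + B - r) \<le> energy A \<phi> \<psi>"
    using energy_ge[OF \<psi> \<phi> R(1)[unfolded R_def] R(2) B] .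
  moreover have "- (alpha_B A p t - l) \<le> sq_norm (mag_grad A \<psi>) + B - r"
    using key by (simp add: r_def)
  ultimately show "ereal (- (alpha_B A p (enn2real (Lnorm_pos q (\<lambda>x. l - \<phi> x))) - l)) \<le> energy A \<phi> \<psi>"
    unfolding t_def[symmetric] using order_trans ereal_less_eq(3) by blast
qed

text \<open>Reverse Hoelder: |\<psi>|^p factors as (V|\<psi>|^2)^(p/2) * V^(-p/2), to which Hoelder
  with exponents 2/p and q + 1 is applied. Solving for the integral of V|\<psi>|^2 bounds it from
  below by \<beta> = Q^(-1/q) times the squared norm of order p, with Q the integral of
  V^(-q).\<close>

lemma principal_eigenvalue_ge_nu:
  fixes A :: "real^'n \<Rightarrow> real^'n"
  assumes A: "loc_square_integrable A"
    and ne: "\<exists>\<psi>\<in>H1 A. \<not> (AE x in lebesgue. \<psi> x = 0)"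
    and \<phi>[measurable]: "\<phi> \<in> borel_measurable lebesgue"
    and q: "q > 1" and p: "p = 2 * q / (q + 1)" and l: "AE x in lebesgue. \<phi> x \<ge> l"
    and fin: "Lnorm_abs q (\<lambda>x. inverse (ennreal (\<phi> x - l))) < \<infinity>"
  shows "principal_eigenvalue A \<phi> \<ge>
    ereal (l + nu_B A p (inverse (enn2real (Lnorm_abs q (\<lambda>x. inverse (ennreal (\<phi> x - l)))))))"
  unfolding principal_eigenvalue_def
proof (rule INF_greatest)
  fix \<psi> assume \<psi>: "\<psi> \<in> admissible A \<phi>"
  note H = admissible_D[OF \<psi>]
  have [measurable]: "\<psi> \<in> borel_measurable lebesgue" using H1_D(1)[OF H(1)] by (simp add: Lspace_2)
  have p2: "p > 0" "p \<le> 2" "2 / p > 1" using q by (simp_all add: p field_simps)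
  have conj: "1 / (2 / p) + 1 / (q + 1) = 1"
  proof -
    have "1 / (2 / p) = q / (q + 1)" using q by (simp add: p divide_simps)
    then show ?thesis using q by (simp only: add_divide_distrib[symmetric]) simp
  qed
  define V where "V = (\<lambda>x. max (\<phi> x - l) 0)"
  have [measurable]: "V \<in> borel_measurable lebesgue" unfolding V_def by measurable
  have V: "V x \<ge> 0" for x by (simp add: V_def)
  define J where "J = (\<integral>\<^sup>+x. inverse (ennreal (\<phi> x - l)) epowr q \<partial>lebesgue)"
  have LJ: "Lnorm_abs q (\<lambda>x. inverse (ennreal (\<phi> x - l))) = J epowr (1 / q)"
    by (simp add: Lnorm_abs_def J_def)
  have J_fin: "J < \<infinity>" using fin unfolding LJ by (auto simp: epowr_def less_top split: if_splits)
  \<comment> \<open>Where \<phi> \<le> l, \<open>ennreal\<close> gives 0, whose inverse is infinite.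
    Finiteness of J therefore forces V > 0 almost everywhere.\<close>
  have inv_eq: "inverse (ennreal (\<phi> x - l)) epowr q = (if V x > 0 then ennreal (V x powr (- q)) else top)" for x
    by (auto simp: V_def epowr_def inverse_ennreal ennreal_neg powr_minus inverse_powr max_def)
  have J_eq: "J = (\<integral>\<^sup>+x. (if V x > 0 then ennreal (V x powr (- q)) else top) \<partial>lebesgue)"
    unfolding J_def inv_eq ..
  have "AE x in lebesgue. (if V x > 0 then ennreal (V x powr (- q)) else top) \<noteq> (\<infinity>::ennreal)"
    using J_fin unfolding J_eq by (intro nn_integral_PInf_AE) auto
  then have V_pos: "AE x in lebesgue. V x > 0" by eventually_elim (auto split: if_splits)
  define Q where "Q = enn2real J"
  have JQ: "J = ennreal Q" "Q \<ge> 0" using J_fin by (auto simp: Q_def)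
  have Q_int: "(\<integral>\<^sup>+x. ennreal (V x powr (- q)) \<partial>lebesgue) = ennreal Q"
    unfolding JQ(1)[symmetric] J_eq by (intro nn_integral_cong_AE) (use V_pos in eventually_elim, simp)
  \<comment> \<open>Q = 0 would make V^(-q) vanish almost everywhere although V > 0, which is
    possible only if almost every statement holds; then \<psi> = 0 almost everywhere, against its
    normalization.\<close>
  have Q_pos: "Q > 0"
  proof (rule ccontr)
    assume "\<not> Q > 0"
    then have "(\<integral>\<^sup>+x. ennreal (V x powr (- q)) \<partial>lebesgue) = 0" using Q_int JQ(2) by simp
    then have "AE x in lebesgue. ennreal (V x powr (- q)) = 0"
      by (subst nn_integral_0_iff_AE[symmetric]) auto
    then have "AE x in lebesgue. \<psi> x = 0" using V_pos by eventually_elim simp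
    then have "sq_norm \<psi> = 0"
      unfolding sq_norm_def by (subst nn_integral_0_iff_AE[THEN iffD2]) auto
    with H(2) show False by simp
  qed
  define \<beta> where "\<beta> = inverse (Q powr (1 / q))"
  have \<beta>: "\<beta> > 0" using Q_pos by (simp add: \<beta>_def)
  have \<beta>_eq: "inverse (enn2real (Lnorm_abs q (\<lambda>x. inverse (ennreal (\<phi> x - l))))) = \<beta>"
    unfolding LJ JQ(1) \<beta>_def using JQ(2) by (simp add: epowr_def)
  obtain B where B: "(\<integral>\<^sup>+x. ennreal (max (\<phi> x) 0 * (norm (\<psi> x))\<^sup>2) \<partial>lebesgue) = ennreal B" "B \<ge> 0"
    using H(3) by blast
  define R where "R = (\<integral>\<^sup>+x. ennreal (max (- \<phi> x) 0 * (norm (\<psi> x))\<^sup>2) \<partial>lebesgue)"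
  define W where "W = (\<integral>\<^sup>+x. ennreal (V x * (norm (\<psi> x))\<^sup>2) \<partial>lebesgue)"
  \<comment> \<open>\<phi> = l + V almost everywhere, rearranged so that every term is nonnegative.
    Being an equality with finite right-hand side, it shows that R and W are both finite and
    determines R from W.\<close>
  have "R + ennreal (max l 0) + W = (\<integral>\<^sup>+x. ennreal (max (- \<phi> x) 0 * (norm (\<psi> x))\<^sup>2)
      + ennreal (max l 0) * ennreal ((norm (\<psi> x))\<^sup>2) + ennreal (V x * (norm (\<psi> x))\<^sup>2) \<partial>lebesgue)"
    by (simp add: nn_integral_add R_def W_def H(4))
  also have "\<dots> = (\<integral>\<^sup>+x. ennreal (max (\<phi> x) 0 * (norm (\<psi> x))\<^sup>2) + ennreal (max (- l) 0) * ennreal ((norm (\<psi> x))\<^sup>2) \<partial>lebesgue)"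
  proof (rule nn_integral_cong_AE)
    show "AE x in lebesgue. ennreal (max (- \<phi> x) 0 * (norm (\<psi> x))\<^sup>2)
      + ennreal (max l 0) * ennreal ((norm (\<psi> x))\<^sup>2) + ennreal (V x * (norm (\<psi> x))\<^sup>2)
      = ennreal (max (\<phi> x) 0 * (norm (\<psi> x))\<^sup>2) + ennreal (max (- l) 0) * ennreal ((norm (\<psi> x))\<^sup>2)"
      using l
    proof eventually_elim
      case (elim x)
      have "(max (- \<phi> x) 0 + max l 0 + V x) * (norm (\<psi> x))\<^sup>2 = (max (\<phi> x) 0 + max (- l) 0) * (norm (\<psi> x))\<^sup>2"
        using elim by (intro arg_cong2[where f = "(*)"]) (auto simp: V_def max_def)
      then have "ennreal (max (- \<phi> x) 0 * (norm (\<psi> x))\<^sup>2 + max l 0 * (norm (\<psi> x))\<^sup>2 + V x * (norm (\<psi> x))\<^sup>2)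
        = ennreal (max (\<phi> x) 0 * (norm (\<psi> x))\<^sup>2 + max (- l) 0 * (norm (\<psi> x))\<^sup>2)"
        by (simp only: distrib_right)
      then show ?case using V by (simp add: ennreal_mult)
    qed
  qed
  also have "\<dots> = ennreal (B + max (- l) 0)"
    using B by (simp add: nn_integral_add H(4))
  finally have RW: "R + ennreal (max l 0) + W = ennreal (B + max (- l) 0)" .
  have "R \<noteq> top" "W \<noteq> top" using RW by auto
  then obtain r w where rw: "R = ennreal r" "r \<ge> 0" "W = ennreal w" "w \<ge> 0" by (cases R; cases W) auto
  have "r + max l 0 + w = B + max (- l) 0"
    using RW rw B by (simp add: ennreal_inj flip: ennreal_plus)
  then have r_eq: "r = B - l - w" by (auto simp: max_def split: if_splits)
  have energy: "ereal (sq_norm (mag_grad A \<psi>) + l + w) \<le> energy A \<phi> \<psi>"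
    using energy_ge[OF \<psi> \<phi> _ rw(2) B] rw(1) by (simp add: R_def r_eq add.assoc)
  have powers: "(V x * (norm (\<psi> x))\<^sup>2) powr (p / 2) * V x powr (- (p / 2)) = norm (\<psi> x) powr p" if "V x > 0" for x
  proof (cases "\<psi> x = 0")
    case False
    then have "((norm (\<psi> x))\<^sup>2) powr (p / 2) = norm (\<psi> x) powr p"
      by (simp add: powr_powr flip: powr_numeral)
    then show ?thesis using that by (simp add: powr_mult powr_minus)
  qed (use p2 in simp)
  have "(\<integral>\<^sup>+x. ennreal (norm (\<psi> x) powr p) \<partial>lebesgue)
    = (\<integral>\<^sup>+x. ennreal ((V x * (norm (\<psi> x))\<^sup>2) powr (p / 2) * V x powr (- (p / 2))) \<partial>lebesgue)"
    by (intro nn_integral_cong_AE) (use V_pos in eventually_elim, simp add: powers)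
  also have "\<dots> \<le> ennreal (w powr (1 / (2 / p)) * Q powr (1 / (q + 1)))"
  proof (rule nn_integral_Holder[OF p2(3) _ conj])
    have "((V x * (norm (\<psi> x))\<^sup>2) powr (p / 2)) powr (2 / p) = V x * (norm (\<psi> x))\<^sup>2" for x
      using p2 V by (simp add: powr_powr)
    then show "(\<integral>\<^sup>+x. ennreal (((V x * (norm (\<psi> x))\<^sup>2) powr (p / 2)) powr (2 / p)) \<partial>lebesgue) = ennreal w"
      using rw(3) by (simp add: W_def)
    \<comment> \<open>p/2 = q/(q+1), so the second Hoelder exponent turns V^(-p/2) into exactly the
      integrand of Q.\<close>
    have "- (p / 2) * (q + 1) = - q" using q by (simp add: p field_simps)
    then have "(V x powr (- (p / 2))) powr (q + 1) = V x powr (- q)" for x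
      by (simp only: powr_powr)
    then show "(\<integral>\<^sup>+x. ennreal ((V x powr (- (p / 2))) powr (q + 1)) \<partial>lebesgue) = ennreal Q"
      using Q_int by simp
  qed (use q rw JQ in auto)
  finally have le: "(\<integral>\<^sup>+x. ennreal (norm (\<psi> x) powr p) \<partial>lebesgue) \<le> ennreal (w powr (p / 2) * Q powr (1 / (q + 1)))"
    by simp
  define n where "n = enn2real (\<integral>\<^sup>+x. ennreal (norm (\<psi> x) powr p) \<partial>lebesgue)"
  have "(\<integral>\<^sup>+x. ennreal (norm (\<psi> x) powr p) \<partial>lebesgue) < \<infinity>"
    by (rule le_less_trans[OF le]) simp
  then have n: "(\<integral>\<^sup>+x. ennreal (norm (\<psi> x) powr p) \<partial>lebesgue) = ennreal n" "n \<ge> 0"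
    "n \<le> w powr (p / 2) * Q powr (1 / (q + 1))"
    using le by (auto simp: n_def intro: enn2real_leI)
  have "n powr (2 / p) \<le> (w powr (p / 2) * Q powr (1 / (q + 1))) powr (2 / p)"
    using n p2 by (intro powr_mono2) auto
  also have "\<dots> = w * Q powr (1 / q)"
  proof -
    \<comment> \<open>This exponent turns Q^(1/(q+1)) into Q^(1/q), which is 1/\<beta>.\<close>
    have "2 / p = (q + 1) / q" unfolding p divide_divide_eq_right by (rule mult_divide_mult_cancel_left) simp
    then have "1 / (q + 1) * (2 / p) = 1 / q" using q by simp
    then have "(Q powr (1 / (q + 1))) powr (2 / p) = Q powr (1 / q)" by (simp only: powr_powr)
    moreover have "(w powr (p / 2)) powr (2 / p) = w" using rw p2 by (simp add: powr_powr)
    ultimately show ?thesis by (simp add: powr_mult)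
  qed
  finally have "\<beta> * n powr (2 / p) \<le> w"
    using Q_pos by (simp add: \<beta>_def field_simps)
  moreover have "nu_B A p \<beta> \<le> sq_norm (mag_grad A \<psi>) + \<beta> * n powr (2 / p)"
    using nu_B_inequality[OF A ne p2(1,2) \<beta> H(1)] H(2) by (simp add: Lnorm_square_finite[OF p2(1) n(1,2)])
  ultimately have "l + nu_B A p \<beta> \<le> sq_norm (mag_grad A \<psi>) + l + w" by simp
  then show "ereal (l + nu_B A p (inverse (enn2real (Lnorm_abs q (\<lambda>x. inverse (ennreal (\<phi> x - l)))))))
      \<le> energy A \<phi> \<psi>"
    unfolding \<beta>_eq using energy order_trans ereal_less_eq(3) by blast
qed

theorem proposition2p1:
  fixes A :: "real^'n \<Rightarrow> real^'n" and \<phi> :: "real^'n \<Rightarrow> real" and r \<Lambda> :: real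
  assumes dim: "CARD('n) = 2 \<and> r > 2 \<or> CARD('n) = 3 \<and> r = 3"
    and A: "A \<in> Lloc r"
    and Lambda: "\<Lambda> = Lambda_B A" "\<Lambda> > 0"
    and gap: "\<forall>\<psi>\<in>H1 A. (Lnorm 2 (mag_grad A \<psi>))\<^sup>2 \<ge> ereal \<Lambda> * (Lnorm 2 \<psi>)\<^sup>2"
    and attained: "\<exists>\<psi>\<in>H1 A. \<not> (AE x in lebesgue. \<psi> x = 0) \<and>
          (Lnorm 2 (mag_grad A \<psi>))\<^sup>2 = ereal \<Lambda> * (Lnorm 2 \<psi>)\<^sup>2"
    and \<phi>: "\<phi> \<in> Lloc 1"
  shows
    "(((\<lambda>\<sigma>. ennreal (\<sigma> ^ (CARD('n) - 2)) *
          (\<integral>\<^sup>+ x. ennreal ((norm (A x))\<^sup>2 * exp (- \<sigma> * norm x)) \<partial>lebesgue)) \<longlongrightarrow> 0) at_top \<longrightarrow>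
      (\<forall>q p l :: real. q > real CARD('n) / 2 \<longrightarrow> p = 2 * q / (q - 1) \<longrightarrow>
         Lnorm_pos q (\<lambda>x. l - \<phi> x) < \<infinity> \<longrightarrow>
         principal_eigenvalue A \<phi> \<ge>
           ereal (- (alpha_B A p (enn2real (Lnorm_pos q (\<lambda>x. l - \<phi> x))) - l))))
     \<and>
     (((\<lambda>\<sigma>. ennreal (\<sigma> ^ (CARD('n) - 2)) *
          (\<integral>\<^sup>+ x\<in>{x. norm x < 1 / \<sigma>}. ennreal ((norm (A x))\<^sup>2) \<partial>lebesgue)) \<longlongrightarrow> 0) at_top \<longrightarrow>
      (\<forall>q p l :: real. q > 1 \<longrightarrow> p = 2 * q / (q + 1) \<longrightarrow>
         (AE x in lebesgue. \<phi> x \<ge> l) \<longrightarrow>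
         Lnorm_abs q (\<lambda>x. inverse (ennreal (\<phi> x - l))) < \<infinity> \<longrightarrow>
         principal_eigenvalue A \<phi> \<ge>
           ereal (l + nu_B A p (inverse (enn2real (Lnorm_abs q (\<lambda>x. inverse (ennreal (\<phi> x - l)))))))))"
proof -
  have A2: "loc_square_integrable A"
    using Lloc_loc_square_integrable[OF A] dim by auto
  have d2: "CARD('n) \<ge> 2" using dim by auto
  have \<phi>_meas: "\<phi> \<in> borel_measurable lebesgue" using \<phi> by (simp add: Lloc_def)
  have ne: "\<exists>\<psi>\<in>H1 A. \<not> (AE x in lebesgue. \<psi> x = 0)" using attained by blast
  show ?thesis
    using principal_eigenvalue_ge_alpha[OF A2 d2 Lambda(1) gap attained \<phi>_meas]
      principal_eigenvalue_ge_nu[OF A2 ne \<phi>_meas] by blast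
qed

end
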